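(* Let $G$ be a $3$-dimensional non-unimodular Lie group with Lie algebra $\mathfrak{g}$ and unimodular kernel $\mathfrak{u}$, and $g$ a left-invariant pseudo-Riemannian metric on $G$ with $g|_{\mathfrak{u}\times\mathfrak{u}}$ degenerate. Let $(v_a)_{1\le a\le3}$ be a $g$-orthonormal basis of $\mathfrak{g}$ with $\epsilon_a=g(v_a,v_a)$, $\epsilon_1=\epsilon_2=-\epsilon_3$ and $$[v_1,v_2]=\epsilon_1(\lambda v_1+\mu v_2+\mu v_3),\quad[v_2,v_3]=-\epsilon_1(\nu v_1+\rho v_2+\rho v_3),\quad[v_3,v_1]=\epsilon_1(\lambda v_1+\mu v_2+\mu v_3),$$ where $\lambda,\mu,\nu,\rho\in\mathbb{R}$, $\lambda+\rho\neq0$. Let $E_{H,F}$ be a Courant algebroid of type $B_3$ over $G$ with left-invariant $H=h\,v_1^*\wedge v_2^*\wedge v_3^*$ and $F=\frac12F_{ab}v_a^*\wedge v_b^*\neq0$ (closedness of $F$ means $F_{12}+F_{13}=0$), and $\delta\in(\mathfrak{g}\oplus\mathfrak{g}^*\oplus\mathbb{R})^*$ a left-invariant divergence operator, $\delta_A=\delta(e_A)$. Then $E_-=\{X-g(X)\mid X\in TG\}$ is generalized Einstein with divergence $\delta$ on $E_{H,F}$ if and only if it belongs to one of the following two families: 1) $\lambda+\rho\neq0$, $\nu=F_{23}=h=0$, $F_{13}=-F_{12}$, $$(F_{12})^2=-\epsilon_1(\lambda^2+\rho^2)+\rho\delta_2>0,$$ $$\rho(\delta_2-\delta_5)=0,\quad\delta_3=-\delta_2,\quad\delta_6=-\delta_5,\quad\delta_0=\delta_1=\delta_4=0;$$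 2) $\nu(\lambda+\rho)\neq0$, $F_{23}=\epsilon\nu$ (where $\epsilon=\pm1$), $F_{12}=-F_{13}=-\epsilon\lambda$, $\epsilon_1=-1$, $h=\nu$, $\delta_0=-\epsilon\delta_1$ and $$(\lambda\rho-\mu\nu)(\delta_1+\nu)=(\lambda\rho-\mu\nu)(\delta_1-\delta_4)=0,$$ $$\delta_3=-\delta_2=\lambda+\rho+\frac\lambda\nu\delta_1,\qquad\delta_6=-\delta_5=\lambda+\rho+\frac\lambda\nu\delta_4.$$
   Context: $\mathfrak{u}=\{x\in\mathfrak{g}\mid\mathrm{tr}\,\mathrm{ad}_x=0\}$. When $g|_{\mathfrak{u}\times\mathfrak{u}}$ is degenerate, a basis $(v_a)$ as in the claim exists (known fact). Basis of $\tilde E=\mathfrak{g}\oplus\mathfrak{g}^*\oplus\mathbb{R}$: $e_0=1$, $e_a=v_a+g(v_a)$, $e_{a+3}=v_a-g(v_a)$ for $1\le a\le3$, where $g(X)=g(X,\cdot)$; $F_{ab}=F(v_a,v_b)$. Courant algebroid of type $B_3$: for left-invariant $H\in\Omega^3(G)$, $F\in\Omega^2(G)$ with $dF=0$, $E=E_{H,F}$ is the bundle $TG\oplus T^*G\oplus\mathbb{R}$ with anchor $\pi$ the projection to $TG$, scalar product $\langle X+\xi+\lambda,Y+\eta+\mu\rangle=\frac12(\xi(Y)+\eta(X))+\lambda\mu$ and Dorfman bracket $$[X+\xi+\lambda,Y+\eta+\mu]_{H,F}=\mathcal{L}_X(Y+\eta)-i_Yd\xi+2\mu\,d\lambda+i_Xi_YH-2(\mu\,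 i_XF-\lambda\, i_YF)+X(\mu)-Y(\lambda)+F(X,Y).$$ Left-invariant sections of $E$ (for the action of $G$ by left translations, trivial on the $\mathbb{R}$-fibre) form $\tilde E$. For $E_-=\{X-g(X)\mid X\in TG\}$ put $E_+=E_-^\perp$. A generalized connection is a linear map $D:\Gamma(E)\to\Gamma(E^*\otimes E)$ with $D_u(fv)=\pi(u)(f)v+fD_uv$ and $\pi(u)\langle v,w\rangle=\langle D_uv,w\rangle+\langle v,D_uw\rangle$. Its torsion is $T^D(u,v,w)=\langle D_uv-D_vu-[u,v]_{H,F},w\rangle+\langle v,D_wu\rangle$; $D$ is Levi-Civita for $E_-$ if $T^D=0$ and $D_u\Gamma(E_-)\subset\Gamma(E_-)$ for all $u$. A divergence operator is an additive map $\delta:\Gamma(E)\to C^\infty(G)$ with $\delta(fu)=\pi(u)(f)+f\delta(u)$; it is left-invariant if constant on left-invariant sections, and is then identified with an element of $\tilde E^*$; $\delta^D(u)=\mathrm{tr}\,Du$. For a Levi-Civita generalized connection $D$ of $E_-$ with $\delta^D=\delta$, put $R^D(u,v)w=D_uD_vw-D_vD_uw-D_{[u,v]_{H,F}}w$ and $\mathrm{Ric}^{\delta,+}(u,v)=\mathrm{tr}(E_+\ni w\mapsto R^D(w,u)v)$ ($u\in E_-,v\in E_+$), $\mathrm{Ric}^{\delta,-}(u,v)=\mathrm{tr}(E_-\ni w\mapsto R^D(w,u)v)$ ($u\in E_+,v\in E_-$). These are tensors depending only on $(E_-,\delta)$. $E_-$ is generalized Einstein with divergence $\delta$ if $\mathrm{Ric}^{\delta,+}=0$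 and $\mathrm{Ric}^{\delta,-}=0$. *)

theory Defs
  imports
    "HOL-Analysis.Analysis"
    "HOL-Algebra.Group"
    "HOL-Library.Function_Algebras"
begin

section \<open>Smooth maps and three-dimensional Lie groups\<close>

text \<open>Only meant for open \<open>S\<close>.\<close>

primrec Ck_on :: "nat \<Rightarrow> 'a::real_normed_vector set \<Rightarrow> ('a \<Rightarrow> 'b::real_normed_vector) \<Rightarrow> bool" where
  "Ck_on 0 S f \<longleftrightarrow> continuous_on S f"
| "Ck_on (Suc k) S f \<longleftrightarrow>
     (\<forall>x\<in>S. f differentiable (at x)) \<and> (\<forall>v. Ck_on k S (\<lambda>x. frechet_derivative f (at x) v))"

definition smooth_on :: "'a::real_normed_vector set \<Rightarrow> ('a \<Rightarrow> 'b::real_normed_vector) \<Rightarrow> bool" where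
  "smooth_on S f \<longleftrightarrow> (\<forall>k. Ck_on k S f)"

text \<open>The underlying point set of the group is the whole type \<open>'g\<close>, and its topology is the
  type class topology; a chart is a pair of a domain and a coordinate map.\<close>

record 'g lie_group = "'g monoid" +
  charts :: "('g set \<times> ('g \<Rightarrow> real ^ 3)) set"

definition is_chart :: "'g::topological_space set \<times> ('g \<Rightarrow> real ^ 3) \<Rightarrow> bool" where
  "is_chart = (\<lambda>(U, \<phi>). open U \<and> open (\<phi> ` U) \<and> homeomorphism U (\<phi> ` U) \<phi> (inv_into U \<phi>))"

definition lie_group3 :: "('g::{t2_space, second_countable_topology}) lie_group \<Rightarrow> bool" where
  "lie_group3 G \<longleftrightarrow>
     group G \<and> carrier G = UNIV \<and>
     (\<forall>c\<in>charts G. is_chart c) \<and> (\<Union>(U, \<phi>)\<in>charts G. U) = UNIV \<and>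
     (\<forall>(U, \<phi>)\<in>charts G. \<forall>(V, \<psi>)\<in>charts G. smooth_on (\<phi> ` (U \<inter> V)) (\<psi> \<circ> inv_into U \<phi>)) \<and>
     continuous_on UNIV (\<lambda>(a, b). a \<otimes>\<^bsub>G\<^esub> b) \<and>
     (\<forall>(U, \<phi>)\<in>charts G. \<forall>(V, \<psi>)\<in>charts G. \<forall>(W, \<kappa>)\<in>charts G.
        smooth_on {(x, y). x \<in> \<phi> ` U \<and> y \<in> \<psi> ` V \<and> inv_into U \<phi> x \<otimes>\<^bsub>G\<^esub> inv_into V \<psi> y \<in> W}
          (\<lambda>(x, y). \<kappa> (inv_into U \<phi> x \<otimes>\<^bsub>G\<^esub> inv_into V \<psi> y))) \<and>
     continuous_on UNIV (\<lambda>a. inv\<^bsub>G\<^esub> a) \<and>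
     (\<forall>(U, \<phi>)\<in>charts G. \<forall>(W, \<kappa>)\<in>charts G.
        smooth_on {x. x \<in> \<phi> ` U \<and> inv\<^bsub>G\<^esub> (inv_into U \<phi> x) \<in> W}
          (\<lambda>x. \<kappa> (inv\<^bsub>G\<^esub> (inv_into U \<phi> x))))"


section \<open>Functions, vector fields and differential forms\<close>

text \<open>Sums and products of functions are pointwise. Vector fields are the derivations of
  \<open>C\<^sup>\<infinity>(G)\<close>, and \<open>k\<close>-forms are the alternating \<open>C\<^sup>\<infinity>(G)\<close>-multilinear
  maps from vector fields to functions. All of these are made into total functions by the
  value \<open>0\<close> outside their domain, so that HOL equality is equality of fields and forms.\<close>

type_synonym 'g cfun = "'g \<Rightarrow> real"
type_synonym 'g vfield = "'g cfun \<Rightarrow> 'g cfun"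
type_synonym 'g form1 = "'g vfield \<Rightarrow> 'g cfun"
type_synonym 'g tensor2 = "'g vfield \<Rightarrow> 'g form1"
type_synonym 'g tensor3 = "'g vfield \<Rightarrow> 'g tensor2"

definition const_fun :: "real \<Rightarrow> 'g cfun" where
  "const_fun c = (\<lambda>_. c)"

definition smooth_functions :: "'g lie_group \<Rightarrow> 'g cfun set" where
  "smooth_functions G = {f. \<forall>(U, \<phi>)\<in>charts G. smooth_on (\<phi> ` U) (f \<circ> inv_into U \<phi>)}"

definition cscale :: "'g cfun \<Rightarrow> ('x \<Rightarrow> 'g cfun) \<Rightarrow> ('x \<Rightarrow> 'g cfun)" where
  "cscale f t = (\<lambda>x. f * t x)"

definition rscale :: "real \<Rightarrow> ('x \<Rightarrow> 'g cfun) \<Rightarrow> ('x \<Rightarrow> 'g cfun)" where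
  "rscale c t = cscale (const_fun c) t"

definition zero_outside :: "'x set \<Rightarrow> ('x \<Rightarrow> 'y::zero) \<Rightarrow> 'x \<Rightarrow> 'y" where
  "zero_outside S f = (\<lambda>x. if x \<in> S then f x else 0)"

definition vector_fields :: "'g lie_group \<Rightarrow> 'g vfield set" where
  "vector_fields G = {X.
     (\<forall>f\<in>smooth_functions G. X f \<in> smooth_functions G) \<and>
     (\<forall>f\<in>smooth_functions G. \<forall>h\<in>smooth_functions G. X (f + h) = X f + X h) \<and>
     (\<forall>c. \<forall>f\<in>smooth_functions G. X (const_fun c * f) = const_fun c * X f) \<and>
     (\<forall>f\<in>smooth_functions G. \<forall>h\<in>smooth_functions G. X (f * h) = X f * h + f * X h) \<and>
     (\<forall>f. f \<notin> smooth_functions G \<longrightarrow> X f = 0)}"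

definition lie_bracket :: "'g vfield \<Rightarrow> 'g vfield \<Rightarrow> 'g vfield" where
  "lie_bracket X Y = (\<lambda>f. X (Y f) - Y (X f))"

definition one_forms :: "'g lie_group \<Rightarrow> 'g form1 set" where
  "one_forms G = {\<xi>.
     (\<forall>X\<in>vector_fields G. \<xi> X \<in> smooth_functions G) \<and>
     (\<forall>X\<in>vector_fields G. \<forall>Y\<in>vector_fields G. \<xi> (X + Y) = \<xi> X + \<xi> Y) \<and>
     (\<forall>f\<in>smooth_functions G. \<forall>X\<in>vector_fields G. \<xi> (cscale f X) = f * \<xi> X) \<and>
     (\<forall>X. X \<notin> vector_fields G \<longrightarrow> \<xi> X = 0)}"

definition two_forms :: "'g lie_group \<Rightarrow> 'g tensor2 set" where
  "two_forms G = {\<omega>.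
     (\<forall>X\<in>vector_fields G. \<omega> X \<in> one_forms G) \<and>
     (\<forall>X\<in>vector_fields G. \<forall>Y\<in>vector_fields G. \<omega> X Y = - \<omega> Y X) \<and>
     (\<forall>X. X \<notin> vector_fields G \<longrightarrow> \<omega> X = 0)}"

definition three_forms :: "'g lie_group \<Rightarrow> 'g tensor3 set" where
  "three_forms G = {\<omega>.
     (\<forall>X\<in>vector_fields G. \<omega> X \<in> two_forms G) \<and>
     (\<forall>X\<in>vector_fields G. \<forall>Y\<in>vector_fields G. \<omega> X Y = - \<omega> Y X) \<and>
     (\<forall>X. X \<notin> vector_fields G \<longrightarrow> \<omega> X = 0)}"

definition wedge2 :: "'g form1 \<Rightarrow> 'g form1 \<Rightarrow> 'g tensor2" where
  "wedge2 \<alpha> \<beta> = (\<lambda>X Y. \<alpha> X * \<beta> Y - \<alpha> Y * \<beta> X)"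

definition wedge3 :: "'g form1 \<Rightarrow> 'g form1 \<Rightarrow> 'g form1 \<Rightarrow> 'g tensor3" where
  "wedge3 \<alpha> \<beta> \<gamma> =
     (\<lambda>X Y Z. \<alpha> X * wedge2 \<beta> \<gamma> Y Z - \<alpha> Y * wedge2 \<beta> \<gamma> X Z + \<alpha> Z * wedge2 \<beta> \<gamma> X Y)"

definition ext_deriv0 :: "'g lie_group \<Rightarrow> 'g cfun \<Rightarrow> 'g form1" where
  "ext_deriv0 G f = zero_outside (vector_fields G) (\<lambda>X. X f)"

definition ext_deriv1 :: "'g lie_group \<Rightarrow> 'g form1 \<Rightarrow> 'g tensor2" where
  "ext_deriv1 G \<xi> = zero_outside (vector_fields G) (\<lambda>X. zero_outside (vector_fields G) (\<lambda>Y.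
     X (\<xi> Y) - Y (\<xi> X) - \<xi> (lie_bracket X Y)))"

definition closed2 :: "'g lie_group \<Rightarrow> 'g tensor2 \<Rightarrow> bool" where
  "closed2 G \<omega> \<longleftrightarrow>
     (\<forall>X\<in>vector_fields G. \<forall>Y\<in>vector_fields G. \<forall>Z\<in>vector_fields G.
        X (\<omega> Y Z) - Y (\<omega> X Z) + Z (\<omega> X Y)
        - \<omega> (lie_bracket X Y) Z + \<omega> (lie_bracket X Z) Y - \<omega> (lie_bracket Y Z) X = 0)"

definition lie_deriv1 :: "'g lie_group \<Rightarrow> 'g vfield \<Rightarrow> 'g form1 \<Rightarrow> 'g form1" where
  "lie_deriv1 G X \<eta> = zero_outside (vector_fields G) (\<lambda>Z. X (\<eta> Z) - \<eta> (lie_bracket X Z))"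

text \<open>The condition \<open>\<forall>f\<in>smooth_functions G. X f p = 0\<close> says that \<open>X\<close> vanishes at
  the point \<open>p\<close>; every tangent vector is the value of a vector field, so the last clause is
  nondegeneracy on each tangent space.\<close>

definition pseudo_riemannian :: "'g lie_group \<Rightarrow> 'g tensor2 \<Rightarrow> bool" where
  "pseudo_riemannian G g \<longleftrightarrow>
     (\<forall>X\<in>vector_fields G. g X \<in> one_forms G) \<and>
     (\<forall>X. X \<notin> vector_fields G \<longrightarrow> g X = 0) \<and>
     (\<forall>X\<in>vector_fields G. \<forall>Y\<in>vector_fields G. g X Y = g Y X) \<and>
     (\<forall>p. \<forall>X\<in>vector_fields G.
        (\<forall>Y\<in>vector_fields G. g X Y p = 0) \<longrightarrow> (\<forall>f\<in>smooth_functions G. X f p = 0))"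


section \<open>Left-invariance\<close>

definition push_left :: "'g lie_group \<Rightarrow> 'g \<Rightarrow> 'g vfield \<Rightarrow> 'g vfield" where
  "push_left G a X = (\<lambda>f p. X (\<lambda>q. f (a \<otimes>\<^bsub>G\<^esub> q)) (inv\<^bsub>G\<^esub> a \<otimes>\<^bsub>G\<^esub> p))"

definition lie_algebra :: "'g lie_group \<Rightarrow> 'g vfield set" where
  "lie_algebra G = {X \<in> vector_fields G. \<forall>a. push_left G a X = X}"

definition left_inv1 :: "'g lie_group \<Rightarrow> 'g form1 \<Rightarrow> bool" where
  "left_inv1 G \<xi> \<longleftrightarrow> (\<forall>a. \<forall>X\<in>vector_fields G.
     (\<lambda>p. \<xi> (push_left G a X) (a \<otimes>\<^bsub>G\<^esub> p)) = \<xi> X)"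

definition left_inv2 :: "'g lie_group \<Rightarrow> 'g tensor2 \<Rightarrow> bool" where
  "left_inv2 G t \<longleftrightarrow> (\<forall>a. \<forall>X\<in>vector_fields G. \<forall>Y\<in>vector_fields G.
     (\<lambda>p. t (push_left G a X) (push_left G a Y) (a \<otimes>\<^bsub>G\<^esub> p)) = t X Y)"

definition left_inv3 :: "'g lie_group \<Rightarrow> 'g tensor3 \<Rightarrow> bool" where
  "left_inv3 G t \<longleftrightarrow> (\<forall>a. \<forall>X\<in>vector_fields G. \<forall>Y\<in>vector_fields G. \<forall>Z\<in>vector_fields G.
     (\<lambda>p. t (push_left G a X) (push_left G a Y) (push_left G a Z) (a \<otimes>\<^bsub>G\<^esub> p)) = t X Y Z)"


section \<open>Bases and traces\<close>

text \<open>Here \<open>R\<close> is a ring of scalars inside the type \<open>'r\<close> acting by \<open>sc\<close> on the module \<open>M\<close>.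
  It is used with \<open>R = \<real>\<close>, \<open>M = \<gg>\<close>, and with \<open>R = C\<^sup>\<infinity>(G)\<close> and the module of
  sections of a vector bundle; the bundles in question are trivial, so that the fibrewise
  trace of a bundle endomorphism is its trace in any global frame.\<close>

definition is_basis ::
  "'r::comm_ring_1 set \<Rightarrow> ('r \<Rightarrow> 'm::ab_group_add \<Rightarrow> 'm) \<Rightarrow> 'm set \<Rightarrow> 'i set \<Rightarrow> ('i \<Rightarrow> 'm) \<Rightarrow> bool" where
  "is_basis R sc M I b \<longleftrightarrow> finite I \<and> (\<forall>i\<in>I. b i \<in> M) \<and>
     (\<forall>x\<in>M. \<exists>!c. (\<forall>i\<in>I. c i \<in> R) \<and> (\<forall>i. i \<notin> I \<longrightarrow> c i = 0) \<and> x = (\<Sum>i\<in>I. sc (c i) (b i)))"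

definition module_trace ::
  "'r::comm_ring_1 set \<Rightarrow> ('r \<Rightarrow> 'm::ab_group_add \<Rightarrow> 'm) \<Rightarrow> 'm set \<Rightarrow> ('m \<Rightarrow> 'm) \<Rightarrow> 'r" where
  "module_trace R sc M T = (THE t. \<exists>(n::nat) b c. is_basis R sc M {..<n} b \<and>
     (\<forall>i<n. \<forall>j<n. c i j \<in> R) \<and> (\<forall>j<n. T (b j) = (\<Sum>i<n. sc (c i j) (b i))) \<and>
     t = (\<Sum>i<n. c i i))"

definition unimodular_kernel :: "'g lie_group \<Rightarrow> 'g vfield set" where
  "unimodular_kernel G =
     {x \<in> lie_algebra G. module_trace (UNIV :: real set) rscale (lie_algebra G) (lie_bracket x) = 0}"


section \<open>Courant algebroids of type \<open>B\<^sub>3\<close>\<close>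

text \<open>A section of \<open>TG \<oplus> T\<^sup>*G \<oplus> \<real>\<close> is a triple \<open>(X, \<xi>, l)\<close>.\<close>

type_synonym 'g sec = "'g vfield \<times> 'g form1 \<times> 'g cfun"

definition sections :: "'g lie_group \<Rightarrow> 'g sec set" where
  "sections G = vector_fields G \<times> one_forms G \<times> smooth_functions G"

definition left_inv_sections :: "'g lie_group \<Rightarrow> 'g sec set" where
  "left_inv_sections G = lie_algebra G \<times> {\<xi> \<in> one_forms G. left_inv1 G \<xi>} \<times> range const_fun"

fun anchor :: "'g sec \<Rightarrow> 'g vfield" where
  "anchor (X, \<xi>, l) = X"

fun sscale :: "'g cfun \<Rightarrow> 'g sec \<Rightarrow> 'g sec" where
  "sscale f (X, \<xi>, l) = (cscale f X, cscale f \<xi>, f * l)"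

fun pairing :: "'g sec \<Rightarrow> 'g sec \<Rightarrow> 'g cfun" where
  "pairing (X, \<xi>, l) (Y, \<eta>, m) = const_fun (1/2) * (\<xi> Y + \<eta> X) + l * m"

text \<open>In the form component, \<open>i\<^sub>X i\<^sub>Y H = H(Y, X, \<cdot>)\<close> and \<open>i\<^sub>Y d\<xi> = d\<xi>(Y, \<cdot>)\<close>.\<close>

fun dorfman :: "'g lie_group \<Rightarrow> 'g tensor3 \<Rightarrow> 'g tensor2 \<Rightarrow> 'g sec \<Rightarrow> 'g sec \<Rightarrow> 'g sec" where
  "dorfman G H F (X, \<xi>, l) (Y, \<eta>, m) =
     (lie_bracket X Y,
      lie_deriv1 G X \<eta> - ext_deriv1 G \<xi> Y + cscale (const_fun 2 * m) (ext_deriv0 G l)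
        + H Y X - rscale 2 (cscale m (F X) - cscale l (F Y)),
      X m - Y l + F X Y)"

definition E_minus :: "'g lie_group \<Rightarrow> 'g tensor2 \<Rightarrow> 'g sec set" where
  "E_minus G g = {(X, - g X, 0) |X. X \<in> vector_fields G}"

definition E_plus :: "'g lie_group \<Rightarrow> 'g tensor2 \<Rightarrow> 'g sec set" where
  "E_plus G g = {u \<in> sections G. \<forall>v\<in>E_minus G g. pairing u v = 0}"

text \<open>The basis \<open>e\<^sub>0, \<dots>, e\<^sub>6\<close> of left-invariant sections, for a basis \<open>v 1, v 2, v 3\<close> of \<open>\<gg>\<close>.\<close>

definition e_basis :: "'g tensor2 \<Rightarrow> (nat \<Rightarrow> 'g vfield) \<Rightarrow> nat \<Rightarrow> 'g sec" where
  "e_basis g v A =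
     (if A = 0 then (0, 0, 1)
      else if A \<le> 3 then (v A, g (v A), 0)
      else (v (A - 3), - g (v (A - 3)), 0))"


section \<open>Generalized connections, divergence operators and the Einstein condition\<close>

definition generalized_connection :: "'g lie_group \<Rightarrow> ('g sec \<Rightarrow> 'g sec \<Rightarrow> 'g sec) \<Rightarrow> bool" where
  "generalized_connection G D \<longleftrightarrow>
     (\<forall>u\<in>sections G. \<forall>v\<in>sections G. D u v \<in> sections G) \<and>
     (\<forall>u\<in>sections G. \<forall>u'\<in>sections G. \<forall>v\<in>sections G. D (u + u') v = D u v + D u' v) \<and>
     (\<forall>f\<in>smooth_functions G. \<forall>u\<in>sections G. \<forall>v\<in>sections G. D (sscale f u) v = sscale f (D u v)) \<and>
     (\<forall>u\<in>sections G. \<forall>v\<in>sections G. \<forall>w\<in>sections G. D u (v + w) = D u v + D u w) \<and>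
     (\<forall>f\<in>smooth_functions G. \<forall>u\<in>sections G. \<forall>v\<in>sections G.
        D u (sscale f v) = sscale (anchor u f) v + sscale f (D u v)) \<and>
     (\<forall>u\<in>sections G. \<forall>v\<in>sections G. \<forall>w\<in>sections G.
        anchor u (pairing v w) = pairing (D u v) w + pairing v (D u w))"

definition torsion ::
  "'g lie_group \<Rightarrow> 'g tensor3 \<Rightarrow> 'g tensor2 \<Rightarrow> ('g sec \<Rightarrow> 'g sec \<Rightarrow> 'g sec) \<Rightarrow>
   'g sec \<Rightarrow> 'g sec \<Rightarrow> 'g sec \<Rightarrow> 'g cfun" where
  "torsion G H F D u v w = pairing (D u v - D v u - dorfman G H F u v) w + pairing v (D w u)"

definition levi_civita ::
  "'g lie_group \<Rightarrow> 'g tensor2 \<Rightarrow> 'g tensor3 \<Rightarrow> 'g tensor2 \<Rightarrow> ('g sec \<Rightarrow> 'g sec \<Rightarrow> 'g sec) \<Rightarrow> bool" where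
  "levi_civita G g H F D \<longleftrightarrow>
     generalized_connection G D \<and>
     (\<forall>u\<in>sections G. \<forall>v\<in>sections G. \<forall>w\<in>sections G. torsion G H F D u v w = 0) \<and>
     (\<forall>u\<in>sections G. \<forall>v\<in>E_minus G g. D u v \<in> E_minus G g)"

definition divergence_operator :: "'g lie_group \<Rightarrow> ('g sec \<Rightarrow> 'g cfun) \<Rightarrow> bool" where
  "divergence_operator G \<delta> \<longleftrightarrow>
     (\<forall>u\<in>sections G. \<delta> u \<in> smooth_functions G) \<and>
     (\<forall>u\<in>sections G. \<forall>v\<in>sections G. \<delta> (u + v) = \<delta> u + \<delta> v) \<and>
     (\<forall>f\<in>smooth_functions G. \<forall>u\<in>sections G. \<delta> (sscale f u) = anchor u f + f * \<delta> u)"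

definition left_inv_divergence :: "'g lie_group \<Rightarrow> ('g sec \<Rightarrow> 'g cfun) \<Rightarrow> bool" where
  "left_inv_divergence G \<delta> \<longleftrightarrow>
     divergence_operator G \<delta> \<and> (\<forall>u\<in>left_inv_sections G. \<exists>c. \<delta> u = const_fun c)"

definition connection_div ::
  "'g lie_group \<Rightarrow> ('g sec \<Rightarrow> 'g sec \<Rightarrow> 'g sec) \<Rightarrow> 'g sec \<Rightarrow> 'g cfun" where
  "connection_div G D u = module_trace (smooth_functions G) sscale (sections G) (\<lambda>w. D w u)"

definition levi_civita_div ::
  "'g lie_group \<Rightarrow> 'g tensor2 \<Rightarrow> 'g tensor3 \<Rightarrow> 'g tensor2 \<Rightarrow> ('g sec \<Rightarrow> 'g cfun) \<Rightarrow>
   ('g sec \<Rightarrow> 'g sec \<Rightarrow> 'g sec) \<Rightarrow> bool" where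
  "levi_civita_div G g H F \<delta> D \<longleftrightarrow>
     levi_civita G g H F D \<and> (\<forall>u\<in>sections G. connection_div G D u = \<delta> u)"

definition curvature ::
  "'g lie_group \<Rightarrow> 'g tensor3 \<Rightarrow> 'g tensor2 \<Rightarrow> ('g sec \<Rightarrow> 'g sec \<Rightarrow> 'g sec) \<Rightarrow>
   'g sec \<Rightarrow> 'g sec \<Rightarrow> 'g sec \<Rightarrow> 'g sec" where
  "curvature G H F D u v w = D u (D v w) - D v (D u w) - D (dorfman G H F u v) w"

definition ricci_plus ::
  "'g lie_group \<Rightarrow> 'g tensor2 \<Rightarrow> 'g tensor3 \<Rightarrow> 'g tensor2 \<Rightarrow> ('g sec \<Rightarrow> 'g sec \<Rightarrow> 'g sec) \<Rightarrow>
   'g sec \<Rightarrow> 'g sec \<Rightarrow> 'g cfun" where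
  "ricci_plus G g H F D u v =
     module_trace (smooth_functions G) sscale (E_plus G g) (\<lambda>w. curvature G H F D w u v)"

definition ricci_minus ::
  "'g lie_group \<Rightarrow> 'g tensor2 \<Rightarrow> 'g tensor3 \<Rightarrow> 'g tensor2 \<Rightarrow> ('g sec \<Rightarrow> 'g sec \<Rightarrow> 'g sec) \<Rightarrow>
   'g sec \<Rightarrow> 'g sec \<Rightarrow> 'g cfun" where
  "ricci_minus G g H F D u v =
     module_trace (smooth_functions G) sscale (E_minus G g) (\<lambda>w. curvature G H F D w u v)"

text \<open>The Ricci tensors do not depend on the Levi-Civita connection with divergence \<open>\<delta>\<close> used to
  compute them. The definition does not presuppose this: it asks that such a connection
  exists and that the Ricci tensors computed from any of them vanish.\<close>

definition generalized_einstein ::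
  "'g lie_group \<Rightarrow> 'g tensor2 \<Rightarrow> 'g tensor3 \<Rightarrow> 'g tensor2 \<Rightarrow> ('g sec \<Rightarrow> 'g cfun) \<Rightarrow> bool" where
  "generalized_einstein G g H F \<delta> \<longleftrightarrow>
     (\<exists>D. levi_civita_div G g H F \<delta> D) \<and>
     (\<forall>D. levi_civita_div G g H F \<delta> D \<longrightarrow>
        (\<forall>u\<in>E_minus G g. \<forall>v\<in>E_plus G g. ricci_plus G g H F D u v = 0) \<and>
        (\<forall>u\<in>E_plus G g. \<forall>v\<in>E_minus G g. ricci_minus G g H F D u v = 0))"

end

theory Submission
  imports Defs
begin

text \<open>
  The proof has two parts, a geometric reduction to algebra and the algebra.

  The seven sections \<open>e\<^sub>A\<close> form an orthonormal frame of \<open>E\<close>, the first four spanning \<open>E\<^sub>+\<close> and the last three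
  \<open>E\<^sub>-\<close>, and the numbers \<open>B\<^sub>A\<^sub>B\<^sub>C = \<langle>[e\<^sub>A, e\<^sub>B], e\<^sub>C\<rangle>\<close> are constant and totally skew-symmetric. For a
  torsion-free generalized connection that preserves \<open>E\<^sub>-\<close>, the Christoffel symbols \<open>\<langle>D\<^sub>A e\<^sub>B, e\<^sub>C\<rangle>\<close> with \<open>B, C\<close> in one
  subbundle and \<open>A\<close> in the other equal \<open>B\<^sub>A\<^sub>B\<^sub>C\<close>. Those with indices in a single subbundle are not determined, but in
  the Ricci tensors only their traces survive, and these are prescribed by the divergence. The result
  (\<open>ric_frame\<close>) is, with signs \<open>\<eta>\<close>, for \<open>b\<close> an index of \<open>E\<^sub>-\<close> and \<open>j\<close> an index of \<open>E\<^sub>+\<close>,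
  \<open>Ric\<^sup>+(e\<^sub>b, e\<^sub>j) = \<Sum>\<^sub>k \<eta>\<^sub>k B\<^sub>b\<^sub>j\<^sub>k \<delta>\<^sub>k - \<Sum>\<^sub>i\<^sub>,\<^sub>c \<eta>\<^sub>i \<eta>\<^sub>c B\<^sub>i\<^sub>b\<^sub>c B\<^sub>c\<^sub>j\<^sub>i\<close>, where \<open>i, k\<close> run over \<open>E\<^sub>+\<close>
  and \<open>c\<close> over \<open>E\<^sub>-\<close>; exchanging the two subbundles gives \<open>Ric\<^sup>-\<close>. Since a Levi-Civita connection with the given
  divergence exists (\<open>levi_civita_div_exists\<close>), the Einstein condition is the vanishing of these 24 numbers
  (\<open>generalized_einstein_iff\<close>).

  That the \<open>e\<^sub>A\<close> form a frame rests on the fact that left-invariant vector fields form a basis of all vector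
  fields (\<open>vector_field_expansion\<close>). Vector fields being derivations of the algebra of smooth functions, this
  needs the classical argument that a derivation at a point is determined by its values on coordinates
  (\<open>tangent_coordinates\<close>), and with it bump functions and Hadamard's lemma.

  In the polynomial system, combinations of equations show that \<open>\<delta>\<^sub>2 + \<delta>\<^sub>3\<close> and \<open>\<delta>\<^sub>5 + \<delta>\<^sub>6\<close> vanish unless \<open>F = 0\<close>.
  This leaves \<open>h\<^sup>2 = \<nu>\<^sup>2\<close> and \<open>\<epsilon>\<^sub>1 F\<^sub>2\<^sub>3\<^sup>2 + \<nu>\<^sup>2 = 0\<close>, and the two families are the cases \<open>\<nu> = 0\<close> and
  \<open>\<nu> \<noteq> 0\<close> (\<open>einstein_system.families\<close>).
\<close>

section \<open>Calculus of \<open>C\<^sup>k\<close> maps\<close>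

lemma Ck_on_has_derivative:
  "Ck_on (Suc k) S f \<Longrightarrow> x \<in> S \<Longrightarrow> (f has_derivative frechet_derivative f (at x)) (at x)"
  by (simp add: frechet_derivative_works)

lemma Ck_on_SucD: "Ck_on (Suc k) S f \<Longrightarrow> Ck_on k S f"
proof (induction k arbitrary: f)
  case 0
  then show ?case
    by (auto intro!: continuous_at_imp_continuous_on differentiable_imp_continuous_within)
next
  case (Suc k)
  then show ?case
    by (metis Ck_on.simps(2))
qed

lemma Ck_on_subset: "Ck_on k T f \<Longrightarrow> S \<subseteq> T \<Longrightarrow> Ck_on k S f"
  by (induction k arbitrary: f) (auto intro: continuous_on_subset)

lemma Ck_on_local:
  assumes "\<And>x. x \<in> S \<Longrightarrow> \<exists>T. open T \<and> x \<in> T \<and> Ck_on k T f"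
  shows "Ck_on k S f"
  using assms
proof (induction k arbitrary: f)
  case 0
  show ?case
    unfolding Ck_on.simps
  proof (rule continuous_at_imp_continuous_on, rule ballI)
    fix x assume "x \<in> S"
    then obtain T where "open T" "x \<in> T" "continuous_on T f" using 0 by force
    then show "isCont f x" by (simp add: continuous_on_eq_continuous_at)
  qed
next
  case (Suc k)
  show ?case
    unfolding Ck_on.simps
  proof (intro conjI ballI allI Suc.IH)
    fix x assume "x \<in> S"
    then show "f differentiable (at x)" using Suc.prems by force
  next
    fix v x assume "x \<in> S"
    then show "\<exists>T. open T \<and> x \<in> T \<and> Ck_on k T (\<lambda>x. frechet_derivative f (at x) v)"
      using Suc.prems by force
  qed
qed

text \<open>\<open>Ck_on\<close> refers to the derivative of \<open>f\<close> at a point, which only depends on \<open>f\<close> near that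
  point; this is where openness of the domain enters.\<close>

lemma Ck_on_cong:
  assumes "open S" "\<And>x. x \<in> S \<Longrightarrow> f x = g x" "Ck_on k S f"
  shows "Ck_on k S g"
  using assms(2,3)
proof (induction k arbitrary: f g)
  case 0
  then show ?case by (auto cong: continuous_on_cong)
next
  case (Suc k)
  have der: "(g has_derivative frechet_derivative f (at x)) (at x)" if "x \<in> S" for x
    using Ck_on_has_derivative[OF Suc.prems(2) that] \<open>open S\<close> that Suc.prems(1)
    by (rule has_derivative_transform_within_open)
  then have eq: "frechet_derivative g (at x) = frechet_derivative f (at x)" if "x \<in> S" for x
    using frechet_derivative_at that by metis
  show ?case
    unfolding Ck_on.simps
  proof (intro conjI ballI allI)
    show "g differentiable (at x)" if "x \<in> S" for x
      using der that by (auto simp: differentiable_def)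
    show "Ck_on k S (\<lambda>x. frechet_derivative g (at x) v)" for v
      by (rule Suc.IH[where f = "\<lambda>x. frechet_derivative f (at x) v"])
        (use eq Suc.prems(2) in auto)
  qed
qed

text \<open>The form in which smoothness is proved below: exhibit a derivative and show that its values
  in every fixed direction are of class \<open>C\<^sup>k\<close>.\<close>

lemma Ck_on_SucI:
  assumes "open S" "\<And>x. x \<in> S \<Longrightarrow> (f has_derivative f' x) (at x)" "\<And>v. Ck_on k S (\<lambda>x. f' x v)"
  shows "Ck_on (Suc k) S f"
  unfolding Ck_on.simps
proof (intro conjI ballI allI)
  show "f differentiable (at x)" if "x \<in> S" for x
    using assms(2) that by (auto simp: differentiable_def)
  show "Ck_on k S (\<lambda>x. frechet_derivative f (at x) v)" for v
    by (rule Ck_on_cong[OF assms(1) _ assms(3)[of v]]) (metis assms(2) frechet_derivative_at)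
qed

lemma Ck_on_const: "open S \<Longrightarrow> Ck_on k S (\<lambda>_. c)"
  by (induction k arbitrary: c) (auto intro: Ck_on_SucI[where f' = "\<lambda>_ _. 0"] simp del: Ck_on.simps(2))

lemma Ck_on_add:
  assumes "open S" "Ck_on k S f" "Ck_on k S g"
  shows "Ck_on k S (\<lambda>x. f x + g x)"
  using assms(2,3)
proof (induction k arbitrary: f g)
  case 0
  then show ?case by (auto intro: continuous_intros)
next
  case (Suc k)
  show ?case
  proof (rule Ck_on_SucI[OF assms(1)])
    show "((\<lambda>x. f x + g x) has_derivative
        (\<lambda>v. frechet_derivative f (at x) v + frechet_derivative g (at x) v)) (at x)" if "x \<in> S" for x
      using Suc.prems that by (intro has_derivative_add Ck_on_has_derivative)
  qed (use Suc in auto)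
qed

lemma Ck_on_bilinear:
  assumes B: "bounded_bilinear B" and "open S" "Ck_on k S f" "Ck_on k S g"
  shows "Ck_on k S (\<lambda>x. B (f x) (g x))"
  using assms(3,4)
proof (induction k arbitrary: f g)
  case 0
  then show ?case by (auto intro: bounded_bilinear.continuous_on[OF B])
next
  case (Suc k)
  note Ck_on.simps(2) [simp del]
  show ?case
  proof (rule Ck_on_SucI[OF assms(2)])
    show "((\<lambda>x. B (f x) (g x)) has_derivative
        (\<lambda>v. B (f x) (frechet_derivative g (at x) v) + B (frechet_derivative f (at x) v) (g x))) (at x)"
      if "x \<in> S" for x
      using Suc.prems that by (intro bounded_bilinear.FDERIV[OF B] Ck_on_has_derivative)
    show "Ck_on k S (\<lambda>x. B (f x) (frechet_derivative g (at x) v) + B (frechet_derivative f (at x) v) (g x))" for v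
      by (intro Ck_on_add assms(2) Suc.IH Ck_on_SucD[OF Suc.prems(1)] Ck_on_SucD[OF Suc.prems(2)])
        (use Suc.prems in \<open>auto simp: Ck_on.simps(2)\<close>)
  qed
qed

lemma Ck_on_sum:
  assumes "open S" "\<And>i. i \<in> I \<Longrightarrow> Ck_on k S (f i)"
  shows "Ck_on k S (\<lambda>x. \<Sum>i\<in>I. f i x)"
  using assms(2)
  by (induction I rule: infinite_finite_induct) (auto intro: Ck_on_const Ck_on_add assms(1))

lemma Ck_on_bounded_linear:
  assumes L: "bounded_linear L" and "open S"
  shows "Ck_on k S L"
proof (cases k)
  case 0
  then show ?thesis
    by (simp add: linear_continuous_on[OF L])
next
  case (Suc j)
  show ?thesis
    unfolding Suc
    by (rule Ck_on_SucI[OF assms(2), where f' = "\<lambda>_. L"])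
      (auto intro: bounded_linear_imp_has_derivative L Ck_on_const assms(2))
qed

lemma Ck_on_compose:
  fixes f :: "'a::real_normed_vector \<Rightarrow> 'b::euclidean_space" and g :: "'b \<Rightarrow> 'c::real_normed_vector"
  assumes "open S" "open T" "Ck_on k S f" "Ck_on k T g" "f ` S \<subseteq> T"
  shows "Ck_on k S (\<lambda>x. g (f x))"
  using assms(3-5)
proof (induction k arbitrary: f g)
  case 0
  then show ?case by (auto intro: continuous_on_compose2)
next
  case (Suc k)
  note Ck_on.simps(2) [simp del]
  let ?df = "\<lambda>x. frechet_derivative f (at x)" and ?dg = "\<lambda>y. frechet_derivative g (at y)"
  have der: "((\<lambda>x. g (f x)) has_derivative (\<lambda>v. ?dg (f x) (?df x v))) (at x)" if "x \<in> S" for x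
    by (rule has_derivative_compose[OF Ck_on_has_derivative[OF Suc.prems(1) that]])
      (rule Ck_on_has_derivative[OF Suc.prems(2)], use that Suc.prems(3) in auto)
  \<comment> \<open>The induction hypothesis speaks of \<open>y \<mapsto> dg\<^sub>y(i)\<close> for a fixed direction \<open>i\<close>, whereas the chain rule
    has the direction \<open>df\<^sub>x(v)\<close>, which varies with \<open>x\<close>; expanding it in an orthonormal basis reconciles the two.\<close>
  have expand: "?dg (f x) (?df x v) = (\<Sum>i\<in>Basis. (?df x v \<bullet> i) *\<^sub>R ?dg (f x) i)" if "x \<in> S" for x v
  proof -
    have "linear (?dg (f x))"
      using Ck_on_has_derivative[OF Suc.prems(2)] that Suc.prems(3) has_derivative_linear by blast
    then have "?dg (f x) (\<Sum>i\<in>Basis. (?df x v \<bullet> i) *\<^sub>R i) = (\<Sum>i\<in>Basis. (?df x v \<bullet> i) *\<^sub>R ?dg (f x) i)"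
      by (simp add: linear_sum linear_scale)
    then show ?thesis
      by (simp add: euclidean_representation)
  qed
  show ?case
  proof (rule Ck_on_SucI[OF assms(1)])
    show "((\<lambda>x. g (f x)) has_derivative (\<lambda>v. \<Sum>i\<in>Basis. (?df x v \<bullet> i) *\<^sub>R ?dg (f x) i)) (at x)" if "x \<in> S" for x
      using der[OF that] by (simp add: expand[OF that])
    show "Ck_on k S (\<lambda>x. \<Sum>i\<in>Basis. (?df x v \<bullet> i) *\<^sub>R ?dg (f x) i)" for v
    proof (intro Ck_on_sum Ck_on_bilinear[OF bounded_bilinear_scaleR] Suc.IH assms(1) Suc.prems(3)
        Ck_on_SucD[OF Suc.prems(1)])
      fix i :: 'b
      show "Ck_on k S (\<lambda>x. ?df x v \<bullet> i)"
        by (intro Ck_on_bilinear[OF bounded_bilinear_inner] Ck_on_const assms(1))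
          (use Suc.prems in \<open>auto simp: Ck_on.simps(2)\<close>)
      show "Ck_on k T (\<lambda>y. ?dg y i)"
        using Suc.prems(2) by (auto simp: Ck_on.simps(2))
    qed
  qed
qed

section \<open>A smooth bump function\<close>

text \<open>The functions \<open>e\<^sup>-\<^sup>1\<^sup>/\<^sup>t t\<^sup>-\<^sup>n\<close>, extended by zero to \<open>t \<le> 0\<close>. Their linear span is closed under
  differentiation, so all of them are smooth by one induction over the order of differentiability.\<close>

definition flat_exp :: "nat \<Rightarrow> real \<Rightarrow> real" where
  "flat_exp n t = (if t > 0 then exp (- inverse t) * inverse t ^ n else 0)"

lemma flat_exp_lim: "((\<lambda>t. exp (- inverse t) * inverse t ^ n) \<longlongrightarrow> 0) (at_right (0::real))"
proof -
  have "((\<lambda>s::real. s ^ n / exp s) \<longlongrightarrow> 0) at_top"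
    by (rule tendsto_power_div_exp_0)
  then have "((\<lambda>t::real. inverse t ^ n / exp (inverse t)) \<longlongrightarrow> 0) (at_right 0)"
    by (rule filterlim_compose[OF _ filterlim_inverse_at_top_right])
  then show ?thesis
    by (simp add: exp_minus divide_inverse mult.commute)
qed

lemma flat_exp_has_derivative:
  "(flat_exp n has_real_derivative (flat_exp (n + 2) t - real n * flat_exp (n + 1) t)) (at t)"
proof -
  consider "t > 0" | "t < 0" | "t = 0" by linarith
  then show ?thesis
  proof cases
    case 1
    have "((\<lambda>t. exp (- inverse t) * inverse t ^ n) has_real_derivative
        exp (- inverse t) * (inverse t)\<^sup>2 * inverse t ^ n
        + exp (- inverse t) * (real n * inverse t ^ (n - 1) * - (inverse t)\<^sup>2)) (at t)"
      using 1 by (auto intro!: derivative_eq_intros simp: power2_eq_square)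
    moreover have "exp (- inverse t) * (inverse t)\<^sup>2 * inverse t ^ n
        + exp (- inverse t) * (real n * inverse t ^ (n - 1) * - (inverse t)\<^sup>2)
        = flat_exp (n + 2) t - real n * flat_exp (n + 1) t"
      using 1 by (cases n) (simp_all add: flat_exp_def algebra_simps power2_eq_square)
    ultimately have "((\<lambda>t. exp (- inverse t) * inverse t ^ n) has_real_derivative
        (flat_exp (n + 2) t - real n * flat_exp (n + 1) t)) (at t)"
      by simp
    then show ?thesis
      by (rule has_field_derivative_transform_within_open[where S = "{0<..}"])
        (use 1 in \<open>auto simp: flat_exp_def\<close>)
  next
    case 2
    have "((\<lambda>_. 0) has_real_derivative 0) (at t)" by simp
    then have "(flat_exp n has_real_derivative 0) (at t)"
      by (rule has_field_derivative_transform_within_open[where S = "{..<0}"])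
        (use 2 in \<open>auto simp: flat_exp_def\<close>)
    with 2 show ?thesis by (simp add: flat_exp_def)
  next
    case 3
    have "((\<lambda>s. (flat_exp n s - flat_exp n 0) / (s - 0)) \<longlongrightarrow> 0) (at 0)"
    proof (rule filterlim_split_at)
      have "((\<lambda>_::real. 0::real) \<longlongrightarrow> 0) (at_left 0)" by simp
      then show "((\<lambda>s. (flat_exp n s - flat_exp n 0) / (s - 0)) \<longlongrightarrow> 0) (at_left 0)"
        by (rule Lim_transform_eventually)
          (auto simp: flat_exp_def eventually_at_filter)
      show "((\<lambda>s. (flat_exp n s - flat_exp n 0) / (s - 0)) \<longlongrightarrow> 0) (at_right 0)"
        by (rule Lim_transform_eventually[OF flat_exp_lim[of "Suc n"]])
          (auto simp: flat_exp_def eventually_at_filter divide_inverse algebra_simps intro: always_eventually)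
    qed
    then show ?thesis
      using 3 by (simp add: has_field_derivative_iff flat_exp_def)
  qed
qed

lemma Ck_on_flat_exp: "Ck_on k UNIV (flat_exp n)"
proof (induction k arbitrary: n)
  case 0
  show ?case
    by (auto intro!: continuous_at_imp_continuous_on DERIV_isCont[OF flat_exp_has_derivative])
next
  case (Suc k)
  show ?case
  proof (rule Ck_on_SucI)
    show "(flat_exp n has_derivative (\<lambda>v. (flat_exp (n + 2) t + (- real n) * flat_exp (n + 1) t) * v)) (at t)" for t
      using flat_exp_has_derivative[of n t] by (simp add: has_field_derivative_def)
    show "Ck_on k UNIV (\<lambda>t. (flat_exp (n + 2) t + (- real n) * flat_exp (n + 1) t) * v)" for v
      by (intro Ck_on_bilinear[OF bounded_bilinear_mult] Ck_on_add Ck_on_const Suc.IH) auto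
  qed auto
qed

section \<open>Hadamard's lemma\<close>

text \<open>The weight \<open>t\<^sup>k\<close> makes the family stable under differentiation: a directional derivative of the
  \<open>k\<close>-th radial mean of \<open>f\<close> is the \<open>(k+1)\<close>-st radial mean of the same derivative of \<open>f\<close>.\<close>

definition radial_mean :: "nat \<Rightarrow> 'a::real_vector \<Rightarrow> ('a \<Rightarrow> real) \<Rightarrow> 'a \<Rightarrow> real" where
  "radial_mean k a f x = integral {0..1} (\<lambda>t. t ^ k * f (a + t *\<^sub>R (x - a)))"

lemma radial_point_in_ball:
  fixes a x :: "'a::real_normed_vector"
  assumes "x \<in> ball a r" "t \<in> {0..1::real}"
  shows "a + t *\<^sub>R (x - a) \<in> ball a r"
proof -
  have "norm (t *\<^sub>R (x - a)) \<le> 1 * norm (x - a)"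
    unfolding norm_scaleR by (rule mult_right_mono) (use assms in auto)
  then show ?thesis
    using assms by (auto simp: dist_norm norm_minus_commute)
qed

lemma radial_mean_continuous_integrand:
  assumes "continuous_on (ball a r) (f :: 'a::euclidean_space \<Rightarrow> real)"
  shows "continuous_on (ball a r \<times> {0..1}) (\<lambda>(x, t). t ^ k * f (a + t *\<^sub>R (x - a)))"
proof -
  have "continuous_on (ball a r \<times> {0..1}) (\<lambda>z. f (a + snd z *\<^sub>R (fst z - a)))"
    by (rule continuous_on_compose2[OF assms])
      (auto intro!: continuous_intros radial_point_in_ball simp del: mem_ball)
  then show ?thesis
    by (auto simp: split_beta intro!: continuous_intros)
qed

text \<open>Differentiation under the integral sign; the inner derivative of \<open>x \<mapsto> a + t(x - a)\<close> supplies
  the extra factor \<open>t\<close>.\<close>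

lemma radial_mean_has_derivative:
  fixes f :: "'a::euclidean_space \<Rightarrow> real"
  assumes f: "Ck_on (Suc 0) (ball a r) f" and x: "x \<in> ball a r"
  shows "(radial_mean k a f has_derivative
    (\<lambda>v. \<Sum>i\<in>Basis. (v \<bullet> i) * radial_mean (Suc k) a (\<lambda>y. frechet_derivative f (at y) i) x)) (at x)"
proof -
  let ?D = "\<lambda>y. frechet_derivative f (at y)"
  have cont_f: "continuous_on (ball a r) f"
    using Ck_on_SucD[OF f] by simp
  have cont_D: "continuous_on (ball a r) (\<lambda>y. ?D y i)" for i
    using f by simp
  define L where "L = (\<lambda>x t. \<Sum>i\<in>Basis. (t ^ Suc k * ?D (a + t *\<^sub>R (x - a)) i) *\<^sub>R blinfun_inner_left i)"
  have L_apply: "blinfun_apply (L x t) v = (\<Sum>i\<in>Basis. t ^ Suc k * ?D (a + t *\<^sub>R (x - a)) i * (v \<bullet> i))" for x t v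
    by (simp add: L_def blinfun.sum_left blinfun.scaleR_left inner_commute)
  note cont = radial_mean_continuous_integrand[OF cont_D]
  have cont_L: "continuous_on (ball a r \<times> {0..1}) (\<lambda>(x, t). L x t)"
    unfolding L_def split_beta
    by (intro continuous_on_sum continuous_on_scaleR continuous_on_const)
      (use cont[of "Suc k"] in \<open>simp add: split_beta\<close>)
  have "((\<lambda>x. integral (cbox 0 1) (\<lambda>t. t ^ k * f (a + t *\<^sub>R (x - a))))
      has_derivative integral (cbox 0 1) (L x)) (at x within ball a r)"
  proof (rule leibniz_rule[where fx = L])
    fix y t assume y: "y \<in> ball a r" and t: "t \<in> cbox 0 (1::real)"
    have "(f has_derivative ?D (a + t *\<^sub>R (y - a))) (at (a + t *\<^sub>R (y - a)))"
      by (rule Ck_on_has_derivative[OF f]) (use radial_point_in_ball y t in auto)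
    moreover have "((\<lambda>y. a + t *\<^sub>R (y - a)) has_derivative (\<lambda>v. t *\<^sub>R v)) (at y within ball a r)"
      by (auto intro!: derivative_eq_intros)
    ultimately have "((\<lambda>y. f (a + t *\<^sub>R (y - a))) has_derivative
        (\<lambda>v. ?D (a + t *\<^sub>R (y - a)) (t *\<^sub>R v))) (at y within ball a r)"
      by (rule has_derivative_compose[rotated])
    then have "((\<lambda>y. t ^ k * f (a + t *\<^sub>R (y - a))) has_derivative
        (\<lambda>v. t ^ k * ?D (a + t *\<^sub>R (y - a)) (t *\<^sub>R v))) (at y within ball a r)"
      by (rule has_derivative_mult_right)
    moreover have "t ^ k * ?D (a + t *\<^sub>R (y - a)) (t *\<^sub>R v) = L y t v" for v
    proof -
      have lin: "linear (?D (a + t *\<^sub>R (y - a)))"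
        using \<open>(f has_derivative ?D (a + t *\<^sub>R (y - a))) _\<close> has_derivative_linear by blast
      then have "?D (a + t *\<^sub>R (y - a)) (\<Sum>i\<in>Basis. (v \<bullet> i) *\<^sub>R i)
          = (\<Sum>i\<in>Basis. (v \<bullet> i) *\<^sub>R ?D (a + t *\<^sub>R (y - a)) i)"
        by (simp add: linear_sum linear_scale)
      then have "?D (a + t *\<^sub>R (y - a)) v = (\<Sum>i\<in>Basis. (v \<bullet> i) * ?D (a + t *\<^sub>R (y - a)) i)"
        by (simp add: euclidean_representation)
      then show ?thesis
        using lin unfolding L_apply
        by (simp add: linear_scale sum_distrib_left algebra_simps)
    qed
    ultimately show "((\<lambda>y. t ^ k * f (a + t *\<^sub>R (y - a))) has_derivative L y t) (at y within ball a r)"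
      by simp
  next
    fix y assume "y \<in> ball a r"
    then have "continuous_on {0..1} (\<lambda>t. case (y, t) of (x, t) \<Rightarrow> t ^ k * f (a + t *\<^sub>R (x - a)))"
      by (intro continuous_on_compose2[OF radial_mean_continuous_integrand[OF cont_f]])
        (auto intro!: continuous_intros)
    then show "(\<lambda>t. t ^ k * f (a + t *\<^sub>R (y - a))) integrable_on cbox 0 1"
      by (auto intro!: integrable_continuous_real)
  qed (use cont_L x in auto)
  moreover have deriv_eq: "blinfun_apply (integral (cbox 0 1) (L x)) = (\<lambda>v. \<Sum>i\<in>Basis. (v \<bullet> i) * radial_mean (Suc k) a (\<lambda>y. ?D y i) x)"
  proof
    fix v
    have cont_x: "continuous_on {0..1} (\<lambda>t. t ^ Suc k * ?D (a + t *\<^sub>R (x - a)) i)" for i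
      by (intro continuous_intros continuous_on_compose2[OF cont_D[of i]])
        (auto intro!: continuous_intros radial_point_in_ball[OF x] simp del: mem_ball)
    have "continuous_on {0..1} (L x)"
      unfolding L_def by (intro continuous_on_sum continuous_on_scaleR continuous_on_const cont_x)
    then have "L x integrable_on cbox 0 1"
      by (auto intro!: integrable_continuous_real)
    then have "blinfun_apply (integral (cbox 0 1) (L x)) v = integral (cbox 0 1) (\<lambda>t. blinfun_apply (L x t) v)"
      by (rule blinfun_apply_integral)
    also have "\<dots> = (\<Sum>i\<in>Basis. integral {0..1} (\<lambda>t. (t ^ Suc k * ?D (a + t *\<^sub>R (x - a)) i) * (v \<bullet> i)))"
      unfolding L_apply cbox_interval
      by (rule integral_sum) (intro finite_Basis integrable_continuous_real continuous_on_mult_right cont_x)+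
    finally show "blinfun_apply (integral (cbox 0 1) (L x)) v
        = (\<Sum>i\<in>Basis. (v \<bullet> i) * radial_mean (Suc k) a (\<lambda>y. ?D y i) x)"
      by (simp only: integral_mult_left radial_mean_def mult.commute[of "v \<bullet> _"])
  qed
  ultimately have "(radial_mean k a f has_derivative
    (\<lambda>v. \<Sum>i\<in>Basis. (v \<bullet> i) * radial_mean (Suc k) a (\<lambda>y. ?D y i) x)) (at x within ball a r)"
    by (simp only: radial_mean_def[abs_def] cbox_interval)
  then show ?thesis
    using x by (simp add: at_within_open[OF x open_ball])
qed

lemma Ck_on_radial_mean:
  fixes f :: "'a::euclidean_space \<Rightarrow> real"
  assumes "Ck_on (Suc n) (ball a r) f"
  shows "Ck_on n (ball a r) (radial_mean k a f)"
  using assms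
proof (induction n arbitrary: f k)
  case 0
  show ?case
    by (auto intro!: continuous_at_imp_continuous_on
        has_derivative_continuous[OF radial_mean_has_derivative[OF 0]] simp del: mem_ball Ck_on.simps(2))
next
  case (Suc n)
  note Ck_on.simps(2) [simp del]
  have C1: "Ck_on (Suc 0) (ball a r) f"
    using Suc.prems by (induction n) (blast dest: Ck_on_SucD)+
  show ?case
  proof (rule Ck_on_SucI[OF open_ball radial_mean_has_derivative[OF C1]])
    fix v :: 'a
    have "Ck_on (Suc n) (ball a r) (\<lambda>y. frechet_derivative f (at y) i)" for i
      using Suc.prems by (subst (asm) Ck_on.simps(2)) auto
    then show "Ck_on n (ball a r)
      (\<lambda>x. \<Sum>i\<in>Basis. (v \<bullet> i) * radial_mean (Suc k) a (\<lambda>y. frechet_derivative f (at y) i) x)"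
      by (intro Ck_on_sum Ck_on_bilinear[OF bounded_bilinear_mult] Ck_on_const Suc.IH open_ball)
  qed
qed

text \<open>By the fundamental theorem of calculus along the ray from \<open>a\<close> to \<open>x\<close>. It is the reason why a
  derivation of smooth functions is determined by its values on coordinate functions.\<close>

lemma hadamard_lemma:
  fixes f :: "'a::euclidean_space \<Rightarrow> real"
  assumes f: "smooth_on (ball a r) f"
  obtains g where "\<And>i. smooth_on (ball a r) (g i)"
    "\<And>x. x \<in> ball a r \<Longrightarrow> f x = f a + (\<Sum>i\<in>Basis. ((x - a) \<bullet> i) * g i x)"
proof
  let ?D = "\<lambda>y. frechet_derivative f (at y)"
  let ?g = "\<lambda>i. radial_mean 0 a (\<lambda>y. ?D y i)"
  have Ck: "Ck_on k (ball a r) f" for k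
    using f by (simp add: smooth_on_def)
  have CkD: "Ck_on k (ball a r) (\<lambda>y. ?D y i)" for k i
    using Ck[of "Suc k"] by simp
  show "smooth_on (ball a r) (?g i)" for i
    unfolding smooth_on_def using Ck_on_radial_mean[OF CkD] by blast
  fix x assume x: "x \<in> ball a r"
  have der: "((\<lambda>t. f (a + t *\<^sub>R (x - a))) has_vector_derivative (\<Sum>i\<in>Basis. ((x - a) \<bullet> i) * ?D (a + t *\<^sub>R (x - a)) i))
      (at t within {0..1})" if t: "t \<in> {0..1}" for t
  proof -
    let ?y = "a + t *\<^sub>R (x - a)"
    have D: "(f has_derivative ?D ?y) (at ?y)"
      by (rule Ck_on_has_derivative[OF Ck[of "Suc 0"] radial_point_in_ball[OF x t]])
    have "((\<lambda>t. a + t *\<^sub>R (x - a)) has_derivative (\<lambda>s. s *\<^sub>R (x - a))) (at t within {0..1})"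
      by (auto intro!: derivative_eq_intros)
    then have "((\<lambda>t. f (a + t *\<^sub>R (x - a))) has_derivative (\<lambda>s. ?D ?y (s *\<^sub>R (x - a)))) (at t within {0..1})"
      using D by (rule has_derivative_compose)
    moreover have lin: "linear (?D ?y)"
      using D has_derivative_linear by blast
    moreover have "?D ?y (x - a) = (\<Sum>i\<in>Basis. ((x - a) \<bullet> i) * ?D ?y i)"
    proof -
      have "?D ?y (\<Sum>i\<in>Basis. ((x - a) \<bullet> i) *\<^sub>R i) = (\<Sum>i\<in>Basis. ((x - a) \<bullet> i) *\<^sub>R ?D ?y i)"
        using lin by (simp add: linear_sum linear_scale)
      then show ?thesis by (simp add: euclidean_representation)
    qed
    ultimately show ?thesis
      by (simp add: has_vector_derivative_def linear_scale)
  qed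
  have ends: "f (a + 1 *\<^sub>R (x - a)) = f x" "f (a + 0 *\<^sub>R (x - a)) = f a"
    by simp_all
  have "f x - f a = integral {0..1} (\<lambda>t. \<Sum>i\<in>Basis. ((x - a) \<bullet> i) * ?D (a + t *\<^sub>R (x - a)) i)"
    using integral_unique[OF fundamental_theorem_of_calculus[OF zero_le_one der]] by (simp only: ends)
  also have "\<dots> = (\<Sum>i\<in>Basis. ((x - a) \<bullet> i) * ?g i x)"
  proof -
    have cont: "continuous_on {0..1} (\<lambda>t. ?D (a + t *\<^sub>R (x - a)) i)" for i
      by (rule continuous_on_compose2[OF CkD[of 0 i, unfolded Ck_on.simps]])
        (auto intro!: continuous_intros radial_point_in_ball[OF x] simp del: mem_ball)
    have "integral {0..1} (\<lambda>t. \<Sum>i\<in>Basis. ((x - a) \<bullet> i) * ?D (a + t *\<^sub>R (x - a)) i)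
        = (\<Sum>i\<in>Basis. integral {0..1} (\<lambda>t. ((x - a) \<bullet> i) * ?D (a + t *\<^sub>R (x - a)) i))"
      by (rule integral_sum) (intro finite_Basis integrable_continuous_real continuous_on_mult_left cont)+
    then show ?thesis
      by (simp add: radial_mean_def)
  qed
  finally show "f x = f a + (\<Sum>i\<in>Basis. ((x - a) \<bullet> i) * ?g i x)"
    unfolding diff_eq_eq by (subst add.commute)
qed

lemma smooth_on_const: "open S \<Longrightarrow> smooth_on S (\<lambda>_. c)"
  by (simp add: smooth_on_def Ck_on_const)

lemma smooth_on_add: "open S \<Longrightarrow> smooth_on S f \<Longrightarrow> smooth_on S g \<Longrightarrow> smooth_on S (\<lambda>x. f x + g x)"
  by (simp add: smooth_on_def Ck_on_add)

lemma smooth_on_mult: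
  fixes f g :: "'a::real_normed_vector \<Rightarrow> real"
  shows "open S \<Longrightarrow> smooth_on S f \<Longrightarrow> smooth_on S g \<Longrightarrow> smooth_on S (\<lambda>x. f x * g x)"
  by (simp add: smooth_on_def Ck_on_bilinear[OF bounded_bilinear_mult])

lemma smooth_on_subset: "smooth_on T f \<Longrightarrow> S \<subseteq> T \<Longrightarrow> smooth_on S f"
  by (auto simp: smooth_on_def intro: Ck_on_subset)

lemma smooth_on_cong: "open S \<Longrightarrow> (\<And>x. x \<in> S \<Longrightarrow> f x = g x) \<Longrightarrow> smooth_on S f \<Longrightarrow> smooth_on S g"
  unfolding smooth_on_def using Ck_on_cong by blast

lemma smooth_on_local: "(\<And>x. x \<in> S \<Longrightarrow> \<exists>T. open T \<and> x \<in> T \<and> smooth_on T f) \<Longrightarrow> smooth_on S f"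
  unfolding smooth_on_def by (metis Ck_on_local)

lemma smooth_on_compose:
  fixes f :: "'a::real_normed_vector \<Rightarrow> 'b::euclidean_space"
  shows "open S \<Longrightarrow> open T \<Longrightarrow> smooth_on S f \<Longrightarrow> smooth_on T g \<Longrightarrow> f ` S \<subseteq> T \<Longrightarrow> smooth_on S (\<lambda>x. g (f x))"
  by (auto simp: smooth_on_def intro: Ck_on_compose)

text \<open>Positive exactly on the open ball of radius \<open>\<bar>r\<bar>\<close> around \<open>a\<close>.\<close>

definition bump :: "'a::euclidean_space \<Rightarrow> real \<Rightarrow> 'a \<Rightarrow> real" where
  "bump a r x = flat_exp 0 (r\<^sup>2 - (x - a) \<bullet> (x - a))"

lemma smooth_on_shift: "smooth_on UNIV (\<lambda>x::'a::euclidean_space. x - a)"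
proof -
  have "smooth_on UNIV (\<lambda>x::'a. x)"
    unfolding smooth_on_def by (intro allI Ck_on_bounded_linear[OF bounded_linear_ident open_UNIV])
  then have "smooth_on UNIV (\<lambda>x. x + - a)"
    by (intro smooth_on_add smooth_on_const) auto
  then show ?thesis by simp
qed

lemma smooth_on_coordinate: "smooth_on UNIV (\<lambda>x::'a::euclidean_space. (x - a) \<bullet> i)"
  using smooth_on_shift[of a]
  by (auto simp: smooth_on_def intro!: Ck_on_bilinear[OF bounded_bilinear_inner] Ck_on_const)

lemma smooth_on_bump: "smooth_on UNIV (bump a r)"
proof -
  have "smooth_on UNIV (\<lambda>x::'a. (x - a) \<bullet> (x - a))"
    using smooth_on_shift[of a] by (simp add: smooth_on_def Ck_on_bilinear[OF bounded_bilinear_inner])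
  then have "smooth_on UNIV (\<lambda>x::'a. r\<^sup>2 + (-1) * ((x - a) \<bullet> (x - a)))"
    by (intro smooth_on_add smooth_on_mult smooth_on_const) auto
  moreover have "smooth_on UNIV (flat_exp 0)"
    by (simp add: smooth_on_def Ck_on_flat_exp)
  ultimately have "smooth_on UNIV (\<lambda>x::'a. flat_exp 0 (r\<^sup>2 + (-1) * ((x - a) \<bullet> (x - a))))"
    by (rule smooth_on_compose[OF open_UNIV open_UNIV]) simp
  then show ?thesis
    by (simp add: bump_def[abs_def])
qed

lemma bump_center: "r \<noteq> 0 \<Longrightarrow> bump a r a \<noteq> 0"
  by (simp add: bump_def flat_exp_def)

lemma bump_outside: "0 \<le> r \<Longrightarrow> r \<le> dist a x \<Longrightarrow> bump a r x = 0"
  by (simp add: bump_def flat_exp_def dist_norm norm_minus_commute power2_norm_eq_inner[symmetric] not_less power_mono)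

lemma sum_Basis_cart: "(\<Sum>i\<in>(Basis :: (real ^ 'n) set). F i) = (\<Sum>i\<in>UNIV. F (axis i 1))"
proof -
  have "bij_betw (\<lambda>i. axis i (1::real)) (UNIV :: 'n set) Basis"
    by (auto simp: bij_betw_def inj_on_def axis_eq_axis Basis_vec_def)
  from sum.reindex_bij_betw[OF this, of F] show ?thesis by simp
qed

section \<open>Smooth functions on the group\<close>

lemma const_fun_apply [simp]: "const_fun c p = c"
  by (simp add: const_fun_def)

lemma const_fun_arith:
  "const_fun 0 = 0" "const_fun 1 = 1" "const_fun a + const_fun b = const_fun (a + b)"
  "const_fun a * const_fun b = const_fun (a * b)" "- const_fun a = const_fun (- a)"
  "const_fun a - const_fun b = const_fun (a - b)"
  by (auto simp: fun_eq_iff)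

lemma const_fun_sum: "(\<Sum>i\<in>I. const_fun (c i)) = const_fun (\<Sum>i\<in>I. c i)"
  by (induction I rule: infinite_finite_induct) (auto simp: const_fun_arith)

lemma const_fun_eq_iff [simp]: "const_fun a = const_fun b \<longleftrightarrow> a = b"
  by (auto simp: const_fun_def dest: fun_cong)

lemma sum_fun_apply: "(\<Sum>i\<in>I. f i) x = (\<Sum>i\<in>I. f i x)"
  by (induction I rule: infinite_finite_induct) auto

locale lie3 =
  fixes G :: "('g::{t2_space, second_countable_topology}) lie_group"
  assumes G: "lie_group3 G"
begin

abbreviation "C \<equiv> smooth_functions G"
abbreviation "VF \<equiv> vector_fields G"

lemma chartD:
  assumes "(U, \<phi>) \<in> charts G"
  shows "open U" "open (\<phi> ` U)" "homeomorphism U (\<phi> ` U) \<phi> (inv_into U \<phi>)"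
  using G assms unfolding lie_group3_def is_chart_def by auto

lemma chart_at: obtains U \<phi> where "(U, \<phi>) \<in> charts G" "p \<in> U"
proof -
  have "p \<in> (\<Union>(U, \<phi>)\<in>charts G. U)"
    using G unfolding lie_group3_def by auto
  then show ?thesis using that by auto
qed

lemma transition_smooth:
  assumes "(U, \<phi>) \<in> charts G" "(V, \<psi>) \<in> charts G"
  shows "smooth_on (\<phi> ` (U \<inter> V)) (\<psi> \<circ> inv_into U \<phi>)"
  using G assms unfolding lie_group3_def by blast

lemma chart_inv:
  assumes "(U, \<phi>) \<in> charts G" "q \<in> U"
  shows "inv_into U \<phi> (\<phi> q) = q"
  using chartD(3)[OF assms(1)] assms(2) by (auto simp: homeomorphism_def)

lemma chart_open_image:
  assumes "(U, \<phi>) \<in> charts G" "open O'" "O' \<subseteq> U"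
  shows "open (\<phi> ` O')"
proof -
  have "openin (top_of_set (\<phi> ` U)) (\<phi> ` O')"
    by (rule homeomorphism_imp_open_map[OF chartD(3)[OF assms(1)]])
      (use assms chartD(1) in \<open>auto simp: openin_open_eq\<close>)
  then show ?thesis
    using chartD(2)[OF assms(1)] by (simp add: openin_open_eq)
qed

lemma smooth_const [simp]: "const_fun c \<in> C"
  using chartD(2) by (auto simp: smooth_functions_def o_def intro: smooth_on_const)

lemma smooth_0 [simp]: "0 \<in> C" and smooth_1 [simp]: "1 \<in> C"
  using smooth_const[of 0] smooth_const[of 1] by (simp_all add: const_fun_arith)

lemma smooth_add [simp]: "f \<in> C \<Longrightarrow> h \<in> C \<Longrightarrow> f + h \<in> C"
  using smooth_on_add[OF chartD(2)] by (fastforce simp: smooth_functions_def o_def)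

lemma smooth_mult [simp]: "f \<in> C \<Longrightarrow> h \<in> C \<Longrightarrow> f * h \<in> C"
  using smooth_on_mult[OF chartD(2)] by (fastforce simp: smooth_functions_def o_def)

lemma smooth_uminus [simp]: "f \<in> C \<Longrightarrow> - f \<in> C"
  using smooth_mult[OF smooth_const[of "-1"], of f]
  by (simp add: const_fun_arith(5)[symmetric] const_fun_arith(2))

lemma smooth_diff [simp]: "f \<in> C \<Longrightarrow> h \<in> C \<Longrightarrow> f - h \<in> C"
  using smooth_add[OF _ smooth_uminus] by fastforce

lemma smooth_sum [simp]: "(\<And>i. i \<in> I \<Longrightarrow> f i \<in> C) \<Longrightarrow> (\<Sum>i\<in>I. f i) \<in> C"
  by (induction I rule: infinite_finite_induct) auto

text \<open>A function given in coordinates on \<open>S\<close>, transplanted to the group and extended by zero.\<close>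

definition chart_extension :: "'g set \<Rightarrow> ('g \<Rightarrow> real ^ 3) \<Rightarrow> (real ^ 3) set \<Rightarrow> (real ^ 3 \<Rightarrow> real) \<Rightarrow> 'g cfun" where
  "chart_extension U \<phi> S w q = (if q \<in> U \<and> \<phi> q \<in> S then w (\<phi> q) else 0)"

text \<open>The set of points with coordinates in \<open>K\<close> is compact, hence closed because the group is Hausdorff.
  So each point has a neighbourhood on which the extension is either the transplanted function
  or zero, and both are smooth in every chart.\<close>

lemma chart_extension_smooth:
  assumes c: "(U, \<phi>) \<in> charts G" and S: "open S" "S \<subseteq> \<phi> ` U" and K: "compact K" "K \<subseteq> S"
    and w: "smooth_on S w" and w0: "\<And>x. x \<in> S \<Longrightarrow> x \<notin> K \<Longrightarrow> w x = 0"
  shows "chart_extension U \<phi> S w \<in> C"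
  unfolding smooth_functions_def
proof (clarify)
  fix V \<psi> assume d: "(V, \<psi>) \<in> charts G"
  let ?f = "chart_extension U \<phi> S w"
  let ?i = "inv_into V \<psi>"
  let ?K = "inv_into U \<phi> ` K"
  have "continuous_on K (inv_into U \<phi>)"
    by (rule continuous_on_subset[of "\<phi> ` U"]) (use chartD(3)[OF c] S(2) K(2) in \<open>auto simp: homeomorphism_def\<close>)
  then have closed: "closed ?K"
    using K(1) compact_continuous_image compact_imp_closed by blast
  have opS: "open (U \<inter> \<phi> -` S)"
    using chartD[OF c] S(1) by (intro continuous_open_preimage) (auto simp: homeomorphism_def)
  show "smooth_on (\<psi> ` V) (?f \<circ> ?i)"
  proof (rule smooth_on_local)
    fix y assume "y \<in> \<psi> ` V"
    then obtain q where q: "q \<in> V" "y = \<psi> q" by auto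
    show "\<exists>T. open T \<and> y \<in> T \<and> smooth_on T (?f \<circ> ?i)"
    proof (cases "q \<in> U \<and> \<phi> q \<in> S")
      case True
      let ?T = "\<psi> ` (V \<inter> (U \<inter> \<phi> -` S))"
      have op: "open ?T"
        using chart_open_image[OF d] opS chartD(1)[OF d] by (meson Int_lower1 open_Int)
      have "smooth_on ?T (\<phi> \<circ> ?i)"
        by (rule smooth_on_subset[OF transition_smooth[OF d c]]) auto
      then have "smooth_on ?T (\<lambda>x. w ((\<phi> \<circ> ?i) x))"
        by (rule smooth_on_compose[OF op S(1) _ w]) (auto simp: chart_inv[OF d])
      then have "smooth_on ?T (?f \<circ> ?i)"
        by (rule smooth_on_cong[OF op, rotated]) (auto simp: chart_extension_def chart_inv[OF d])
      then show ?thesis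
        using op q True by blast
    next
      case False
      let ?T = "\<psi> ` (V - ?K)"
      have op: "open ?T"
        using chart_open_image[OF d] closed chartD(1)[OF d] by (meson Diff_subset open_Diff)
      have 0: "?f q' = 0" if "q' \<in> V - ?K" for q'
      proof (cases "q' \<in> U \<and> \<phi> q' \<in> S")
        case True
        then have "\<phi> q' \<notin> K"
          using that chart_inv[OF c, of q'] by (metis DiffD2 image_eqI)
        then show ?thesis
          using True w0 by (simp add: chart_extension_def)
      qed (auto simp: chart_extension_def)
      have "smooth_on ?T (?f \<circ> ?i)"
        by (rule smooth_on_cong[OF op _ smooth_on_const[OF op, of 0]]) (auto simp: chart_inv[OF d] 0)
      moreover have "q \<notin> ?K"
        using False K(2) S(2) chart_inv[OF c] by fastforce
      ultimately show ?thesis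
        using op q by blast
    qed
  qed
qed

section \<open>Vector fields as derivations\<close>

lemma VF_zero [simp]: "0 \<in> VF"
  by (auto simp: vector_fields_def)

lemma VF_plus [simp]: "X \<in> VF \<Longrightarrow> Y \<in> VF \<Longrightarrow> X + Y \<in> VF"
  by (auto simp: vector_fields_def algebra_simps)

lemma VF_cscale [simp]: "f \<in> C \<Longrightarrow> X \<in> VF \<Longrightarrow> cscale f X \<in> VF"
  by (auto simp: vector_fields_def cscale_def algebra_simps)

lemma VF_minus [simp]: "X \<in> VF \<Longrightarrow> - X \<in> VF"
  by (auto simp: vector_fields_def algebra_simps)

lemma VF_smooth [simp]: "X \<in> VF \<Longrightarrow> f \<in> C \<Longrightarrow> X f \<in> C"
  and VF_add: "X \<in> VF \<Longrightarrow> f \<in> C \<Longrightarrow> h \<in> C \<Longrightarrow> X (f + h) = X f + X h"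
  and VF_scale: "X \<in> VF \<Longrightarrow> f \<in> C \<Longrightarrow> X (const_fun c * f) = const_fun c * X f"
  and VF_mult: "X \<in> VF \<Longrightarrow> f \<in> C \<Longrightarrow> h \<in> C \<Longrightarrow> X (f * h) = X f * h + f * X h"
  and VF_nonsmooth: "X \<in> VF \<Longrightarrow> f \<notin> C \<Longrightarrow> X f = 0"
  by (auto simp: vector_fields_def)

lemma VF_0 [simp]: "X \<in> VF \<Longrightarrow> X 0 = 0"
  using VF_scale[of X 0 0] by (simp add: const_fun_arith)

lemma VF_1 [simp]: "X \<in> VF \<Longrightarrow> X 1 = 0"
  using VF_mult[of X 1 1] by simp

lemma VF_const [simp]: "X \<in> VF \<Longrightarrow> X (const_fun c) = 0"
  using VF_scale[of X 1 c] by (simp add: fun_eq_iff)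

lemma VF_uminus: "X \<in> VF \<Longrightarrow> f \<in> C \<Longrightarrow> X (- f) = - X f"
  using VF_scale[of X f "-1"] by (simp add: const_fun_arith(5)[symmetric] const_fun_arith(2))

lemma VF_diff: "X \<in> VF \<Longrightarrow> f \<in> C \<Longrightarrow> h \<in> C \<Longrightarrow> X (f - h) = X f - X h"
  using VF_add[of X f "- h"] by (simp add: VF_uminus fun_eq_iff)

lemma VF_sum: "X \<in> VF \<Longrightarrow> (\<And>i. i \<in> I \<Longrightarrow> f i \<in> C) \<Longrightarrow> X (\<Sum>i\<in>I. f i) = (\<Sum>i\<in>I. X (f i))"
  by (induction I rule: infinite_finite_induct) (auto simp: VF_add)

lemma VF_sum_mem [simp]: "(\<And>i. i \<in> I \<Longrightarrow> X i \<in> VF) \<Longrightarrow> (\<Sum>i\<in>I. X i) \<in> VF"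
  by (induction I rule: infinite_finite_induct) auto

lemma VF_bracket [simp]:
  assumes "X \<in> VF" "Y \<in> VF"
  shows "lie_bracket X Y \<in> VF"
  unfolding vector_fields_def
proof (intro CollectI conjI ballI allI impI)
  fix f c assume f: "f \<in> C"
  show "lie_bracket X Y (const_fun c * f) = const_fun c * lie_bracket X Y f"
    \<comment> \<open>The derivation rules are used for the two given vector fields only: their left-hand sides are
      headed by a variable and would otherwise match every application.\<close>
    unfolding lie_bracket_def VF_scale[OF assms(1) f] VF_scale[OF assms(2) f]
      VF_scale[OF assms(1) VF_smooth[OF assms(2) f]] VF_scale[OF assms(2) VF_smooth[OF assms(1) f]]
    by (rule right_diff_distrib[symmetric])
  show "lie_bracket X Y f \<in> C"
    using assms f by (simp add: lie_bracket_def)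
  fix h assume h: "h \<in> C"
  show "lie_bracket X Y (f + h) = lie_bracket X Y f + lie_bracket X Y h"
    using f h unfolding lie_bracket_def
    by (simp only: VF_add[OF assms(1)] VF_add[OF assms(2)] VF_smooth[OF assms(1)] VF_smooth[OF assms(2)]) simp
  show "lie_bracket X Y (f * h) = lie_bracket X Y f * h + f * lie_bracket X Y h"
    using f h unfolding lie_bracket_def
    by (simp only: VF_add[OF assms(1)] VF_add[OF assms(2)] VF_mult[OF assms(1)] VF_mult[OF assms(2)]
        VF_smooth[OF assms(1)] VF_smooth[OF assms(2)] smooth_mult) (simp add: algebra_simps)
next
  fix f assume "f \<notin> C"
  then show "lie_bracket X Y f = 0"
    by (simp only: lie_bracket_def VF_nonsmooth[OF assms(1)] VF_nonsmooth[OF assms(2)]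
        VF_0[OF assms(1)] VF_0[OF assms(2)] diff_self not_False_eq_True)
qed

text \<open>The tangent space at a point has dimension at most three: the value at \<open>p\<close> of a vector field
  is determined by its effect on three functions \<open>y i\<close>. These are the coordinates centred at \<open>p\<close>, cut off
  by a bump \<open>\<beta>\<close>. Hadamard's lemma, multiplied by \<open>\<beta>\<^sup>2\<close>, becomes an identity between globally defined
  smooth functions, \<open>\<beta>\<^sup>2(f - f(p)) = \<Sum>\<^sub>i y\<^sub>i \<gamma>\<^sub>i\<close>, to which a derivation can be applied.\<close>

lemma tangent_coordinates:
  "\<exists>y :: 3 \<Rightarrow> 'g cfun. (\<forall>i. y i \<in> C) \<and>
     (\<forall>f\<in>C. \<exists>c. \<forall>X\<in>VF. X f p = (\<Sum>i\<in>UNIV. c i * X (y i) p))"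
proof -
  obtain U \<phi> where c: "(U, \<phi>) \<in> charts G" and p: "p \<in> U"
    by (rule chart_at)
  define a where "a = \<phi> p"
  obtain R where R: "R > 0" "ball a R \<subseteq> \<phi> ` U"
    using chartD(2)[OF c] p unfolding a_def open_contains_ball by blast
  let ?S = "ball a R"
  define b where "b = bump a (R / 2)"
  let ?ext = "chart_extension U \<phi> ?S"
  have ext: "?ext (\<lambda>x. b x * w x) \<in> C" if "smooth_on ?S w" for w
  proof (rule chart_extension_smooth[OF c open_ball R(2), of "cball a (R / 2)"])
    show "smooth_on ?S (\<lambda>x. b x * w x)"
      using smooth_on_bump[of a "R / 2"] that
      by (auto intro!: smooth_on_mult intro: smooth_on_subset simp: b_def)
    show "b x * w x = 0" if "x \<notin> cball a (R / 2)" for x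
      using that R(1) by (simp add: b_def bump_outside)
  qed (use R(1) in auto)
  define y where "y i = ?ext (\<lambda>x. b x * ((x - a) \<bullet> axis i 1))" for i
  define \<beta> where "\<beta> = ?ext (\<lambda>x. b x * 1)"
  have y: "y i \<in> C" for i
    unfolding y_def by (rule ext) (rule smooth_on_subset[OF smooth_on_coordinate], simp)
  have \<beta>: "\<beta> \<in> C"
    unfolding \<beta>_def by (rule ext) (simp add: smooth_on_const)
  have y0: "y i p = 0" for i
    by (simp add: y_def chart_extension_def a_def)
  have \<beta>0: "\<beta> p \<noteq> 0"
    using p R(1) by (simp add: \<beta>_def chart_extension_def a_def[symmetric] b_def bump_center)
  have "\<exists>k. \<forall>X\<in>VF. X f p = (\<Sum>i\<in>UNIV. k i * X (y i) p)" if f: "f \<in> C" for f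
  proof -
    have "smooth_on ?S (f \<circ> inv_into U \<phi>)"
      using f c by (intro smooth_on_subset[OF _ R(2)]) (auto simp: smooth_functions_def)
    then obtain g where g: "\<And>i. smooth_on ?S (g i)"
      "\<And>x. x \<in> ?S \<Longrightarrow> (f \<circ> inv_into U \<phi>) x = (f \<circ> inv_into U \<phi>) a + (\<Sum>i\<in>Basis. ((x - a) \<bullet> i) * g i x)"
      by (rule hadamard_lemma) blast
    define \<gamma> where "\<gamma> i = ?ext (\<lambda>x. b x * g (axis i 1) x)" for i
    have \<gamma>: "\<gamma> i \<in> C" for i
      unfolding \<gamma>_def by (rule ext) (rule g)
    have split: "\<beta> * \<beta> * (f - const_fun (f p)) = (\<Sum>i\<in>UNIV. y i * \<gamma> i)"
    proof
      fix q
      show "(\<beta> * \<beta> * (f - const_fun (f p))) q = (\<Sum>i\<in>UNIV. y i * \<gamma> i) q"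
      proof (cases "q \<in> U \<and> \<phi> q \<in> ?S")
        case True
        then have "f q = f p + (\<Sum>i\<in>UNIV. ((\<phi> q - a) \<bullet> axis i 1) * g (axis i 1) (\<phi> q))"
          using g(2)[of "\<phi> q"] p by (simp add: chart_inv[OF c] a_def sum_Basis_cart)
        then show ?thesis
          using True by (simp add: \<beta>_def y_def \<gamma>_def chart_extension_def sum_fun_apply
              sum_distrib_left algebra_simps del: mem_ball)
      next
        case False
        then show ?thesis
          by (auto simp: \<beta>_def y_def \<gamma>_def chart_extension_def sum_fun_apply simp del: mem_ball)
      qed
    qed
    have "X f p = (\<Sum>i\<in>UNIV. (\<gamma> i p / (\<beta> p)\<^sup>2) * X (y i) p)" if X: "X \<in> VF" for X
    proof -
      have "X (\<beta> * \<beta> * (f - const_fun (f p))) p = (\<beta> p)\<^sup>2 * X f p"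
        using X \<beta> f by (simp add: VF_mult VF_diff power2_eq_square)
      moreover have "X (\<Sum>i\<in>UNIV. y i * \<gamma> i) p = (\<Sum>i\<in>UNIV. \<gamma> i p * X (y i) p)"
        using X y \<gamma> by (simp add: VF_sum VF_mult sum_fun_apply y0 mult.commute)
      ultimately have "(\<beta> p)\<^sup>2 * X f p = (\<Sum>i\<in>UNIV. \<gamma> i p * X (y i) p)"
        by (simp add: split)
      then have "X f p = (\<Sum>i\<in>UNIV. \<gamma> i p * X (y i) p) / (\<beta> p)\<^sup>2"
        using \<beta>0 by (simp add: field_simps)
      then show ?thesis
        by (simp add: sum_divide_distrib)
    qed
    then show ?thesis by (intro exI[of _ "\<lambda>i. \<gamma> i p / (\<beta> p)\<^sup>2"]) blast
  qed
  with y show ?thesis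
    by (intro exI[of _ y] conjI allI ballI)
qed

end

section \<open>Traces over a ring of functions\<close>

text \<open>A trace computed in one basis agrees with the trace in any other one. If \<open>P\<close> and \<open>Q\<close> are the two
  change-of-basis matrices, uniqueness of coordinates gives one of the two relations \<open>PQ = 1\<close>, and this
  one already implies \<open>tr(PcQ) = tr c\<close>.\<close>

lemma module_trace_eq:
  fixes sc :: "'r::comm_ring_1 \<Rightarrow> 'm::ab_group_add \<Rightarrow> 'm" and n :: nat
  assumes m: "module sc"
    and R: "0 \<in> R" "1 \<in> R" "\<And>f h. f \<in> R \<Longrightarrow> h \<in> R \<Longrightarrow> f + h \<in> R" "\<And>f h. f \<in> R \<Longrightarrow> h \<in> R \<Longrightarrow> f * h \<in> R"
    and M: "0 \<in> M" "\<And>x y. x \<in> M \<Longrightarrow> y \<in> M \<Longrightarrow> x + y \<in> M" "\<And>f x. f \<in> R \<Longrightarrow> x \<in> M \<Longrightarrow> sc f x \<in> M"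
    and T: "\<And>x y. x \<in> M \<Longrightarrow> y \<in> M \<Longrightarrow> T (x + y) = T x + T y"
      "\<And>f x. f \<in> R \<Longrightarrow> x \<in> M \<Longrightarrow> T (sc f x) = sc f (T x)"
    and b: "is_basis R sc M {..<n} b"
    and c: "\<And>i j. i < n \<Longrightarrow> j < n \<Longrightarrow> c i j \<in> R" "\<And>j. j < n \<Longrightarrow> T (b j) = (\<Sum>i<n. sc (c i j) (b i))"
  shows "module_trace R sc M T = (\<Sum>i<n. c i i)"
  unfolding module_trace_def
proof (rule the_equality)
  show "\<exists>(n'::nat) b' c'. is_basis R sc M {..<n'} b' \<and> (\<forall>i<n'. \<forall>j<n'. c' i j \<in> R) \<and>
      (\<forall>j<n'. T (b' j) = (\<Sum>i<n'. sc (c' i j) (b' i))) \<and> (\<Sum>i<n. c i i) = (\<Sum>i<n'. c' i i)"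
    using b c by blast
next
  interpret module sc by (rule m)
  fix t
  assume "\<exists>(n::nat) b c. is_basis R sc M {..<n} b \<and> (\<forall>i<n. \<forall>j<n. c i j \<in> R) \<and>
      (\<forall>j<n. T (b j) = (\<Sum>i<n. sc (c i j) (b i))) \<and> t = (\<Sum>i<n. c i i)"
  then obtain n' :: nat and b' c' where b': "is_basis R sc M {..<n'} b'"
    and c': "\<And>i j. i < n' \<Longrightarrow> j < n' \<Longrightarrow> c' i j \<in> R"
      "\<And>j. j < n' \<Longrightarrow> T (b' j) = (\<Sum>i<n'. sc (c' i j) (b' i))" "t = (\<Sum>i<n'. c' i i)"
    by blast
  have sumR: "(\<Sum>i\<in>S. f i) \<in> R" if "\<And>i. i \<in> S \<Longrightarrow> f i \<in> R" for f :: "nat \<Rightarrow> 'r" and S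
    using that by (induction S rule: infinite_finite_induct) (auto intro: R)
  have sumM: "(\<Sum>i\<in>S. f i) \<in> M" if "\<And>i. i \<in> S \<Longrightarrow> f i \<in> M" for f :: "nat \<Rightarrow> 'm" and S
    using that by (induction S rule: infinite_finite_induct) (auto intro: M)
  have T0: "T 0 = 0"
    using T(2)[OF R(1) M(1)] by simp
  have sumT: "T (\<Sum>i\<in>S. f i) = (\<Sum>i\<in>S. T (f i))" if "\<And>i. i \<in> S \<Longrightarrow> f i \<in> M" for f :: "nat \<Rightarrow> 'm" and S
    using that by (induction S rule: infinite_finite_induct) (auto simp: T T0 sumM)
  have coords: "\<exists>k. (\<forall>i<l. k i \<in> R) \<and> x = (\<Sum>i<l. sc (k i) (a i))"
    if "is_basis R sc M {..<l} a" "x \<in> M" for l :: nat and a x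
  proof -
    have "\<exists>!k. (\<forall>i\<in>{..<l}. k i \<in> R) \<and> (\<forall>i. i \<notin> {..<l} \<longrightarrow> k i = 0) \<and> x = (\<Sum>i\<in>{..<l}. sc (k i) (a i))"
      using that(1) unfolding is_basis_def by (elim conjE) (rule bspec[OF _ that(2)])
    then obtain k where "\<forall>i\<in>{..<l}. k i \<in> R" "x = (\<Sum>i\<in>{..<l}. sc (k i) (a i))"
      by (elim ex1E conjE) (rule that)
    then show ?thesis by auto
  qed
  have unique: "k i = k' i"
    if a: "is_basis R sc M {..<l} a" and "\<And>i. i < l \<Longrightarrow> k i \<in> R" "\<And>i. i < l \<Longrightarrow> k' i \<in> R"
      "(\<Sum>i<l. sc (k i) (a i)) = (\<Sum>i<l. sc (k' i) (a i))" "i < l" for l :: nat and a k k' i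
  proof -
    let ?t = "\<lambda>k i. if i < l then k i else 0"
    have aM: "a i \<in> M" if "i < l" for i
      using a that by (auto simp: is_basis_def)
    have sum: "(\<Sum>i<l. sc (k i) (a i)) \<in> M"
      by (intro sumM M) (use that(2) aM in auto)
    define P where "P r \<longleftrightarrow> (\<forall>i\<in>{..<l}. r i \<in> R) \<and> (\<forall>i. i \<notin> {..<l} \<longrightarrow> r i = 0) \<and>
        (\<Sum>i<l. sc (k i) (a i)) = (\<Sum>i\<in>{..<l}. sc (r i) (a i))" for r
    have "\<exists>!r. P r"
      using a unfolding is_basis_def P_def by (elim conjE) (rule bspec[OF _ sum])
    moreover have "P (?t k)"
      using that(2) by (auto simp: P_def)
    moreover have "P (?t k')"
      using that(3,4) by (auto simp: P_def)
    ultimately have "?t k = ?t k'" by blast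
    from fun_cong[OF this, of i] show ?thesis using \<open>i < l\<close> by simp
  qed
  have bM: "b i \<in> M" if "i < n" for i
    using b that by (auto simp: is_basis_def)
  have b'M: "b' i \<in> M" if "i < n'" for i
    using b' that by (auto simp: is_basis_def)
  obtain Q where Q: "\<And>i j. j < n' \<Longrightarrow> i < n \<Longrightarrow> Q j i \<in> R" "\<And>j. j < n' \<Longrightarrow> b' j = (\<Sum>i<n. sc (Q j i) (b i))"
    using coords[OF b b'M] by metis
  obtain P where P: "\<And>i j. i < n \<Longrightarrow> j < n' \<Longrightarrow> P i j \<in> R" "\<And>i. i < n \<Longrightarrow> b i = (\<Sum>j<n'. sc (P i j) (b' j))"
    using coords[OF b' bM] by metis
  have PQ: "(\<Sum>j<n'. P i j * Q j l) = (if l = i then 1 else 0)" if "i < n" "l < n" for i l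
  proof (rule unique[OF b, where k = "\<lambda>l. \<Sum>j<n'. P i j * Q j l" and k' = "\<lambda>l. if l = i then 1 else 0" and i = l])
    show "(\<Sum>l<n. sc (\<Sum>j<n'. P i j * Q j l) (b l)) = (\<Sum>l<n. sc (if l = i then 1 else 0) (b l))"
    proof -
      have "(\<Sum>l<n. sc (if l = i then 1 else 0) (b l)) = (\<Sum>l<n. if l = i then b l else 0)"
        by (rule sum.cong) auto
      also have "\<dots> = b i"
        using \<open>i < n\<close> by simp
      also have "\<dots> = (\<Sum>j<n'. sc (P i j) (\<Sum>l<n. sc (Q j l) (b l)))"
        using P(2)[OF \<open>i < n\<close>] Q(2) by simp
      also have "\<dots> = (\<Sum>l<n. \<Sum>j<n'. sc (P i j * Q j l) (b l))"
        by (subst sum.swap) (simp add: scale_sum_right)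
      finally show ?thesis
        by (simp add: scale_sum_left)
    qed
  qed (use that P(1) Q(1) R in \<open>auto intro!: sumR\<close>)
  have c'_eq: "c' k j = (\<Sum>i<n. \<Sum>l<n. Q j i * c l i * P l k)" if "k < n'" "j < n'" for k j
  proof (rule unique[OF b' _ _ _ \<open>k < n'\<close>, where k = "\<lambda>k. c' k j" and k' = "\<lambda>k. \<Sum>i<n. \<Sum>l<n. Q j i * c l i * P l k"])
    have "(\<Sum>k<n'. sc (c' k j) (b' k)) = T (\<Sum>i<n. sc (Q j i) (b i))"
      using c'(2)[OF \<open>j < n'\<close>] Q(2)[OF \<open>j < n'\<close>] by simp
    also have "\<dots> = (\<Sum>i<n. sc (Q j i) (\<Sum>l<n. sc (c l i) (\<Sum>k<n'. sc (P l k) (b' k))))"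
    proof -
      have "T (\<Sum>i<n. sc (Q j i) (b i)) = (\<Sum>i<n. T (sc (Q j i) (b i)))"
        by (rule sumT) (use Q(1)[OF \<open>j < n'\<close>] bM M(3) in auto)
      also have "\<dots> = (\<Sum>i<n. sc (Q j i) (\<Sum>l<n. sc (c l i) (b l)))"
        using Q(1)[OF \<open>j < n'\<close>] by (simp add: T bM c(2))
      also have "\<dots> = (\<Sum>i<n. sc (Q j i) (\<Sum>l<n. sc (c l i) (\<Sum>k<n'. sc (P l k) (b' k))))"
        by (simp add: P(2)[symmetric])
      finally show ?thesis .
    qed
    also have "\<dots> = (\<Sum>i<n. \<Sum>l<n. \<Sum>k<n'. sc (Q j i * c l i * P l k) (b' k))"
      by (simp add: scale_sum_right mult.assoc)
    also have "\<dots> = (\<Sum>i<n. \<Sum>k<n'. \<Sum>l<n. sc (Q j i * c l i * P l k) (b' k))"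
      by (rule sum.cong[OF refl], rule sum.swap)
    also have "\<dots> = (\<Sum>k<n'. \<Sum>i<n. \<Sum>l<n. sc (Q j i * c l i * P l k) (b' k))"
      by (rule sum.swap)
    finally show "(\<Sum>k<n'. sc (c' k j) (b' k)) = (\<Sum>k<n'. sc (\<Sum>i<n. \<Sum>l<n. Q j i * c l i * P l k) (b' k))"
      by (simp add: scale_sum_left)
  qed (use that c'(1) c(1) P(1) Q(1) R in \<open>auto intro!: sumR\<close>)
  have "t = (\<Sum>j<n'. \<Sum>i<n. \<Sum>l<n. c l i * (P l j * Q j i))"
    using c'(3) c'_eq by (simp add: mult_ac)
  also have "\<dots> = (\<Sum>i<n. \<Sum>j<n'. \<Sum>l<n. c l i * (P l j * Q j i))"
    by (rule sum.swap)
  also have "\<dots> = (\<Sum>i<n. \<Sum>l<n. c l i * (\<Sum>j<n'. P l j * Q j i))"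
    by (rule sum.cong[OF refl], subst sum.swap) (simp add: sum_distrib_left)
  also have "\<dots> = (\<Sum>i<n. \<Sum>l<n. if i = l then c l i else 0)"
    by (intro sum.cong refl) (simp add: PQ)
  also have "\<dots> = (\<Sum>i<n. c i i)"
    by simp
  finally show "t = (\<Sum>i<n. c i i)" .
qed

section \<open>Courant algebroids with an orthonormal frame\<close>

text \<open>The algebraic content of a Courant algebroid that is trivialized by a frame: \<open>R\<close> is the ring of
  functions, \<open>M\<close> the module of sections, \<open>pr\<close> the scalar product, \<open>act u\<close> the derivation given by the anchor
  of \<open>u\<close>, and \<open>br\<close> the Dorfman bracket. The frame is orthonormal with signs \<open>\<eta>\<close> and has constant structure
  coefficients, where constancy is expressed by the vanishing of all derivatives. The Leibniz rules of the
  bracket follow from these axioms and the nondegeneracy of \<open>pr\<close>.\<close>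

locale courant_frame = module sc
  for sc :: "'r::comm_ring_1 \<Rightarrow> 'm::ab_group_add \<Rightarrow> 'm" +
  fixes R :: "'r set" and M :: "'m set" and pr :: "'m \<Rightarrow> 'm \<Rightarrow> 'r"
    and act :: "'m \<Rightarrow> 'r \<Rightarrow> 'r" and br :: "'m \<Rightarrow> 'm \<Rightarrow> 'm"
    and I :: "nat set" and e :: "nat \<Rightarrow> 'm" and \<eta> :: "nat \<Rightarrow> 'r"
  assumes R [simp]: "0 \<in> R" "1 \<in> R" "\<And>f h. f \<in> R \<Longrightarrow> h \<in> R \<Longrightarrow> f + h \<in> R"
      "\<And>f h. f \<in> R \<Longrightarrow> h \<in> R \<Longrightarrow> f * h \<in> R" "\<And>f. f \<in> R \<Longrightarrow> - f \<in> R"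
    and M [simp]: "0 \<in> M" "\<And>x y. x \<in> M \<Longrightarrow> y \<in> M \<Longrightarrow> x + y \<in> M"
      "\<And>f x. f \<in> R \<Longrightarrow> x \<in> M \<Longrightarrow> sc f x \<in> M"
    and pr_mem [simp]: "\<And>u v. u \<in> M \<Longrightarrow> v \<in> M \<Longrightarrow> pr u v \<in> R"
    and pr_sym: "\<And>u v. u \<in> M \<Longrightarrow> v \<in> M \<Longrightarrow> pr u v = pr v u"
    and pr_add: "\<And>u v w. u \<in> M \<Longrightarrow> v \<in> M \<Longrightarrow> w \<in> M \<Longrightarrow> pr (u + v) w = pr u w + pr v w"
    and pr_scale: "\<And>f u v. f \<in> R \<Longrightarrow> u \<in> M \<Longrightarrow> v \<in> M \<Longrightarrow> pr (sc f u) v = f * pr u v"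
    and act_mem [simp]: "\<And>u f. u \<in> M \<Longrightarrow> f \<in> R \<Longrightarrow> act u f \<in> R"
    and act_add: "\<And>u f h. u \<in> M \<Longrightarrow> f \<in> R \<Longrightarrow> h \<in> R \<Longrightarrow> act u (f + h) = act u f + act u h"
    and act_mult: "\<And>u f h. u \<in> M \<Longrightarrow> f \<in> R \<Longrightarrow> h \<in> R \<Longrightarrow> act u (f * h) = act u f * h + f * act u h"
    and act_add_left: "\<And>u v f. u \<in> M \<Longrightarrow> v \<in> M \<Longrightarrow> f \<in> R \<Longrightarrow> act (u + v) f = act u f + act v f"
    and act_scale_left: "\<And>u h f. u \<in> M \<Longrightarrow> h \<in> R \<Longrightarrow> f \<in> R \<Longrightarrow> act (sc h u) f = h * act u f"
    and br_mem [simp]: "\<And>u v. u \<in> M \<Longrightarrow> v \<in> M \<Longrightarrow> br u v \<in> M"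
    and br_pr: "\<And>u v w. u \<in> M \<Longrightarrow> v \<in> M \<Longrightarrow> w \<in> M \<Longrightarrow> act u (pr v w) = pr (br u v) w + pr v (br u w)"
    and br_sym: "\<And>u v w. u \<in> M \<Longrightarrow> v \<in> M \<Longrightarrow> w \<in> M \<Longrightarrow> pr (br u v + br v u) w = act w (pr u v)"
    and act_br: "\<And>u v f. u \<in> M \<Longrightarrow> v \<in> M \<Longrightarrow> f \<in> R \<Longrightarrow> act (br u v) f = act u (act v f) - act v (act u f)"
    and I [simp]: "finite I"
    and e [simp]: "\<And>A. A \<in> I \<Longrightarrow> e A \<in> M"
    and \<eta> [simp]: "\<And>A. A \<in> I \<Longrightarrow> \<eta> A \<in> R"
    and \<eta>_sq: "\<And>A. A \<in> I \<Longrightarrow> \<eta> A * \<eta> A = 1"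
    and act_\<eta> [simp]: "\<And>u A. u \<in> M \<Longrightarrow> A \<in> I \<Longrightarrow> act u (\<eta> A) = 0"
    and orth: "\<And>A A'. A \<in> I \<Longrightarrow> A' \<in> I \<Longrightarrow> pr (e A) (e A') = (if A = A' then \<eta> A else 0)"
    and expand: "\<And>u. u \<in> M \<Longrightarrow> u = (\<Sum>A\<in>I. sc (\<eta> A * pr u (e A)) (e A))"
    and act_br_frame: "\<And>u A A' A''. u \<in> M \<Longrightarrow> A \<in> I \<Longrightarrow> A' \<in> I \<Longrightarrow> A'' \<in> I \<Longrightarrow>
        act u (pr (br (e A) (e A')) (e A'')) = 0"
begin

lemma R_diff [simp]: "f \<in> R \<Longrightarrow> h \<in> R \<Longrightarrow> f - h \<in> R"
  using R(3)[of f "- h"] by simp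

lemma R_sum [simp]: "(\<And>i. i \<in> S \<Longrightarrow> f i \<in> R) \<Longrightarrow> (\<Sum>i\<in>S. f i) \<in> R"
  by (induction S rule: infinite_finite_induct) auto

lemma M_uminus [simp]: "u \<in> M \<Longrightarrow> - u \<in> M"
  using M(3)[of "- 1" u] by simp

lemma M_diff [simp]: "u \<in> M \<Longrightarrow> v \<in> M \<Longrightarrow> u - v \<in> M"
  using M(2)[of u "- v"] by simp

lemma M_sum [simp]: "(\<And>i. i \<in> S \<Longrightarrow> f i \<in> M) \<Longrightarrow> (\<Sum>i\<in>S. f i) \<in> M"
  by (induction S rule: infinite_finite_induct) auto

lemma act_0 [simp]: "u \<in> M \<Longrightarrow> act u 0 = 0"
  using act_add[of u 0 0] by simp

lemma act_sum: "u \<in> M \<Longrightarrow> (\<And>i. i \<in> S \<Longrightarrow> f i \<in> R) \<Longrightarrow> act u (\<Sum>i\<in>S. f i) = (\<Sum>i\<in>S. act u (f i))"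
  by (induction S rule: infinite_finite_induct) (auto simp: act_add)

lemma pr_0 [simp]: "v \<in> M \<Longrightarrow> pr 0 v = 0" "v \<in> M \<Longrightarrow> pr v 0 = 0"
  using pr_scale[of 0 0 v] pr_sym[of v 0] by simp_all

lemma pr_uminus: "u \<in> M \<Longrightarrow> v \<in> M \<Longrightarrow> pr (- u) v = - pr u v"
  using pr_scale[of "- 1" u v] by simp

lemma pr_diff: "u \<in> M \<Longrightarrow> v \<in> M \<Longrightarrow> w \<in> M \<Longrightarrow> pr (u - v) w = pr u w - pr v w"
  using pr_add[of u "- v" w] by (simp add: pr_uminus)

lemma pr_add_right: "u \<in> M \<Longrightarrow> v \<in> M \<Longrightarrow> w \<in> M \<Longrightarrow> pr w (u + v) = pr w u + pr w v"
  using pr_add[of u v w] by (simp add: pr_sym[of w])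

lemma pr_scale_right: "f \<in> R \<Longrightarrow> u \<in> M \<Longrightarrow> v \<in> M \<Longrightarrow> pr v (sc f u) = f * pr v u"
  using pr_scale[of f u v] by (simp add: pr_sym[of v])

lemma pr_diff_right: "u \<in> M \<Longrightarrow> v \<in> M \<Longrightarrow> w \<in> M \<Longrightarrow> pr w (u - v) = pr w u - pr w v"
  using pr_diff[of u v w] by (simp add: pr_sym[of w])

lemma pr_sum: "v \<in> M \<Longrightarrow> (\<And>i. i \<in> S \<Longrightarrow> f i \<in> M) \<Longrightarrow> pr (\<Sum>i\<in>S. f i) v = (\<Sum>i\<in>S. pr (f i) v)"
  by (induction S rule: infinite_finite_induct) (auto simp: pr_add)

lemmas pr_linear = pr_add pr_add_right pr_diff pr_diff_right pr_scale pr_scale_right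

lemma pr_ext:
  assumes "u \<in> M" "v \<in> M" "\<And>A. A \<in> I \<Longrightarrow> pr u (e A) = pr v (e A)"
  shows "u = v"
  using expand[OF assms(1)] expand[OF assms(2)] assms(3) by simp

lemma parseval:
  assumes "u \<in> M" "v \<in> M"
  shows "pr u v = (\<Sum>A\<in>I. \<eta> A * pr u (e A) * pr v (e A))"
proof -
  have "pr u v = pr (\<Sum>A\<in>I. sc (\<eta> A * pr u (e A)) (e A)) v"
    using expand[OF assms(1)] by simp
  then show ?thesis
    using assms by (simp add: pr_sum pr_scale pr_sym[of v])
qed

lemma br_scale_right:
  assumes "u \<in> M" "v \<in> M" "f \<in> R"
  shows "br u (sc f v) = sc (act u f) v + sc f (br u v)"
proof (rule pr_ext)
  fix A assume A: "A \<in> I"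
  have "act u (f * pr v (e A)) = pr (br u (sc f v)) (e A) + f * pr v (br u (e A))"
    using br_pr[of u "sc f v" "e A"] assms A by (simp add: pr_linear)
  moreover have "act u (pr v (e A)) = pr (br u v) (e A) + pr v (br u (e A))"
    using br_pr[of u v "e A"] assms A by simp
  ultimately show "pr (br u (sc f v)) (e A) = pr (sc (act u f) v + sc f (br u v)) (e A)"
    using assms A by (simp add: pr_linear act_mult algebra_simps)
qed (use assms in auto)

lemma br_add_right:
  assumes "u \<in> M" "v \<in> M" "w \<in> M"
  shows "br u (v + w) = br u v + br u w"
proof (rule pr_ext)
  fix A assume A: "A \<in> I"
  show "pr (br u (v + w)) (e A) = pr (br u v + br u w) (e A)"
    using br_pr[of u "v + w" "e A"] br_pr[of u v "e A"] br_pr[of u w "e A"] assms A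
    by (simp add: pr_linear act_add algebra_simps)
qed (use assms in auto)

lemma br_swap:
  "u \<in> M \<Longrightarrow> v \<in> M \<Longrightarrow> w \<in> M \<Longrightarrow> pr (br u v) w = act w (pr u v) - pr (br v u) w"
  using br_sym[of u v w] by (simp add: pr_linear eq_diff_eq)

lemma br_add_left:
  assumes "u \<in> M" "v \<in> M" "w \<in> M"
  shows "br (u + v) w = br u w + br v w"
proof (rule pr_ext)
  fix A assume A: "A \<in> I"
  show "pr (br (u + v) w) (e A) = pr (br u w + br v w) (e A)"
    using assms A by (simp add: pr_linear br_swap[of "u + v" w] br_swap[of u w] br_swap[of v w]
        br_add_right act_add)
qed (use assms in auto)

text \<open>Unlike the Leibniz rule in the second argument this one has a correction term, the gradient of
  \<open>f\<close> times \<open>\<langle>u, v\<rangle>\<close>; it is stated after pairing with \<open>w\<close>, which avoids introducing gradients.\<close>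

lemma pr_br_scale_left:
  assumes "u \<in> M" "v \<in> M" "w \<in> M" "f \<in> R"
  shows "pr (br (sc f u) v) w = f * pr (br u v) w - act v f * pr u w + act w f * pr u v"
  using assms by (simp add: br_swap[of "sc f u" v w] br_swap[of u v w] pr_linear br_scale_right
      act_mult algebra_simps)

text \<open>The span of the frame vectors with index in \<open>J\<close>, described by the vanishing of the other
  coordinates.\<close>

definition part :: "nat set \<Rightarrow> 'm set" where
  "part J = {u \<in> M. \<forall>A\<in>I - J. pr u (e A) = 0}"

lemma part_M: "u \<in> part J \<Longrightarrow> u \<in> M"
  by (simp add: part_def)

lemma part_zero: "u \<in> part J \<Longrightarrow> A \<in> I \<Longrightarrow> A \<notin> J \<Longrightarrow> pr u (e A) = 0"
  by (simp add: part_def)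

lemma part_intro: "u \<in> M \<Longrightarrow> (\<And>A. A \<in> I \<Longrightarrow> A \<notin> J \<Longrightarrow> pr u (e A) = 0) \<Longrightarrow> u \<in> part J"
  by (simp add: part_def)

lemma part_I: "part I = M"
  by (auto simp: part_def)

lemma part_closed [simp]:
  "0 \<in> part J" "u \<in> part J \<Longrightarrow> v \<in> part J \<Longrightarrow> u + v \<in> part J"
  "f \<in> R \<Longrightarrow> u \<in> part J \<Longrightarrow> sc f u \<in> part J"
  by (simp_all add: part_def pr_linear)

lemma part_sum [simp]: "(\<And>i. i \<in> S \<Longrightarrow> f i \<in> part J) \<Longrightarrow> (\<Sum>i\<in>S. f i) \<in> part J"
  by (induction S rule: infinite_finite_induct) auto

lemma part_diff [simp]: "u \<in> part J \<Longrightarrow> v \<in> part J \<Longrightarrow> u - v \<in> part J"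
  by (simp add: part_def pr_linear)

lemma e_part [simp]: "A \<in> J \<Longrightarrow> J \<subseteq> I \<Longrightarrow> e A \<in> part J"
  by (auto simp: part_def orth)

lemma part_expand:
  assumes "u \<in> part J" "J \<subseteq> I"
  shows "u = (\<Sum>A\<in>J. sc (\<eta> A * pr u (e A)) (e A))"
proof -
  have "(\<Sum>A\<in>I. sc (\<eta> A * pr u (e A)) (e A)) = (\<Sum>A\<in>J. sc (\<eta> A * pr u (e A)) (e A))"
    by (rule sum.mono_neutral_right) (use assms in \<open>auto simp: part_def\<close>)
  then show ?thesis
    using expand[OF part_M[OF assms(1)]] by simp
qed

lemma part_orthogonal:
  assumes "u \<in> part J" "v \<in> part K" "J \<inter> K = {}"
  shows "pr u v = 0"
  unfolding parseval[OF part_M[OF assms(1)] part_M[OF assms(2)]]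
proof (intro sum.neutral ballI)
  fix A assume "A \<in> I"
  then have "pr u (e A) = 0 \<or> pr v (e A) = 0"
    using assms by (auto simp: part_def)
  then show "\<eta> A * pr u (e A) * pr v (e A) = 0" by auto
qed

declare part_M [simp]

lemma trace_part:
  assumes J: "J \<subseteq> I"
    and T: "\<And>x. x \<in> part J \<Longrightarrow> T x \<in> part J"
      "\<And>x y. x \<in> part J \<Longrightarrow> y \<in> part J \<Longrightarrow> T (x + y) = T x + T y"
      "\<And>f x. f \<in> R \<Longrightarrow> x \<in> part J \<Longrightarrow> T (sc f x) = sc f (T x)"
  shows "module_trace R sc (part J) T = (\<Sum>A\<in>J. \<eta> A * pr (T (e A)) (e A))"
proof -
  have fin: "finite J" using J I finite_subset by blast
  then obtain h where h: "bij_betw h {..<card J} J"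
    using ex_bij_betw_nat_finite atLeast0LessThan by metis
  have hJ: "h i \<in> J" "h i \<in> I" if "i < card J" for i
    using h that J by (auto simp: bij_betw_def)
  have re: "(\<Sum>i<card J. F (h i)) = (\<Sum>A\<in>J. F A)" for F :: "nat \<Rightarrow> 'z::comm_monoid_add"
    using sum.reindex_bij_betw[OF h] by fast
  have basis: "is_basis R sc (part J) {..<card J} (\<lambda>i. e (h i))"
    unfolding is_basis_def
  proof (intro conjI ballI)
    fix x assume x: "x \<in> part J"
    show "\<exists>!c. (\<forall>i\<in>{..<card J}. c i \<in> R) \<and> (\<forall>i. i \<notin> {..<card J} \<longrightarrow> c i = 0) \<and>
        x = (\<Sum>i<card J. sc (c i) (e (h i)))"
    proof (rule ex1I)
      let ?c = "\<lambda>i. if i < card J then \<eta> (h i) * pr x (e (h i)) else 0"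
      have "x = (\<Sum>i<card J. sc (?c i) (e (h i)))"
        using part_expand[OF x J] re[of "\<lambda>A. sc (\<eta> A * pr x (e A)) (e A)"] by simp
      then show "(\<forall>i\<in>{..<card J}. ?c i \<in> R) \<and> (\<forall>i. i \<notin> {..<card J} \<longrightarrow> ?c i = 0) \<and>
        x = (\<Sum>i<card J. sc (?c i) (e (h i)))"
        using hJ x by auto
    next
      fix c assume c: "(\<forall>i\<in>{..<card J}. c i \<in> R) \<and> (\<forall>i. i \<notin> {..<card J} \<longrightarrow> c i = 0) \<and>
        x = (\<Sum>i<card J. sc (c i) (e (h i)))"
      show "c = (\<lambda>i. if i < card J then \<eta> (h i) * pr x (e (h i)) else 0)"
      proof
        fix i
        show "c i = (if i < card J then \<eta> (h i) * pr x (e (h i)) else 0)"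
        proof (cases "i < card J")
          case True
          have cR: "c j \<in> R" if "j < card J" for j
            using c that by blast
          have "pr x (e (h i)) = pr (\<Sum>j<card J. sc (c j) (e (h j))) (e (h i))"
            using c by simp
          also have "\<dots> = (\<Sum>j<card J. c j * pr (e (h j)) (e (h i)))"
            by (subst pr_sum) (use hJ True cR in \<open>auto simp: pr_scale\<close>)
          also have "\<dots> = (\<Sum>j<card J. if j = i then c j * \<eta> (h j) else 0)"
            using hJ True h by (intro sum.cong) (auto simp: orth bij_betw_def inj_on_def)
          finally show ?thesis
            using True hJ \<eta>_sq[of "h i"] by (simp add: mult.left_commute)
        qed (use c in auto)
      qed
    qed
  qed (use hJ J in auto)
  have "module_trace R sc (part J) T
      = (\<Sum>i<card J. \<eta> (h i) * pr (T (e (h i))) (e (h i)))"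
  proof (rule module_trace_eq[OF module_axioms, where c = "\<lambda>i j. \<eta> (h i) * pr (T (e (h j))) (e (h i))"])
    fix j assume "j < card J"
    then have "T (e (h j)) \<in> part J" using T(1) hJ J by simp
    then show "T (e (h j)) = (\<Sum>i<card J. sc (\<eta> (h i) * pr (T (e (h j))) (e (h i))) (e (h i)))"
      using part_expand[OF _ J] re[of "\<lambda>A. sc (\<eta> A * pr (T (e (h j))) (e A)) (e A)"] by simp
  next
    fix i j assume "i < card J" "j < card J"
    then show "\<eta> (h i) * pr (T (e (h j))) (e (h i)) \<in> R"
      using T(1) hJ J part_M by (metis R(4) \<eta> e e_part pr_mem)
  qed (use T basis in simp_all)
  then show ?thesis
    using re[of "\<lambda>A. \<eta> A * pr (T (e A)) (e A)"] by simp
qed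

lemma part_linear_zero:
  assumes J: "J \<subseteq> I" and T: "\<And>x y. x \<in> part J \<Longrightarrow> y \<in> part J \<Longrightarrow> T (x + y) = T x + T y"
      "\<And>f x. f \<in> R \<Longrightarrow> x \<in> part J \<Longrightarrow> T (sc f x) = f * T x"
    and 0: "\<And>A. A \<in> J \<Longrightarrow> T (e A) = (0::'r)" and u: "u \<in> part J"
  shows "T u = 0"
proof -
  have fin: "finite J" using J I finite_subset by blast
  have T0: "T 0 = 0"
    using T(2)[of 0 0] by simp
  have "T (\<Sum>A\<in>S. sc (k A) (e A)) = 0" if "finite S" "S \<subseteq> J" "\<And>A. A \<in> S \<Longrightarrow> k A \<in> R" for S k
    using that
  proof (induction S)
    case (insert A S)
    have "(\<Sum>A\<in>S. sc (k A) (e A)) \<in> part J"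
      using insert.prems J by (intro part_sum part_closed(3) e_part) auto
    then show ?case
      using insert J by (simp add: T 0)
  qed (simp add: T0)
  from this[of J "\<lambda>A. \<eta> A * pr u (e A)"] show ?thesis
    using part_expand[OF u J] fin J u by (auto simp: subset_iff)
qed

section \<open>Connections\<close>

definition gconn :: "('m \<Rightarrow> 'm \<Rightarrow> 'm) \<Rightarrow> bool" where
  "gconn D \<longleftrightarrow>
     (\<forall>u\<in>M. \<forall>v\<in>M. D u v \<in> M) \<and>
     (\<forall>u\<in>M. \<forall>u'\<in>M. \<forall>v\<in>M. D (u + u') v = D u v + D u' v) \<and>
     (\<forall>f\<in>R. \<forall>u\<in>M. \<forall>v\<in>M. D (sc f u) v = sc f (D u v)) \<and>
     (\<forall>u\<in>M. \<forall>v\<in>M. \<forall>w\<in>M. D u (v + w) = D u v + D u w) \<and>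
     (\<forall>f\<in>R. \<forall>u\<in>M. \<forall>v\<in>M. D u (sc f v) = sc (act u f) v + sc f (D u v)) \<and>
     (\<forall>u\<in>M. \<forall>v\<in>M. \<forall>w\<in>M. act u (pr v w) = pr (D u v) w + pr v (D u w))"

definition tors :: "('m \<Rightarrow> 'm \<Rightarrow> 'm) \<Rightarrow> 'm \<Rightarrow> 'm \<Rightarrow> 'm \<Rightarrow> 'r" where
  "tors D u v w = pr (D u v - D v u - br u v) w + pr v (D w u)"

definition curv :: "('m \<Rightarrow> 'm \<Rightarrow> 'm) \<Rightarrow> 'm \<Rightarrow> 'm \<Rightarrow> 'm \<Rightarrow> 'm" where
  "curv D u v w = D u (D v w) - D v (D u w) - D (br u v) w"

text \<open>The structure coefficients of the frame. Invariance of the scalar product makes them totally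
  skew-symmetric.\<close>

definition B :: "nat \<Rightarrow> nat \<Rightarrow> nat \<Rightarrow> 'r" where
  "B a b c = pr (br (e a) (e b)) (e c)"

lemma B_mem [simp]: "a \<in> I \<Longrightarrow> b \<in> I \<Longrightarrow> c \<in> I \<Longrightarrow> B a b c \<in> R"
  by (simp add: B_def)

lemma act_B [simp]: "u \<in> M \<Longrightarrow> a \<in> I \<Longrightarrow> b \<in> I \<Longrightarrow> c \<in> I \<Longrightarrow> act u (B a b c) = 0"
  by (simp add: B_def act_br_frame)

lemma act_orth [simp]: "u \<in> M \<Longrightarrow> a \<in> I \<Longrightarrow> b \<in> I \<Longrightarrow> act u (pr (e a) (e b)) = 0"
  by (simp add: orth)

lemma B_antisym:
  assumes "a \<in> I" "b \<in> I" "c \<in> I"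
  shows "B b a c = - B a b c" "B a c b = - B a b c"
proof -
  show "B b a c = - B a b c"
    using br_sym[of "e a" "e b" "e c"] assms by (simp add: B_def pr_add eq_neg_iff_add_eq_0 add.commute)
  show "B a c b = - B a b c"
    using br_pr[of "e a" "e b" "e c"] assms
    by (simp add: B_def eq_neg_iff_add_eq_0 add.commute pr_sym[of "e b"])
qed

end

context courant_frame
begin

definition LC :: "nat set \<Rightarrow> ('m \<Rightarrow> 'm \<Rightarrow> 'm) \<Rightarrow> bool" where
  "LC K D \<longleftrightarrow> gconn D \<and> (\<forall>u\<in>M. \<forall>v\<in>M. \<forall>w\<in>M. tors D u v w = 0) \<and>
     (\<forall>u\<in>M. \<forall>v\<in>part K. D u v \<in> part K)"

lemma gconnD:
  assumes "gconn D"
  shows "u \<in> M \<Longrightarrow> v \<in> M \<Longrightarrow> D u v \<in> M"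
    "u \<in> M \<Longrightarrow> u' \<in> M \<Longrightarrow> v \<in> M \<Longrightarrow> D (u + u') v = D u v + D u' v"
    "f \<in> R \<Longrightarrow> u \<in> M \<Longrightarrow> v \<in> M \<Longrightarrow> D (sc f u) v = sc f (D u v)"
    "u \<in> M \<Longrightarrow> v \<in> M \<Longrightarrow> w \<in> M \<Longrightarrow> D u (v + w) = D u v + D u w"
    "f \<in> R \<Longrightarrow> u \<in> M \<Longrightarrow> v \<in> M \<Longrightarrow> D u (sc f v) = sc (act u f) v + sc f (D u v)"
    "u \<in> M \<Longrightarrow> v \<in> M \<Longrightarrow> w \<in> M \<Longrightarrow> act u (pr v w) = pr (D u v) w + pr v (D u w)"
  using assms unfolding gconn_def by blast+

lemma preserves_complement:
  assumes D: "gconn D" and JK: "J \<union> K = I" "J \<inter> K = {}"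
    and pres: "\<And>u v. u \<in> M \<Longrightarrow> v \<in> part K \<Longrightarrow> D u v \<in> part K" and u: "u \<in> M" and v: "v \<in> part J"
  shows "D u v \<in> part J"
proof -
  have "pr (D u v) (e A) = 0" if A: "A \<in> K" for A
  proof -
    have KI: "K \<subseteq> I" using JK by auto
    then have eA: "e A \<in> part K" "e A \<in> M" using A by auto
    have "pr v (e A) = 0" "pr v (D u (e A)) = 0"
      using part_orthogonal[OF v] eA pres[OF u] JK by blast+
    then show ?thesis
      using gconnD(6)[OF D u part_M[OF v] eA(2)] u by simp
  qed
  moreover have "I - J = K" using JK by auto
  ultimately show ?thesis
    using gconnD(1)[OF D u part_M[OF v]] unfolding part_def by simp
qed

lemma linear_zero:
  assumes add: "\<And>x y. x \<in> M \<Longrightarrow> y \<in> M \<Longrightarrow> T (x + y) = T x + T y"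
    and scale: "\<And>f x. f \<in> R \<Longrightarrow> x \<in> M \<Longrightarrow> T (sc f x) = f * T x"
    and 0: "\<And>A. A \<in> I \<Longrightarrow> T (e A) = (0::'r)" and u: "u \<in> M"
  shows "T u = 0"
  using part_linear_zero[OF subset_refl, of T u] assms unfolding part_I by blast

text \<open>The torsion is a tensor in all three arguments. In the first two the derivatives of \<open>f\<close> cancel between
  the connection, the bracket and the last term of the torsion.\<close>

lemma tors_zero:
  assumes D: "gconn D"
    and 0: "\<And>a b c. a \<in> I \<Longrightarrow> b \<in> I \<Longrightarrow> c \<in> I \<Longrightarrow> tors D (e a) (e b) (e c) = 0"
    and "u \<in> M" "v \<in> M" "w \<in> M"
  shows "tors D u v w = 0"
proof -
  note D' [simp] = gconnD(1)[OF D] and D'' = gconnD(2-5)[OF D]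
  have 1: "tors D (e a) (e b) w = 0" if "a \<in> I" "b \<in> I" "w \<in> M" for a b w
    by (rule linear_zero[of "\<lambda>w. tors D (e a) (e b) w"])
      (use that 0 in \<open>auto simp: tors_def pr_linear D'' algebra_simps\<close>)
  have 2: "tors D (e a) v w = 0" if "a \<in> I" "v \<in> M" "w \<in> M" for a v w
    by (rule linear_zero[of "\<lambda>v. tors D (e a) v w"])
      (use that 1 in \<open>auto simp: tors_def pr_linear D'' br_add_right br_scale_right algebra_simps\<close>)
  show ?thesis
  proof (rule linear_zero[of "\<lambda>u. tors D u v w"])
    show "tors D (sc f x) v w = f * tors D x v w" if "f \<in> R" "x \<in> M" for f x
      using assms(3-) that
      by (simp add: tors_def pr_linear D'' pr_br_scale_left pr_sym[of x v] algebra_simps)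
  qed (use assms 2 in \<open>auto simp: tors_def pr_linear D'' br_add_left algebra_simps\<close>)
qed

section \<open>Existence of Levi-Civita connections\<close>

text \<open>Christoffel symbols in an orthonormal frame can be prescribed freely, subject to three linear
  conditions: skew-symmetry (compatibility with the scalar product), a cyclic sum (vanishing torsion),
  and a block shape (invariance of the subbundle).\<close>

lemma connection_exists:
  assumes \<gamma>: "\<And>a b c. a \<in> I \<Longrightarrow> b \<in> I \<Longrightarrow> c \<in> I \<Longrightarrow> \<gamma> a b c \<in> R"
    and antisym: "\<And>a b c. a \<in> I \<Longrightarrow> b \<in> I \<Longrightarrow> c \<in> I \<Longrightarrow> \<gamma> a c b = - \<gamma> a b c"
    and cyc: "\<And>a b c. a \<in> I \<Longrightarrow> b \<in> I \<Longrightarrow> c \<in> I \<Longrightarrow> \<gamma> a b c + \<gamma> b c a + \<gamma> c a b = B a b c"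
    and block: "\<And>a b c. a \<in> I \<Longrightarrow> b \<in> K \<Longrightarrow> c \<in> I - K \<Longrightarrow> \<gamma> a b c = 0"
    and K: "K \<subseteq> I"
  obtains D where "LC K D" "\<And>a b c. a \<in> I \<Longrightarrow> b \<in> I \<Longrightarrow> c \<in> I \<Longrightarrow> pr (D (e a) (e b)) (e c) = \<gamma> a b c"
proof -
  define x where "x u A = \<eta> A * pr u (e A)" for u A
  define \<Gamma> where "\<Gamma> u v c = (\<Sum>a\<in>I. \<Sum>b\<in>I. x u a * x v b * \<gamma> a b c)" for u v c
  define D where "D u v = (\<Sum>c\<in>I. sc (\<eta> c * (act u (pr v (e c)) + \<Gamma> u v c)) (e c))" for u v
  have x_mem [simp]: "x u A \<in> R" if "u \<in> M" "A \<in> I" for u A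
    using that by (simp add: x_def)
  have \<Gamma>_mem [simp]: "\<Gamma> u v c \<in> R" if "u \<in> M" "v \<in> M" "c \<in> I" for u v c
    unfolding \<Gamma>_def using that by (intro R_sum R) (auto intro: \<gamma>)
  have D_mem [simp]: "D u v \<in> M" if "u \<in> M" "v \<in> M" for u v
    using that by (simp add: D_def)
  have D_pr: "pr (D u v) (e c) = act u (pr v (e c)) + \<Gamma> u v c" if "u \<in> M" "v \<in> M" "c \<in> I" for u v c
  proof -
    have "pr (D u v) (e c) = (\<Sum>b\<in>I. \<eta> b * (act u (pr v (e b)) + \<Gamma> u v b) * pr (e b) (e c))"
      using that by (simp add: D_def pr_sum pr_scale)
    also have "\<dots> = (\<Sum>b\<in>I. if b = c then \<eta> b * \<eta> b * (act u (pr v (e b)) + \<Gamma> u v b) else 0)"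
      using that by (intro sum.cong) (auto simp: orth mult_ac)
    finally show ?thesis
      using that by (simp add: \<eta>_sq)
  qed
  have x_add: "x (u + v) A = x u A + x v A" if "u \<in> M" "v \<in> M" "A \<in> I" for u v A
    using that by (simp add: x_def pr_linear algebra_simps)
  have x_scale: "x (sc f u) A = f * x u A" if "u \<in> M" "f \<in> R" "A \<in> I" for u f A
    using that by (simp add: x_def pr_linear algebra_simps)
  have x_e: "x (e a) A = (if A = a then 1 else 0)" if "a \<in> I" "A \<in> I" for a A
    using that by (simp add: x_def orth \<eta>_sq)
  have \<Gamma>_add: "\<Gamma> (u + u') v c = \<Gamma> u v c + \<Gamma> u' v c" "\<Gamma> v (u + u') c = \<Gamma> v u c + \<Gamma> v u' c"
    if "u \<in> M" "u' \<in> M" "v \<in> M" for u u' v c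
    using that by (simp_all add: \<Gamma>_def x_add sum.distrib[symmetric] algebra_simps cong: sum.cong)
  have \<Gamma>_scale: "\<Gamma> (sc f u) v c = f * \<Gamma> u v c" "\<Gamma> v (sc f u) c = f * \<Gamma> v u c"
    if "u \<in> M" "f \<in> R" "v \<in> M" for f u v c
    using that by (simp_all add: \<Gamma>_def x_scale sum_distrib_left algebra_simps cong: sum.cong)
  have \<Gamma>_e: "\<Gamma> (e a) (e b) c = \<gamma> a b c" if "a \<in> I" "b \<in> I" for a b c
  proof -
    have "\<Gamma> (e a) (e b) c = (\<Sum>a'\<in>I. \<Sum>b'\<in>I. if b' = b then if a' = a then \<gamma> a' b' c else 0 else 0)"
      unfolding \<Gamma>_def using that by (intro sum.cong refl) (simp add: x_e)
    then show ?thesis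
      using that by simp
  qed
  have frame: "pr (D (e a) (e b)) (e c) = \<gamma> a b c" if "a \<in> I" "b \<in> I" "c \<in> I" for a b c
    using that by (simp add: D_pr \<Gamma>_e)
  have conn: "gconn D"
    unfolding gconn_def
  proof (intro conjI ballI)
    fix u v w assume u [simp]: "u \<in> M" and v [simp]: "v \<in> M" and w [simp]: "w \<in> M"
    show "D (u + v) w = D u w + D v w"
      by (rule pr_ext) (simp_all add: D_pr pr_linear \<Gamma>_add act_add_left)
    show "D u (v + w) = D u v + D u w"
      by (rule pr_ext) (simp_all add: D_pr pr_linear \<Gamma>_add act_add)
    have \<Gamma>_skew: "(\<Sum>c\<in>I. \<eta> c * \<Gamma> u v c * pr w (e c)) = - (\<Sum>c\<in>I. \<eta> c * pr v (e c) * \<Gamma> u w c)"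
    proof -
      have "(\<Sum>c\<in>I. \<eta> c * \<Gamma> u v c * pr w (e c)) = (\<Sum>c\<in>I. \<Sum>a\<in>I. \<Sum>b\<in>I. x u a * x v b * x w c * \<gamma> a b c)"
        by (intro sum.cong refl) (simp add: \<Gamma>_def x_def[of w] sum_distrib_left sum_distrib_right mult_ac)
      also have "\<dots> = (\<Sum>a\<in>I. \<Sum>c\<in>I. \<Sum>b\<in>I. x u a * x v b * x w c * \<gamma> a b c)"
        by (rule sum.swap)
      also have "\<dots> = (\<Sum>a\<in>I. \<Sum>b\<in>I. \<Sum>c\<in>I. x u a * x v b * x w c * \<gamma> a b c)"
        by (intro sum.cong refl sum.swap)
      also have "\<dots> = (\<Sum>a\<in>I. \<Sum>b\<in>I. \<Sum>c\<in>I. - (x u a * x v b * x w c * \<gamma> a c b))"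
      proof (intro sum.cong refl)
        fix a b c assume "a \<in> I" "b \<in> I" "c \<in> I"
        then show "x u a * x v b * x w c * \<gamma> a b c = - (x u a * x v b * x w c * \<gamma> a c b)"
          by (simp add: antisym[of a b c])
      qed
      also have "\<dots> = - (\<Sum>a\<in>I. \<Sum>b\<in>I. \<Sum>c\<in>I. x u a * x v b * x w c * \<gamma> a c b)"
        by (simp add: sum_negf)
      also have "(\<Sum>a\<in>I. \<Sum>b\<in>I. \<Sum>c\<in>I. x u a * x v b * x w c * \<gamma> a c b)
          = (\<Sum>b\<in>I. \<Sum>a\<in>I. \<Sum>c\<in>I. x u a * x v b * x w c * \<gamma> a c b)"
        by (rule sum.swap)
      also have "\<dots> = (\<Sum>c\<in>I. \<eta> c * pr v (e c) * \<Gamma> u w c)"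
        by (intro sum.cong refl) (simp add: \<Gamma>_def x_def[of v] sum_distrib_left sum_distrib_right mult_ac)
      finally show ?thesis .
    qed
    have "act u (pr v w) = (\<Sum>c\<in>I. \<eta> c * (act u (pr v (e c)) * pr w (e c) + pr v (e c) * act u (pr w (e c))))"
      unfolding parseval[OF v w] by (subst act_sum) (simp_all add: act_mult algebra_simps)
    moreover have "pr (D u v) w = (\<Sum>c\<in>I. \<eta> c * (act u (pr v (e c)) + \<Gamma> u v c) * pr w (e c))"
      using parseval[of "D u v" w] by (simp add: D_pr)
    moreover have "pr v (D u w) = (\<Sum>c\<in>I. \<eta> c * pr v (e c) * (act u (pr w (e c)) + \<Gamma> u w c))"
      using parseval[of v "D u w"] by (simp add: D_pr)
    ultimately show "act u (pr v w) = pr (D u v) w + pr v (D u w)"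
      using \<Gamma>_skew by (simp add: sum.distrib algebra_simps)
  next
    fix f u v assume f [simp]: "f \<in> R" and u [simp]: "u \<in> M" and v [simp]: "v \<in> M"
    show "D (sc f u) v = sc f (D u v)"
      by (rule pr_ext) (simp_all add: D_pr pr_linear \<Gamma>_scale act_scale_left algebra_simps)
    show "D u (sc f v) = sc (act u f) v + sc f (D u v)"
      by (rule pr_ext) (simp_all add: D_pr pr_linear \<Gamma>_scale act_mult algebra_simps)
  qed simp
  have tors: "tors D (e a) (e b) (e c) = 0" if "a \<in> I" "b \<in> I" "c \<in> I" for a b c
  proof -
    have "tors D (e a) (e b) (e c) = \<gamma> a b c - \<gamma> b a c - B a b c + \<gamma> c a b"
      using that by (simp add: tors_def pr_linear frame B_def pr_sym[of "e b"])
    then show ?thesis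
      using cyc[OF that] antisym[of b c a] that by (simp add: algebra_simps)
  qed
  have pres: "D u v \<in> part K" if u: "u \<in> M" and v: "v \<in> part K" for u v
  proof -
    have "\<Gamma> u v c = 0" if c: "c \<in> I - K" for c
      unfolding \<Gamma>_def
    proof (intro sum.neutral ballI)
      fix a b assume "a \<in> I" "b \<in> I"
      then show "x u a * x v b * \<gamma> a b c = 0"
        using block[of a b c] part_zero[OF v] c by (cases "b \<in> K") (simp_all add: x_def)
    qed
    then show ?thesis
      using u v by (intro part_intro) (simp_all add: D_pr part_zero)
  qed
  show ?thesis
  proof (rule that[OF _ frame])
    show "LC K D"
      unfolding LC_def using conn tors_zero[OF conn tors] pres by blast
  qed
qed

lemma connection_trace:
  assumes D: "gconn D" and v: "v \<in> M"
  shows "module_trace R sc M (\<lambda>w. D w v)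
    = (\<Sum>b\<in>I. act (e b) (\<eta> b * pr v (e b)) + \<eta> b * pr v (e b) * (\<Sum>a\<in>I. \<eta> a * pr (D (e a) (e b)) (e a)))"
proof -
  note D' [simp] = gconnD(1)[OF D] and D'' = gconnD(2-5)[OF D]
  define k where "k b = \<eta> b * pr v (e b)" for b
  have k [simp]: "k b \<in> R" if "b \<in> I" for b
    using that v by (simp add: k_def)
  have D0: "D u 0 = 0" if "u \<in> M" for u
    using D''(3)[of u 0 0] that by simp
  have Dsum: "D u (\<Sum>b\<in>S. sc (k b) (e b)) = (\<Sum>b\<in>S. sc (act u (k b)) (e b) + sc (k b) (D u (e b)))"
    if u: "u \<in> M" and "S \<subseteq> I" for u S
    using finite_subset[OF \<open>S \<subseteq> I\<close> I] \<open>S \<subseteq> I\<close>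
  proof (induction S)
    case (insert b S)
    have "(\<Sum>b\<in>S. sc (k b) (e b)) \<in> M"
      using insert.prems by (intro M_sum M) auto
    then show ?case
      using insert u by (simp add: D'')
  qed (simp add: D0 u)
  have "module_trace R sc M (\<lambda>w. D w v) = (\<Sum>a\<in>I. \<eta> a * pr (D (e a) v) (e a))"
    using trace_part[OF subset_refl, of "\<lambda>w. D w v"] v by (simp add: part_I D'')
  also have "\<dots> = (\<Sum>a\<in>I. \<eta> a * (\<Sum>b\<in>I. act (e a) (k b) * pr (e b) (e a) + k b * pr (D (e a) (e b)) (e a)))"
  proof (rule sum.cong[OF refl])
    fix a assume a: "a \<in> I"
    have "D (e a) v = (\<Sum>b\<in>I. sc (act (e a) (k b)) (e b) + sc (k b) (D (e a) (e b)))"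
      using Dsum[OF e[OF a] subset_refl] expand[OF v] by (simp add: k_def)
    then show "\<eta> a * pr (D (e a) v) (e a)
        = \<eta> a * (\<Sum>b\<in>I. act (e a) (k b) * pr (e b) (e a) + k b * pr (D (e a) (e b)) (e a))"
      using a by (simp add: pr_sum pr_linear)
  qed
  also have "\<dots> = (\<Sum>a\<in>I. act (e a) (k a)) + (\<Sum>a\<in>I. \<Sum>b\<in>I. \<eta> a * (k b * pr (D (e a) (e b)) (e a)))"
  proof -
    have "\<eta> a * (\<Sum>b\<in>I. act (e a) (k b) * pr (e b) (e a) + k b * pr (D (e a) (e b)) (e a))
        = act (e a) (k a) + (\<Sum>b\<in>I. \<eta> a * (k b * pr (D (e a) (e b)) (e a)))" if a: "a \<in> I" for a
    proof -
      have "(\<Sum>b\<in>I. act (e a) (k b) * pr (e b) (e a)) = (\<Sum>b\<in>I. if b = a then act (e a) (k b) * \<eta> b else 0)"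
        using a by (intro sum.cong) (auto simp: orth)
      then have "(\<Sum>b\<in>I. act (e a) (k b) * pr (e b) (e a)) = act (e a) (k a) * \<eta> a"
        using a by simp
      then show ?thesis
        using \<eta>_sq[OF a] by (simp add: sum.distrib distrib_left sum_distrib_left mult.left_commute[of "\<eta> a"])
    qed
    then show ?thesis by (simp add: sum.distrib)
  qed
  also have "(\<Sum>a\<in>I. \<Sum>b\<in>I. \<eta> a * (k b * pr (D (e a) (e b)) (e a)))
      = (\<Sum>b\<in>I. \<Sum>a\<in>I. \<eta> a * (k b * pr (D (e a) (e b)) (e a)))"
    by (rule sum.swap)
  finally show ?thesis
    by (simp add: sum.distrib k_def[symmetric] sum_distrib_left mult.left_commute)
qed

end

section \<open>The Ricci tensors in the frame\<close>

text \<open>The setting of both Ricci tensors: \<open>J\<close> is the index set of the subbundle over which the trace is taken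
  and \<open>K\<close> that of its orthogonal complement, so the two tensors differ by exchanging \<open>J\<close> and \<open>K\<close>.\<close>

locale split_connection = courant_frame +
  fixes J K :: "nat set" and D :: "'b \<Rightarrow> 'b \<Rightarrow> 'b"
  assumes JK: "J \<union> K = I" "J \<inter> K = {}"
    and conn: "gconn D"
    and torsion_free: "\<And>u v w. u \<in> M \<Longrightarrow> v \<in> M \<Longrightarrow> w \<in> M \<Longrightarrow> tors D u v w = 0"
    and pres: "\<And>u v. u \<in> M \<Longrightarrow> v \<in> part J \<Longrightarrow> D u v \<in> part J"
      "\<And>u v. u \<in> M \<Longrightarrow> v \<in> part K \<Longrightarrow> D u v \<in> part K"
begin

lemma JK_subset [simp]: "J \<subseteq> I" "K \<subseteq> I" and in_I [simp]: "i \<in> J \<Longrightarrow> i \<in> I" "b \<in> K \<Longrightarrow> b \<in> I"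
  using JK by auto

lemma fin [simp]: "finite J" "finite K"
  using finite_subset[OF JK_subset(1) I] finite_subset[OF JK_subset(2) I] .

lemma D_mem [simp]: "u \<in> M \<Longrightarrow> v \<in> M \<Longrightarrow> D u v \<in> M"
  and D_add_left: "u \<in> M \<Longrightarrow> u' \<in> M \<Longrightarrow> v \<in> M \<Longrightarrow> D (u + u') v = D u v + D u' v"
  and D_scale_left: "f \<in> R \<Longrightarrow> u \<in> M \<Longrightarrow> v \<in> M \<Longrightarrow> D (sc f u) v = sc f (D u v)"
  and D_add: "u \<in> M \<Longrightarrow> v \<in> M \<Longrightarrow> w \<in> M \<Longrightarrow> D u (v + w) = D u v + D u w"
  and D_scale: "f \<in> R \<Longrightarrow> u \<in> M \<Longrightarrow> v \<in> M \<Longrightarrow> D u (sc f v) = sc (act u f) v + sc f (D u v)"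
  and D_metric: "u \<in> M \<Longrightarrow> v \<in> M \<Longrightarrow> w \<in> M \<Longrightarrow> act u (pr v w) = pr (D u v) w + pr v (D u w)"
  using conn unfolding gconn_def by blast+

lemma D_zero_left [simp]: "v \<in> M \<Longrightarrow> D 0 v = 0"
  using D_scale_left[of 0 0 v] by simp

lemma D_sum_left: "v \<in> M \<Longrightarrow> (\<And>i. i \<in> S \<Longrightarrow> f i \<in> M) \<Longrightarrow> D (\<Sum>i\<in>S. f i) v = (\<Sum>i\<in>S. D (f i) v)"
  by (induction S rule: infinite_finite_induct) (auto simp: D_add_left)

definition \<omega> :: "nat \<Rightarrow> nat \<Rightarrow> nat \<Rightarrow> 'a" where
  "\<omega> a b c = pr (D (e a) (e b)) (e c)"

lemma \<omega>_mem [simp]: "a \<in> I \<Longrightarrow> b \<in> I \<Longrightarrow> c \<in> I \<Longrightarrow> \<omega> a b c \<in> R"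
  by (simp add: \<omega>_def)

lemma \<omega>_antisym:
  assumes "a \<in> I" "b \<in> I" "c \<in> I"
  shows "\<omega> a c b = - \<omega> a b c"
  using D_metric[of "e a" "e b" "e c"] assms
  by (simp add: \<omega>_def eq_neg_iff_add_eq_0 pr_sym[of "e b"] add.commute)

lemma \<omega>_block [simp]:
  assumes "a \<in> I"
  shows "b \<in> J \<Longrightarrow> c \<in> K \<Longrightarrow> \<omega> a b c = 0" "b \<in> K \<Longrightarrow> c \<in> J \<Longrightarrow> \<omega> a b c = 0"
  using part_orthogonal[OF pres(1)[of "e a" "e b"] e_part[of c K]]
    part_orthogonal[OF pres(2)[of "e a" "e b"] e_part[of c J]] assms JK
  by (auto simp: \<omega>_def)

text \<open>Of the three cyclic Christoffel symbols with indices in both blocks, two vanish, so vanishing torsion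
  determines the third one.\<close>

lemma \<omega>_mixed:
  assumes "i \<in> J" "j \<in> J" "b \<in> K"
  shows "\<omega> b i j = B b i j"
proof -
  have "tors D (e b) (e i) (e j) = \<omega> b i j - \<omega> i b j - B b i j + \<omega> j b i"
    using assms by (simp add: tors_def \<omega>_def B_def pr_linear pr_sym[of "e i"])
  then show ?thesis
    using torsion_free[of "e b" "e i" "e j"] assms by simp
qed

lemma I_minus [simp]: "I - J = K"
  using JK by auto

lemma sum_block:
  assumes "\<And>c. c \<in> K \<Longrightarrow> F c = 0" "\<And>k. k \<in> J \<Longrightarrow> F k = H k"
  shows "(\<Sum>A\<in>I. F A) = (\<Sum>k\<in>J. H k)"
  by (rule sum.mono_neutral_cong_right) (use assms in auto)

lemma split_sum: "(\<Sum>A\<in>I. F A) = (\<Sum>A\<in>J. F A) + (\<Sum>A\<in>K. F A)"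
  using JK fin by (metis sum.union_disjoint)

text \<open>On orthogonal sections the correction term disappears; hence the curvature with its first two arguments
  in orthogonal subbundles is a tensor.\<close>

lemma br_scale_left_orth:
  assumes "u \<in> part J" "v \<in> part K" "f \<in> R"
  shows "br (sc f u) v = sc f (br u v) - sc (act v f) u"
proof (rule pr_ext)
  have "pr u v = 0" using part_orthogonal[OF assms(1,2)] JK by simp
  then show "pr (br (sc f u) v) (e A) = pr (sc f (br u v) - sc (act v f) u) (e A)" if "A \<in> I" for A
    using assms that by (simp add: pr_br_scale_left pr_linear)
qed (use assms in auto)

lemma curv_mem: "w \<in> part J \<Longrightarrow> u \<in> part K \<Longrightarrow> v \<in> part J \<Longrightarrow> curv D w u v \<in> part J"
  unfolding curv_def by (intro part_diff pres) auto

lemma curv_add1: "w \<in> M \<Longrightarrow> w' \<in> M \<Longrightarrow> u \<in> M \<Longrightarrow> v \<in> M \<Longrightarrow> curv D (w + w') u v = curv D w u v + curv D w' u v"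
  by (simp add: curv_def D_add_left D_add br_add_left algebra_simps)

lemma curv_add2: "w \<in> M \<Longrightarrow> u \<in> M \<Longrightarrow> u' \<in> M \<Longrightarrow> v \<in> M \<Longrightarrow> curv D w (u + u') v = curv D w u v + curv D w u' v"
  by (simp add: curv_def D_add_left D_add br_add_right algebra_simps)

lemma curv_add3: "w \<in> M \<Longrightarrow> u \<in> M \<Longrightarrow> v \<in> M \<Longrightarrow> v' \<in> M \<Longrightarrow> curv D w u (v + v') = curv D w u v + curv D w u v'"
  by (simp add: curv_def D_add algebra_simps)

lemma D_diff_left: "u \<in> M \<Longrightarrow> v \<in> M \<Longrightarrow> w \<in> M \<Longrightarrow> D (u - v) w = D u w - D v w"
  using D_add_left[of "u - v" v w] by (simp add: algebra_simps)

lemma curv_scale1: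
  assumes "w \<in> part J" "u \<in> part K" "v \<in> part J" "f \<in> R"
  shows "curv D (sc f w) u v = sc f (curv D w u v)"
  using assms
  by (simp add: curv_def D_scale_left D_scale br_scale_left_orth D_diff_left scale_right_diff_distrib algebra_simps)

lemma curv_scale2:
  assumes "w \<in> M" "u \<in> M" "v \<in> M" "f \<in> R"
  shows "curv D w (sc f u) v = sc f (curv D w u v)"
  using assms
  by (simp add: curv_def D_scale_left D_scale br_scale_right D_add_left scale_right_diff_distrib algebra_simps)

lemma curv_scale3:
  assumes "w \<in> M" "u \<in> M" "v \<in> M" "f \<in> R"
  shows "curv D w u (sc f v) = sc f (curv D w u v)"
  using assms
  by (simp add: curv_def D_scale D_add act_br scale_right_diff_distrib scale_left_diff_distrib algebra_simps)

definition ric :: "'b \<Rightarrow> 'b \<Rightarrow> 'a" where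
  "ric u v = module_trace R sc (part J) (\<lambda>w. curv D w u v)"

lemma ric_eq:
  assumes "u \<in> part K" "v \<in> part J"
  shows "ric u v = (\<Sum>i\<in>J. \<eta> i * pr (curv D (e i) u v) (e i))"
  unfolding ric_def
  by (rule trace_part) (use assms in \<open>auto simp: curv_mem curv_add1 curv_scale1\<close>)

lemma curv_M [simp]: "u \<in> M \<Longrightarrow> v \<in> M \<Longrightarrow> w \<in> M \<Longrightarrow> curv D u v w \<in> M"
  by (simp add: curv_def)

lemma ric_zero_iff:
  "(\<forall>u\<in>part K. \<forall>v\<in>part J. ric u v = 0) \<longleftrightarrow> (\<forall>b\<in>K. \<forall>j\<in>J. ric (e b) (e j) = 0)"
proof (intro iffI ballI)
  fix u v assume 0: "\<forall>b\<in>K. \<forall>j\<in>J. ric (e b) (e j) = 0" and u: "u \<in> part K" and v: "v \<in> part J"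
  have "ric (e b) v = 0" if b: "b \<in> K" for b
    by (rule part_linear_zero[OF JK_subset(1) _ _ _ v])
      (use 0 b in \<open>auto simp: ric_eq curv_add3 curv_scale3 pr_linear sum.distrib sum_distrib_left algebra_simps\<close>)
  then show "ric u v = 0"
    by (intro part_linear_zero[OF JK_subset(2) _ _ _ u, of "\<lambda>u. ric u v"])
      (use v in \<open>auto simp: ric_eq curv_add2 curv_scale2 pr_linear sum.distrib sum_distrib_left algebra_simps\<close>)
qed auto

definition frame_div :: "nat \<Rightarrow> 'a" where
  "frame_div k = module_trace R sc M (\<lambda>w. D w (e k))"

lemma frame_div_eq: "k \<in> J \<Longrightarrow> frame_div k = (\<Sum>i\<in>J. \<eta> i * \<omega> i k i)"
proof -
  assume k: "k \<in> J"
  have "frame_div k = (\<Sum>A\<in>I. \<eta> A * pr (D (e A) (e k)) (e A))"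
    using trace_part[OF subset_refl, of "\<lambda>w. D w (e k)"] k
    by (simp add: frame_div_def part_I D_add_left D_scale_left)
  also have "\<dots> = (\<Sum>i\<in>J. \<eta> i * \<omega> i k i)"
    by (rule sum_block) (use k in \<open>auto simp: \<omega>_def[symmetric]\<close>)
  finally show ?thesis .
qed

text \<open>The Christoffel symbols that are not determined by vanishing torsion, those with all three indices in
  \<open>J\<close>, enter the trace of the curvature in two ways. Their trace is the divergence of a frame vector,
  whose derivative vanishes by assumption. Their other contributions cancel because \<open>B\<close> is skew-symmetric
  (fact 5 in the proof). So the Ricci tensor is expressed by the structure coefficients and the divergence.\<close>

theorem ric_frame:
  assumes b: "b \<in> K" and j: "j \<in> J" and frame_div: "act (e b) (frame_div j) = 0"
  shows "ric (e b) (e j) = (\<Sum>k\<in>J. \<eta> k * B b j k * frame_div k)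
    - (\<Sum>i\<in>J. \<Sum>c\<in>K. \<eta> i * \<eta> c * B i b c * B c j i)"
proof -
  have 1: "pr (D (e i) (D (e b) (e j))) (e i) = (\<Sum>k\<in>J. \<eta> k * B b j k * \<omega> i k i)" if i: "i \<in> J" for i
  proof -
    have "act (e i) (pr (D (e b) (e j)) (e i)) = 0"
      using \<omega>_mixed[OF j i b] i j b by (simp add: \<omega>_def)
    then have "pr (D (e i) (D (e b) (e j))) (e i) = - pr (D (e b) (e j)) (D (e i) (e i))"
      using D_metric[of "e i" "D (e b) (e j)" "e i"] i j b by (simp add: eq_neg_iff_add_eq_0)
    also have "\<dots> = - (\<Sum>A\<in>I. \<eta> A * \<omega> b j A * \<omega> i i A)"
      using i j b parseval[of "D (e b) (e j)" "D (e i) (e i)"] by (simp add: \<omega>_def)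
    also have "(\<Sum>A\<in>I. \<eta> A * \<omega> b j A * \<omega> i i A) = (\<Sum>k\<in>J. \<eta> k * B b j k * \<omega> i i k)"
      by (rule sum_block) (use i j b in \<open>auto simp: \<omega>_mixed\<close>)
    also have "- (\<Sum>k\<in>J. \<eta> k * B b j k * \<omega> i i k) = (\<Sum>k\<in>J. \<eta> k * B b j k * \<omega> i k i)"
      unfolding sum_negf[symmetric]
      by (rule sum.cong[OF refl]) (simp add: i \<omega>_antisym[of i i])
    finally show ?thesis .
  qed
  have 2: "pr (D (e b) (D (e i) (e j))) (e i) = act (e b) (\<omega> i j i) - (\<Sum>k\<in>J. \<eta> k * \<omega> i j k * B b i k)"
    if i: "i \<in> J" for i
  proof -
    have "pr (D (e b) (D (e i) (e j))) (e i) = act (e b) (\<omega> i j i) - pr (D (e i) (e j)) (D (e b) (e i))"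
      using D_metric[of "e b" "D (e i) (e j)" "e i"] i j b by (simp add: \<omega>_def)
    also have "pr (D (e i) (e j)) (D (e b) (e i)) = (\<Sum>A\<in>I. \<eta> A * \<omega> i j A * \<omega> b i A)"
      using i j b parseval[of "D (e i) (e j)" "D (e b) (e i)"] by (simp add: \<omega>_def)
    also have "\<dots> = (\<Sum>k\<in>J. \<eta> k * \<omega> i j k * B b i k)"
      by (rule sum_block) (use i j b in \<open>auto simp: \<omega>_mixed\<close>)
    finally show ?thesis .
  qed
  have 3: "pr (D (br (e i) (e b)) (e j)) (e i) = (\<Sum>k\<in>J. \<eta> k * B i b k * \<omega> k j i) + (\<Sum>c\<in>K. \<eta> c * B i b c * B c j i)"
    if i: "i \<in> J" for i
  proof -
    have "pr (D (br (e i) (e b)) (e j)) (e i) = pr (D (\<Sum>A\<in>I. sc (\<eta> A * B i b A) (e A)) (e j)) (e i)"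
      using expand[of "br (e i) (e b)"] i b by (simp add: B_def)
    also have "\<dots> = (\<Sum>A\<in>I. \<eta> A * B i b A * \<omega> A j i)"
      using i j b by (simp add: D_sum_left D_scale_left pr_sum pr_scale \<omega>_def)
    also have "\<dots> = (\<Sum>k\<in>J. \<eta> k * B i b k * \<omega> k j i) + (\<Sum>c\<in>K. \<eta> c * B i b c * B c j i)"
      unfolding split_sum using i j b by (simp add: \<omega>_mixed)
    finally show ?thesis .
  qed
  have 4: "act (e b) (\<Sum>i\<in>J. \<eta> i * \<omega> i j i) = (\<Sum>i\<in>J. \<eta> i * act (e b) (\<omega> i j i))"
    using b j by (simp add: act_sum act_mult)
  have 5: "(\<Sum>i\<in>J. \<eta> i * (\<Sum>k\<in>J. \<eta> k * \<omega> i j k * B b i k)) = (\<Sum>i\<in>J. \<eta> i * (\<Sum>k\<in>J. \<eta> k * B i b k * \<omega> k j i))"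
  proof -
    have "(\<Sum>i\<in>J. \<eta> i * (\<Sum>k\<in>J. \<eta> k * \<omega> i j k * B b i k)) = (\<Sum>i\<in>J. \<Sum>k\<in>J. \<eta> k * \<eta> i * B k b i * \<omega> i j k)"
      unfolding sum_distrib_left
    proof (intro sum.cong refl)
      fix i k assume "i \<in> J" "k \<in> J"
      then have "B b i k = B k b i"
        using B_antisym(2)[of b k i] B_antisym(1)[of k b i] b by simp
      then show "\<eta> i * (\<eta> k * \<omega> i j k * B b i k) = \<eta> k * \<eta> i * B k b i * \<omega> i j k"
        by (simp add: mult_ac)
    qed
    also have "\<dots> = (\<Sum>k\<in>J. \<Sum>i\<in>J. \<eta> k * \<eta> i * B k b i * \<omega> i j k)"
      by (rule sum.swap)
    finally show ?thesis
      by (simp add: sum_distrib_left mult_ac)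
  qed
  have 6: "(\<Sum>i\<in>J. \<eta> i * (\<Sum>k\<in>J. \<eta> k * B b j k * \<omega> i k i)) = (\<Sum>k\<in>J. \<eta> k * B b j k * frame_div k)"
  proof -
    have "(\<Sum>i\<in>J. \<eta> i * (\<Sum>k\<in>J. \<eta> k * B b j k * \<omega> i k i)) = (\<Sum>k\<in>J. \<Sum>i\<in>J. \<eta> i * (\<eta> k * B b j k * \<omega> i k i))"
      unfolding sum_distrib_left by (rule sum.swap)
    also have "\<dots> = (\<Sum>k\<in>J. \<eta> k * B b j k * frame_div k)"
      by (simp add: frame_div_eq sum_distrib_left mult_ac cong: sum.cong)
    finally show ?thesis .
  qed
  have "ric (e b) (e j) = (\<Sum>i\<in>J. \<eta> i * (\<Sum>k\<in>J. \<eta> k * B b j k * \<omega> i k i)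
      - \<eta> i * act (e b) (\<omega> i j i) + \<eta> i * (\<Sum>k\<in>J. \<eta> k * \<omega> i j k * B b i k)
      - \<eta> i * (\<Sum>k\<in>J. \<eta> k * B i b k * \<omega> k j i) - \<eta> i * (\<Sum>c\<in>K. \<eta> c * B i b c * B c j i))"
  proof -
    have "\<eta> i * pr (curv D (e i) (e b) (e j)) (e i) = \<eta> i * (\<Sum>k\<in>J. \<eta> k * B b j k * \<omega> i k i)
      - \<eta> i * act (e b) (\<omega> i j i) + \<eta> i * (\<Sum>k\<in>J. \<eta> k * \<omega> i j k * B b i k)
      - \<eta> i * (\<Sum>k\<in>J. \<eta> k * B i b k * \<omega> k j i) - \<eta> i * (\<Sum>c\<in>K. \<eta> c * B i b c * B c j i)"
      if i: "i \<in> J" for i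
      using i b j by (simp add: curv_def pr_linear 1[OF i] 2[OF i] 3[OF i] right_diff_distrib distrib_left)
    then show ?thesis
      using b j by (simp add: ric_eq)
  qed
  also have "\<dots> = (\<Sum>k\<in>J. \<eta> k * B b j k * frame_div k) - act (e b) (frame_div j)
      - (\<Sum>i\<in>J. \<eta> i * (\<Sum>c\<in>K. \<eta> c * B i b c * B c j i))"
    using 4 5 6 j by (simp add: sum_subtractf sum.distrib frame_div_eq)
  also have "act (e b) (frame_div j) = 0"
    by (rule frame_div)
  finally show ?thesis
    by (simp add: sum_distrib_left mult.assoc)
qed

end

section \<open>One-forms and left translations\<close>

context lie3
begin

abbreviation "OF1 \<equiv> one_forms G"

lemma one_formI:
  assumes "\<And>X. X \<in> VF \<Longrightarrow> \<xi> X \<in> C" "\<And>X Y. X \<in> VF \<Longrightarrow> Y \<in> VF \<Longrightarrow> \<xi> (X + Y) = \<xi> X + \<xi> Y"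
    "\<And>f X. f \<in> C \<Longrightarrow> X \<in> VF \<Longrightarrow> \<xi> (cscale f X) = f * \<xi> X" "\<And>X. X \<notin> VF \<Longrightarrow> \<xi> X = 0"
  shows "\<xi> \<in> OF1"
  using assms by (simp add: one_forms_def)

lemma one_formD:
  assumes "\<xi> \<in> OF1"
  shows "X \<in> VF \<Longrightarrow> \<xi> X \<in> C" "X \<in> VF \<Longrightarrow> Y \<in> VF \<Longrightarrow> \<xi> (X + Y) = \<xi> X + \<xi> Y"
    "f \<in> C \<Longrightarrow> X \<in> VF \<Longrightarrow> \<xi> (cscale f X) = f * \<xi> X" "X \<notin> VF \<Longrightarrow> \<xi> X = 0"
  using assms by (simp_all add: one_forms_def)

lemma cscale_zero: "cscale 0 X = 0"
  by (simp add: cscale_def fun_eq_iff)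

lemma one_form_zero_arg: "\<xi> \<in> OF1 \<Longrightarrow> \<xi> 0 = 0"
  using one_formD(3)[of \<xi> 0 0] by (simp add: cscale_zero)

lemma one_form_uminus:
  assumes "\<xi> \<in> OF1" "X \<in> VF"
  shows "\<xi> (- X) = - \<xi> X"
proof -
  have "\<xi> (X + - X) = \<xi> X + \<xi> (- X)"
    using one_formD(2)[OF assms(1) assms(2) VF_minus[OF assms(2)]] .
  then show ?thesis
    using one_form_zero_arg[OF assms(1)] by (simp add: eq_neg_iff_add_eq_0 add.commute)
qed

lemma one_form_sum:
  assumes "\<xi> \<in> OF1" "\<And>i. i \<in> S \<Longrightarrow> X i \<in> VF"
  shows "\<xi> (\<Sum>i\<in>S. X i) = (\<Sum>i\<in>S. \<xi> (X i))"
  using assms(2)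
  by (induction S rule: infinite_finite_induct)
    (simp_all add: one_form_zero_arg[OF assms(1)] one_formD(2)[OF assms(1)])

lemma OF1_zero [simp]: "0 \<in> OF1"
  by (rule one_formI) auto

lemma OF1_plus [simp]: "\<xi> \<in> OF1 \<Longrightarrow> \<eta> \<in> OF1 \<Longrightarrow> \<xi> + \<eta> \<in> OF1"
  by (rule one_formI) (simp_all add: one_formD algebra_simps fun_eq_iff)

lemma OF1_cscale [simp]: "f \<in> C \<Longrightarrow> \<xi> \<in> OF1 \<Longrightarrow> cscale f \<xi> \<in> OF1"
  by (rule one_formI) (simp_all add: one_formD cscale_def[of f \<xi>] algebra_simps fun_eq_iff)

lemma OF1_uminus [simp]: "\<xi> \<in> OF1 \<Longrightarrow> - \<xi> \<in> OF1"
  by (rule one_formI) (simp_all add: one_formD algebra_simps fun_eq_iff)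

lemma OF1_diff [simp]: "\<xi> \<in> OF1 \<Longrightarrow> \<eta> \<in> OF1 \<Longrightarrow> \<xi> - \<eta> \<in> OF1"
  using OF1_plus[OF _ OF1_uminus, of \<xi> \<eta>] by simp

lemma OF1_sum [simp]: "(\<And>i. i \<in> I \<Longrightarrow> \<xi> i \<in> OF1) \<Longrightarrow> (\<Sum>i\<in>I. \<xi> i) \<in> OF1"
  by (induction I rule: infinite_finite_induct) auto

lemma OF1_rscale [simp]: "\<xi> \<in> OF1 \<Longrightarrow> rscale c \<xi> \<in> OF1"
  by (simp add: rscale_def)

lemma VF_rscale [simp]: "X \<in> VF \<Longrightarrow> rscale c X \<in> VF"
  by (simp add: rscale_def)

lemma one_form_ext:
  assumes "\<xi> \<in> OF1" "\<eta> \<in> OF1" "\<And>X. X \<in> VF \<Longrightarrow> \<xi> X = \<eta> X"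
  shows "\<xi> = \<eta>"
proof
  fix X show "\<xi> X = \<eta> X"
    using assms(3) one_formD(4)[OF assms(1)] one_formD(4)[OF assms(2)] by (cases "X \<in> VF") auto
qed

lemma lie_algebra_VF: "X \<in> lie_algebra G \<Longrightarrow> X \<in> VF"
  by (simp add: lie_algebra_def)

text \<open>The values of left-invariant fields at \<open>q\<close> are obtained from those at \<open>p\<close> by precomposing functions
  with one left translation, the same for all fields.\<close>

lemma left_translate:
  "\<exists>b. \<forall>X\<in>lie_algebra G. \<forall>f. X f q = X (\<lambda>r. f (b \<otimes>\<^bsub>G\<^esub> r)) p"
proof -
  have grp: "group G" and car: "carrier G = UNIV"
    using G by (auto simp: lie_group3_def)
  interpret group G by (rule grp)
  let ?b = "q \<otimes>\<^bsub>G\<^esub> inv\<^bsub>G\<^esub> p"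
  have inv: "inv\<^bsub>G\<^esub> ?b \<otimes>\<^bsub>G\<^esub> q = p"
    by (simp add: car inv_mult_group m_assoc)
  have "X f q = X (\<lambda>r. f (?b \<otimes>\<^bsub>G\<^esub> r)) p" if "X \<in> lie_algebra G" for X f
  proof -
    have "push_left G ?b X = X"
      using that by (simp add: lie_algebra_def)
    then have "X f q = push_left G ?b X f q"
      by (rule arg_cong[where f = "\<lambda>Y. Y f q", symmetric])
    also have "\<dots> = X (\<lambda>r. f (?b \<otimes>\<^bsub>G\<^esub> r)) p"
      unfolding push_left_def inv ..
    finally show ?thesis .
  qed
  then show ?thesis by blast
qed

end

section \<open>Left-invariant fields as a frame\<close>

text \<open>Matrices are indexed by the type \<open>3\<close>, in which \<open>3 = 0\<close>; this translates to the indices 1, 2, 3.\<close>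

definition idx :: "3 \<Rightarrow> nat" where
  "idx i = (if i = 1 then 1 else if i = 2 then 2 else 3)"

lemma idx_simps [simp]: "idx 1 = 1" "idx 2 = 2" "idx 3 = 3"
  by (simp_all add: idx_def)

lemma sum_idx: "(\<Sum>a\<in>{1..3::nat}. F a) = (\<Sum>i\<in>UNIV. F (idx i))"
proof -
  have "{1..3::nat} = {1, 2, 3}" by auto
  then show ?thesis by (simp add: sum_3 add.assoc)
qed

lemma idx_mem [simp]: "idx i \<in> {1..3}"
  by (simp add: idx_def)

locale framed = lie3 G for G :: "('g::{t2_space, second_countable_topology}) lie_group" +
  fixes v :: "nat \<Rightarrow> 'g vfield" and \<theta> :: "nat \<Rightarrow> 'g form1"
  assumes basis: "is_basis (UNIV :: real set) rscale (lie_algebra G) {1..3} v"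
    and \<theta>: "\<And>a. a \<in> {1..3} \<Longrightarrow> \<theta> a \<in> one_forms G"
    and dual: "\<And>a b. a \<in> {1..3} \<Longrightarrow> b \<in> {1..3} \<Longrightarrow> \<theta> a (v b) = const_fun (if a = b then 1 else 0)"
begin

lemma v_alg: "a \<in> {1..3} \<Longrightarrow> v a \<in> lie_algebra G"
  using basis by (simp add: is_basis_def)

lemma v_VF: "a \<in> {1..3} \<Longrightarrow> v a \<in> VF"
  using v_alg lie_algebra_VF by blast

text \<open>A linear relation at one point is carried by left translations to every other point, so it is a
  relation between the fields themselves. Should the translated function fail
  to be smooth, all fields vanish on it, so the relation holds there as well.\<close>

lemma independent_at_point:
  fixes c :: "real ^ 3"
  assumes zero: "\<And>f. f \<in> C \<Longrightarrow> (\<Sum>i\<in>UNIV. c $ i * v (idx i) f p) = 0"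
  shows "c = 0"
proof -
  define k where "k a = (if a = 1 then c $ 1 else if a = 2 then c $ 2 else if a = 3 then c $ 3 else 0)" for a :: nat
  have k_idx: "k (idx i) = c $ i" for i
    using exhaust_3[of i] by (auto simp: k_def)
  have all: "(\<Sum>i\<in>UNIV. c $ i * v (idx i) f q) = 0" for f q
  proof -
    obtain b where "\<forall>X\<in>lie_algebra G. \<forall>f. X f q = X (\<lambda>r. f (b \<otimes>\<^bsub>G\<^esub> r)) p"
      using left_translate[of q p] ..
    then have b: "X f q = X (\<lambda>r. f (b \<otimes>\<^bsub>G\<^esub> r)) p" if "X \<in> lie_algebra G" for X f
      using that by (elim ballE) (erule spec, erule notE)
    let ?f = "\<lambda>r. f (b \<otimes>\<^bsub>G\<^esub> r)"
    have "(\<Sum>i\<in>UNIV. c $ i * v (idx i) f q) = (\<Sum>i\<in>UNIV. c $ i * v (idx i) ?f p)"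
      using b[OF v_alg[OF idx_mem]] by simp
    also have "\<dots> = 0"
    proof (cases "?f \<in> C")
      case False
      have "v (idx i) ?f = 0" for i
        by (rule VF_nonsmooth[OF v_VF[OF idx_mem] False])
      then show ?thesis by simp
    qed (rule zero)
    finally show ?thesis .
  qed
  have z: "0 = (\<Sum>a\<in>{1..3}. rscale (k a) (v a))"
    unfolding sum_idx
  proof (intro ext)
    fix f q
    show "0 f q = (\<Sum>i\<in>UNIV. rscale (k (idx i)) (v (idx i))) f q"
      using all[of f q] by (simp add: sum_fun_apply rscale_def cscale_def k_idx)
  qed
  have z': "0 = (\<Sum>a\<in>{1..3}. rscale 0 (v a))"
    by (simp add: rscale_def const_fun_arith cscale_zero)
  have zero_mem: "0 \<in> lie_algebra G"
    by (auto simp: lie_algebra_def push_left_def fun_eq_iff)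
  define P where "P k \<longleftrightarrow> (\<forall>i\<in>{1..3}. k i \<in> (UNIV :: real set)) \<and> (\<forall>i. i \<notin> {1..3} \<longrightarrow> k i = 0) \<and>
      0 = (\<Sum>i\<in>{1..3}. rscale (k i) (v i))" for k
  have "\<exists>!k. P k"
    using basis unfolding is_basis_def P_def by (elim conjE) (rule bspec[OF _ zero_mem])
  moreover have "P k"
    unfolding P_def using z by (auto simp: k_def)
  moreover have "P (\<lambda>_. 0)"
    unfolding P_def using z' by simp
  ultimately have "k = (\<lambda>_. 0)" by blast
  then show ?thesis
    using k_idx by (simp add: vec_eq_iff)
qed

definition frame_matrix :: "(3 \<Rightarrow> 'g cfun) \<Rightarrow> 'g \<Rightarrow> real ^ 3 ^ 3" where
  "frame_matrix y q = (\<chi> i j. v (idx j) (y i) q)"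

lemma frame_matrix_invertible:
  assumes y: "\<And>i. y i \<in> C"
    and gen: "\<And>f. f \<in> C \<Longrightarrow> \<exists>c. \<forall>X\<in>VF. X f p = (\<Sum>i\<in>UNIV. c i * X (y i) p)"
  shows "det (frame_matrix y p) \<noteq> 0"
proof -
  have "c = 0" if c: "frame_matrix y p *v c = 0" for c
  proof (rule independent_at_point)
    fix f assume "f \<in> C"
    then obtain k where k: "\<And>X. X \<in> VF \<Longrightarrow> X f p = (\<Sum>i\<in>UNIV. k i * X (y i) p)"
      using gen by blast
    have "(\<Sum>j\<in>UNIV. c $ j * v (idx j) f p) = (\<Sum>j\<in>UNIV. \<Sum>i\<in>UNIV. c $ j * (k i * v (idx j) (y i) p))"
      using k[OF v_VF[OF idx_mem]] by (simp add: sum_distrib_left)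
    also have "\<dots> = (\<Sum>i\<in>UNIV. \<Sum>j\<in>UNIV. c $ j * (k i * v (idx j) (y i) p))"
      by (rule sum.swap)
    also have "\<dots> = (\<Sum>i\<in>UNIV. k i * (frame_matrix y p *v c) $ i)"
      by (simp add: matrix_vector_mult_def frame_matrix_def sum_distrib_left mult_ac)
    finally show "(\<Sum>j\<in>UNIV. c $ j * v (idx j) f p) = 0"
      by (simp add: c)
  qed
  then have "\<exists>B. B ** frame_matrix y p = mat 1"
    by (simp add: matrix_left_invertible_ker)
  then have "invertible (frame_matrix y p)"
    by (simp add: invertible_left_inverse)
  then show ?thesis
    by (simp add: invertible_det_nz)
qed

text \<open>Three independent vectors in a space of dimension at most three span it.\<close>

lemma span_at_point:
  assumes X: "X \<in> VF"
  shows "\<exists>c :: real ^ 3. \<forall>f\<in>C. X f q = (\<Sum>j\<in>UNIV. c $ j * v (idx j) f q)"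
proof -
  obtain y :: "3 \<Rightarrow> 'g cfun" where "(\<forall>i. y i \<in> C) \<and>
      (\<forall>f\<in>C. \<exists>c. \<forall>X\<in>VF. X f q = (\<Sum>i\<in>UNIV. c i * X (y i) q))"
    using tangent_coordinates[of q] ..
  then have y: "y i \<in> C" "f \<in> C \<Longrightarrow> \<exists>c. \<forall>X\<in>VF. X f q = (\<Sum>i\<in>UNIV. c i * X (y i) q)" for i f
    by simp_all
  let ?A = "frame_matrix y q"
  have "invertible ?A"
    using frame_matrix_invertible[OF y] by (simp add: invertible_det_nz)
  then obtain B where B: "?A ** B = mat 1"
    unfolding invertible_def by blast
  define c where "c = B *v (\<chi> i. X (y i) q)"
  have Ac: "?A *v c = (\<chi> i. X (y i) q)"
    by (simp add: c_def matrix_vector_mul_assoc B)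
  have "X f q = (\<Sum>j\<in>UNIV. c $ j * v (idx j) f q)" if f: "f \<in> C" for f
  proof -
    obtain k where k: "\<And>X. X \<in> VF \<Longrightarrow> X f q = (\<Sum>i\<in>UNIV. k i * X (y i) q)"
      using y(2)[OF f] by blast
    have "X f q = (\<Sum>i\<in>UNIV. k i * (?A *v c) $ i)"
      using k[OF X] by (simp add: Ac)
    also have "\<dots> = (\<Sum>i\<in>UNIV. \<Sum>j\<in>UNIV. c $ j * (k i * v (idx j) (y i) q))"
      by (simp add: matrix_vector_mult_def frame_matrix_def sum_distrib_left mult_ac)
    also have "\<dots> = (\<Sum>j\<in>UNIV. \<Sum>i\<in>UNIV. c $ j * (k i * v (idx j) (y i) q))"
      by (rule sum.swap)
    also have "\<dots> = (\<Sum>j\<in>UNIV. c $ j * v (idx j) f q)"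
      using k[OF v_VF[OF idx_mem]] by (simp add: sum_distrib_left)
    finally show ?thesis .
  qed
  then show ?thesis by blast
qed

lemma det3_smooth:
  assumes "\<And>i j. (\<lambda>q. M q $ i $ j) \<in> C"
  shows "(\<lambda>q. det (M q :: real ^ 3 ^ 3)) \<in> C"
proof -
  define m where "m i j = (\<lambda>q. M q $ i $ j)" for i j
  have m: "m i j \<in> C" for i j
    using assms by (simp add: m_def)
  have "(\<lambda>q. det (M q)) = m 1 1 * m 2 2 * m 3 3 + m 1 2 * m 2 3 * m 3 1 + m 1 3 * m 2 1 * m 3 2
      - m 1 1 * m 2 3 * m 3 2 - m 1 2 * m 2 1 * m 3 3 - m 1 3 * m 2 2 * m 3 1"
    by (simp add: fun_eq_iff det_3 m_def)
  then show ?thesis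
    using m by simp
qed

text \<open>The left-invariant fields \<open>v 1, v 2, v 3\<close> are a basis of the module of all vector fields, with the
  dual one-forms as coordinates. Cramer's rule for the matrix \<open>v\<^sub>j(y\<^sub>i)\<close> gives smooth functions \<open>s j\<close> with
  \<open>d X = \<Sum>\<^sub>j s\<^sub>j v\<^sub>j\<close> on the whole group, where the determinant \<open>d\<close> does not vanish at the point \<open>p\<close> under
  consideration. Since no division has taken place, \<open>\<theta> k\<close> can be applied to this equation, so that
  \<open>s\<^sub>k = d \<theta>\<^sub>k(X)\<close>, and \<open>d\<close> is cancelled at \<open>p\<close> only afterwards.\<close>

theorem vector_field_expansion:
  assumes X: "X \<in> VF"
  shows "X = (\<Sum>a\<in>{1..3}. cscale (\<theta> a X) (v a))"
proof (intro ext)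
  fix f p
  obtain y :: "3 \<Rightarrow> 'g cfun" where "(\<forall>i. y i \<in> C) \<and>
      (\<forall>f\<in>C. \<exists>c. \<forall>X\<in>VF. X f p = (\<Sum>i\<in>UNIV. c i * X (y i) p))"
    using tangent_coordinates[of p] ..
  then have y: "y i \<in> C" "f \<in> C \<Longrightarrow> \<exists>c. \<forall>X\<in>VF. X f p = (\<Sum>i\<in>UNIV. c i * X (y i) p)" for i f
    by simp_all
  define d where "d q = det (frame_matrix y q)" for q
  define s where "s k q = det (\<chi> i j. if j = k then X (y i) q else frame_matrix y q $ i $ j)" for k q
  have d: "d \<in> C"
    unfolding d_def by (rule det3_smooth) (simp add: frame_matrix_def VF_smooth[OF v_VF[OF idx_mem] y(1)])
  have s: "s k \<in> C" for k
    unfolding s_def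
  proof (rule det3_smooth)
    fix i j
    have "X (y i) \<in> C" "v (idx j) (y i) \<in> C"
      using X y v_VF[OF idx_mem] by auto
    then show "(\<lambda>q. (\<chi> i j. if j = k then X (y i) q else frame_matrix y q $ i $ j) $ i $ j) \<in> C"
      by (cases "j = k") (simp_all add: frame_matrix_def)
  qed
  have d0: "d p \<noteq> 0"
    unfolding d_def by (rule frame_matrix_invertible[OF y])
  have cramer: "d q * X f q = (\<Sum>j\<in>UNIV. s j q * v (idx j) f q)" if f: "f \<in> C" for f q
  proof -
    obtain c :: "real ^ 3" where c: "\<And>f. f \<in> C \<Longrightarrow> X f q = (\<Sum>j\<in>UNIV. c $ j * v (idx j) f q)"
      using span_at_point[OF X, of q] by blast
    have "X (y i) q = (frame_matrix y q *v c) $ i" for i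
      using c[OF y(1)] by (simp add: matrix_vector_mult_def frame_matrix_def mult.commute)
    then have "s k q = c $ k * d q" for k
      by (simp only: s_def d_def cramer_lemma)
    then show ?thesis
      using c[OF f] by (simp add: sum_distrib_left mult_ac)
  qed
  have dX: "cscale d X = (\<Sum>j\<in>UNIV. cscale (s j) (v (idx j)))"
  proof (intro ext)
    fix f q
    show "cscale d X f q = (\<Sum>j\<in>UNIV. cscale (s j) (v (idx j))) f q"
    proof (cases "f \<in> C")
      case True
      then show ?thesis using cramer by (simp add: cscale_def sum_fun_apply)
    next
      case False
      have "v (idx j) f = 0" for j
        by (rule VF_nonsmooth[OF v_VF[OF idx_mem] False])
      then show ?thesis
        using VF_nonsmooth[OF X False] by (simp add: cscale_def sum_fun_apply)
    qed
  qed
  have ds: "d * \<theta> (idx k) X = s k" for k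
  proof -
    note th = \<theta>[OF idx_mem[of k]]
    have "d * \<theta> (idx k) X = \<theta> (idx k) (cscale d X)"
      using one_formD(3)[OF th d X] by simp
    also have "\<dots> = (\<Sum>j\<in>UNIV. s j * \<theta> (idx k) (v (idx j)))"
      unfolding dX using s VF_cscale[OF s v_VF[OF idx_mem]]
      by (simp add: one_form_sum[OF th] one_formD(3)[OF th s v_VF[OF idx_mem]])
    also have "\<dots> = s k"
    proof -
      have "s j * \<theta> (idx k) (v (idx j)) = (if j = k then s j else 0)" for j
        using dual[OF idx_mem[of k] idx_mem[of j]] exhaust_3[of j] exhaust_3[of k]
        by (auto simp: const_fun_arith)
      then show ?thesis by simp
    qed
    finally show ?thesis .
  qed
  show "X f p = (\<Sum>a\<in>{1..3}. cscale (\<theta> a X) (v a)) f p"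
  proof (cases "f \<in> C")
    case True
    have "d p * X f p = (\<Sum>j\<in>UNIV. (d * \<theta> (idx j) X) p * v (idx j) f p)"
      using cramer[OF True, of p] by (simp only: ds)
    then have "d p * X f p = d p * (\<Sum>j\<in>UNIV. \<theta> (idx j) X p * v (idx j) f p)"
      by (simp add: sum_distrib_left mult_ac)
    then have "X f p = (\<Sum>j\<in>UNIV. \<theta> (idx j) X p * v (idx j) f p)"
      using d0 by simp
    then show ?thesis
      unfolding sum_idx by (simp add: cscale_def sum_fun_apply)
  next
    case False
    have "v a f = 0" if "a \<in> {1..3}" for a
      by (rule VF_nonsmooth[OF v_VF[OF that] False])
    then show ?thesis
      using VF_nonsmooth[OF X False] by (simp add: cscale_def sum_fun_apply)
  qed
qed

end

section \<open>The Courant algebroid axioms\<close>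

lemma cscale_distribs:
  "cscale f (X + Y) = cscale f X + cscale f Y" "cscale (f + h) X = cscale f X + cscale h X"
  "cscale f (cscale h X) = cscale (f * h) X" "cscale 1 X = X" "cscale f 0 = 0" "cscale 0 X = 0"
  by (simp_all add: cscale_def fun_eq_iff algebra_simps)

lemma rscale_simps: "rscale 1 X = X" "rscale (- 1) X = - X" "rscale 0 X = 0"
  by (simp_all add: rscale_def cscale_def fun_eq_iff)

lemma module_sscale: "module sscale"
proof
  fix f h :: "'a cfun" and u w :: "'a sec"
  show "sscale f (u + w) = sscale f u + sscale f w"
    by (cases u; cases w) (simp add: cscale_distribs distrib_left)
  show "sscale (f + h) u = sscale f u + sscale h u"
    by (cases u) (simp add: cscale_distribs distrib_right)
  show "sscale f (sscale h u) = sscale (f * h) u"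
    by (cases u) (simp add: cscale_distribs mult.assoc)
  show "sscale 1 u = u"
    by (cases u) (simp add: cscale_distribs)
qed

lemma lie_bracket_skew: "lie_bracket Y X = - lie_bracket X Y"
  by (simp add: lie_bracket_def fun_eq_iff)

lemma lie_bracket_self: "lie_bracket X X = 0"
  by (simp add: lie_bracket_def fun_eq_iff)

context lie3
begin

lemma lie_bracket_zero [simp]: "X \<in> VF \<Longrightarrow> lie_bracket X 0 = 0" "X \<in> VF \<Longrightarrow> lie_bracket 0 X = 0"
proof -
  assume X: "X \<in> VF"
  show 1: "lie_bracket X 0 = 0"
    by (rule ext) (simp only: lie_bracket_def zero_fun_apply VF_0[OF X] diff_self)
  show "lie_bracket 0 X = 0"
    unfolding lie_bracket_skew[of 0 X] 1 by simp
qed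

lemma lie_bracket_add_right:
  assumes "X \<in> VF" "Y \<in> VF" "Z \<in> VF"
  shows "lie_bracket X (Y + Z) = lie_bracket X Y + lie_bracket X Z"
proof
  fix f
  have "X (Y f + Z f) = X (Y f) + X (Z f)"
  proof (cases "f \<in> C")
    case True
    show ?thesis
      by (rule VF_add[OF assms(1) VF_smooth[OF assms(2) True] VF_smooth[OF assms(3) True]])
  next
    case False
    then show ?thesis
      using VF_nonsmooth[OF assms(2) False] VF_nonsmooth[OF assms(3) False] VF_0[OF assms(1)] by simp
  qed
  then show "lie_bracket X (Y + Z) f = (lie_bracket X Y + lie_bracket X Z) f"
    by (simp only: lie_bracket_def plus_fun_apply add_diff_add)
qed

lemma lie_bracket_cscale_right:
  assumes "X \<in> VF" "Y \<in> VF" "k \<in> C"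
  shows "lie_bracket X (cscale k Y) = cscale (X k) Y + cscale k (lie_bracket X Y)"
proof
  fix f
  have "X (k * Y f) = X k * Y f + k * X (Y f)"
  proof (cases "f \<in> C")
    case True
    show ?thesis
      by (rule VF_mult[OF assms(1,3) VF_smooth[OF assms(2) True]])
  next
    case False
    then show ?thesis
      using VF_nonsmooth[OF assms(2) False] VF_0[OF assms(1)] by simp
  qed
  then show "lie_bracket X (cscale k Y) f = (cscale (X k) Y + cscale k (lie_bracket X Y)) f"
    by (simp only: lie_bracket_def plus_fun_apply cscale_def right_diff_distrib add_diff_eq)
qed

lemma lie_deriv1_form [simp]:
  assumes X: "X \<in> VF" and \<eta>: "\<eta> \<in> OF1"
  shows "lie_deriv1 G X \<eta> \<in> OF1"
proof -
  note [simp] = one_formD(1)[OF \<eta>] and \<eta>' = one_formD(2,3)[OF \<eta>]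
  show ?thesis
  proof (rule one_formI)
    fix Y assume Y [simp]: "Y \<in> VF"
    note [simp] = VF_bracket[OF X Y]
    show "lie_deriv1 G X \<eta> Y \<in> C"
      by (simp add: lie_deriv1_def zero_outside_def VF_smooth[OF X])
    fix Z assume Z [simp]: "Z \<in> VF"
    note [simp] = VF_bracket[OF X Z]
    show "lie_deriv1 G X \<eta> (Y + Z) = lie_deriv1 G X \<eta> Y + lie_deriv1 G X \<eta> Z"
      by (simp add: lie_deriv1_def zero_outside_def lie_bracket_add_right[OF X] \<eta>' VF_add[OF X])
  next
    fix Y f assume Y [simp]: "Y \<in> VF" and f [simp]: "f \<in> C"
    note [simp] = VF_bracket[OF X Y]
    have "\<eta> (lie_bracket X (cscale f Y)) = X f * \<eta> Y + f * \<eta> (lie_bracket X Y)"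
      by (simp add: lie_bracket_cscale_right[OF X] \<eta>' VF_smooth[OF X])
    then show "lie_deriv1 G X \<eta> (cscale f Y) = f * lie_deriv1 G X \<eta> Y"
      by (simp add: lie_deriv1_def zero_outside_def \<eta>' VF_mult[OF X] algebra_simps)
  qed (simp add: lie_deriv1_def zero_outside_def)
qed

lemma ext_deriv0_form [simp]: "l \<in> C \<Longrightarrow> ext_deriv0 G l \<in> OF1"
  by (rule one_formI) (simp_all add: ext_deriv0_def zero_outside_def, simp_all add: cscale_def)

lemma ext_deriv1_form [simp]:
  assumes Y: "Y \<in> VF" and \<xi>: "\<xi> \<in> OF1"
  shows "ext_deriv1 G \<xi> Y \<in> OF1"
proof -
  have "ext_deriv1 G \<xi> Y = lie_deriv1 G Y \<xi> - ext_deriv0 G (\<xi> Y)"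
    using Y by (auto simp: ext_deriv1_def lie_deriv1_def ext_deriv0_def zero_outside_def fun_eq_iff)
  then show ?thesis
    using Y \<xi> one_formD(1)[OF \<xi> Y] by simp
qed

end

locale bn_courant = framed G v \<theta>
  for G :: "('g::{t2_space, second_countable_topology}) lie_group" and v \<theta> +
  fixes g F :: "'g tensor2" and H :: "'g tensor3" and \<epsilon> :: "nat \<Rightarrow> real"
  assumes metric: "pseudo_riemannian G g"
    and F: "F \<in> two_forms G"
    and H: "H \<in> three_forms G"
    and \<epsilon>: "\<And>a. a \<in> {1..3} \<Longrightarrow> \<epsilon> a = 1 \<or> \<epsilon> a = -1"
    and g_v: "\<And>a b. a \<in> {1..3} \<Longrightarrow> b \<in> {1..3} \<Longrightarrow> g (v a) (v b) = const_fun (if a = b then \<epsilon> a else 0)"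
begin

abbreviation "S \<equiv> sections G"

lemma g_form [simp]: "X \<in> VF \<Longrightarrow> g X \<in> OF1"
  and g_sym: "X \<in> VF \<Longrightarrow> Y \<in> VF \<Longrightarrow> g X Y = g Y X"
  using metric unfolding pseudo_riemannian_def by blast+

lemma F_form [simp]: "X \<in> VF \<Longrightarrow> F X \<in> OF1"
  and F_skew: "X \<in> VF \<Longrightarrow> Y \<in> VF \<Longrightarrow> F X Y = - F Y X"
  using F unfolding two_forms_def by blast+

lemma H_form [simp]: "X \<in> VF \<Longrightarrow> Y \<in> VF \<Longrightarrow> H X Y \<in> OF1"
  and H_skew: "X \<in> VF \<Longrightarrow> Y \<in> VF \<Longrightarrow> H X Y = - H Y X"
  and H_skew': "X \<in> VF \<Longrightarrow> Y \<in> VF \<Longrightarrow> Z \<in> VF \<Longrightarrow> H X Y Z = - H X Z Y"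
  using H unfolding three_forms_def two_forms_def by blast+

lemma sections_iff [simp]: "(X, \<xi>, l) \<in> S \<longleftrightarrow> X \<in> VF \<and> \<xi> \<in> OF1 \<and> l \<in> C"
  by (simp add: sections_def)

lemma pairing_mem:
  assumes "u \<in> S" "w \<in> S"
  shows "pairing u w \<in> C"
proof -
  obtain X \<xi> l where u: "u = (X, \<xi>, l)" by (rule prod_cases3)
  obtain Y \<eta> m where w: "w = (Y, \<eta>, m)" by (rule prod_cases3)
  show ?thesis
    using assms one_formD(1)[of \<xi> Y] one_formD(1)[of \<eta> X] unfolding u w by simp
qed

lemma dorfman_mem:
  assumes "u \<in> S" "w \<in> S"
  shows "dorfman G H F u w \<in> S"
proof -
  obtain X \<xi> l where u: "u = (X, \<xi>, l)" by (rule prod_cases3)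
  obtain Y \<eta> m where w: "w = (Y, \<eta>, m)" by (rule prod_cases3)
  have "F X Y \<in> C"
    using assms one_formD(1)[OF F_form] unfolding u w by simp
  then show ?thesis
    using assms VF_smooth[of X m] VF_smooth[of Y l] unfolding u w by simp
qed

text \<open>The compatibility of the bracket with the scalar product and its symmetric part are read off from this
  formula.\<close>

lemma pairing_dorfman:
  assumes "(X, \<xi>, l) \<in> S" "(Y, \<eta>, m) \<in> S" "(Z, \<zeta>, n) \<in> S"
  shows "pairing (dorfman G H F (X, \<xi>, l) (Y, \<eta>, m)) (Z, \<zeta>, n) =
    const_fun (1/2) * (X (\<eta> Z) - \<eta> (lie_bracket X Z) - Y (\<xi> Z) + Z (\<xi> Y) + \<xi> (lie_bracket Y Z)
      + H Y X Z + \<zeta> (lie_bracket X Y))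
    + m * Z l - m * F X Z + l * F Y Z + n * (X m - Y l + F X Y)"
  using assms
  by (auto simp: fun_eq_iff lie_deriv1_def ext_deriv1_def ext_deriv0_def zero_outside_def cscale_def rscale_def field_simps)

text \<open>Apart from the derivatives of the scalar product, all terms of \<open>\<langle>[u, w], z\<rangle>\<close> are skew-symmetric in \<open>w\<close> and \<open>z\<close>.\<close>

lemma dorfman_metric:
  assumes "u \<in> S" "w \<in> S" "z \<in> S"
  shows "anchor u (pairing w z) = pairing (dorfman G H F u w) z + pairing w (dorfman G H F u z)"
proof -
  obtain X \<xi> l where u: "u = (X, \<xi>, l)" by (rule prod_cases3)
  obtain Y \<eta> m where w: "w = (Y, \<eta>, m)" by (rule prod_cases3)
  obtain Z \<zeta> n where z: "z = (Z, \<zeta>, n)" by (rule prod_cases3)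
  have mem: "X \<in> VF" "Y \<in> VF" "Z \<in> VF" "\<xi> \<in> OF1" "\<eta> \<in> OF1" "\<zeta> \<in> OF1" "l \<in> C" "m \<in> C" "n \<in> C"
    using assms unfolding u w z by auto
  have smooth: "\<eta> Z \<in> C" "\<zeta> Y \<in> C"
    using one_formD(1) mem by auto
  have pc: "pairing w (dorfman G H F u z) = pairing (dorfman G H F u z) w"
    by (cases "dorfman G H F u z") (simp add: w fun_eq_iff mult.commute)
  have sk: "lie_bracket Z Y = - lie_bracket Y Z" "\<xi> (- lie_bracket Y Z) = - \<xi> (lie_bracket Y Z)"
    "H Z X Y = - H Y X Z" "F Z Y = - F Y Z"
    using lie_bracket_skew[of Z Y] one_form_uminus[OF mem(4) VF_bracket[OF mem(2,3)]] F_skew[OF mem(3,2)]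
      H_skew'[OF mem(1,3,2)] H_skew[OF mem(3,1)] H_skew[OF mem(2,1)] by (auto simp: fun_eq_iff)
  have "X (pairing w z) = const_fun (1/2) * (X (\<eta> Z) + X (\<zeta> Y)) + (X m * n + m * X n)"
    unfolding w z pairing.simps using mem smooth
    by (simp only: VF_add[OF mem(1)] VF_mult[OF mem(1)] VF_const[OF mem(1)] smooth_add smooth_mult smooth_const mult_zero_left add_0_left)
  then show ?thesis
    unfolding pc unfolding u w z using mem
    by (simp only: anchor.simps pairing_dorfman sections_iff simp_thms sk)
      (simp add: fun_eq_iff field_simps)
qed

text \<open>Apart from the derivatives of the scalar product, all terms of \<open>\<langle>[u, w], z\<rangle>\<close> are skew-symmetric in \<open>u\<close> and \<open>w\<close>.\<close>

lemma dorfman_symmetric_part: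
  assumes "u \<in> S" "w \<in> S" "z \<in> S"
  shows "pairing (dorfman G H F u w + dorfman G H F w u) z = anchor z (pairing u w)"
proof -
  obtain X \<xi> l where u: "u = (X, \<xi>, l)" by (rule prod_cases3)
  obtain Y \<eta> m where w: "w = (Y, \<eta>, m)" by (rule prod_cases3)
  obtain Z \<zeta> n where z: "z = (Z, \<zeta>, n)" by (rule prod_cases3)
  have mem: "X \<in> VF" "Y \<in> VF" "Z \<in> VF" "\<xi> \<in> OF1" "\<eta> \<in> OF1" "\<zeta> \<in> OF1" "l \<in> C" "m \<in> C" "n \<in> C"
    using assms unfolding u w z by auto
  have smooth: "\<eta> X \<in> C" "\<xi> Y \<in> C"
    using one_formD(1) mem by auto
  have add: "pairing (a + b) z = pairing a z + pairing b z" if "a \<in> S" "b \<in> S" for a b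
    using that mem by (cases a; cases b) (auto simp: z one_formD(2) fun_eq_iff algebra_simps)
  have sk: "lie_bracket Y X = - lie_bracket X Y" "\<zeta> (- lie_bracket X Y) = - \<zeta> (lie_bracket X Y)"
    "H X Y Z = - H Y X Z" "F Y X = - F X Y"
    using lie_bracket_skew[of Y X] one_form_uminus[OF mem(6) VF_bracket[OF mem(1,2)]] F_skew[OF mem(2,1)]
      H_skew[OF mem(1,2)] by (auto simp: fun_eq_iff)
  have "Z (pairing u w) = const_fun (1/2) * (Z (\<xi> Y) + Z (\<eta> X)) + (Z l * m + l * Z m)"
    unfolding u w pairing.simps using mem smooth
    by (simp only: VF_add[OF mem(3)] VF_mult[OF mem(3)] VF_const[OF mem(3)] smooth_add smooth_mult smooth_const mult_zero_left add_0_left)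
  then show ?thesis
    unfolding add[OF dorfman_mem[OF assms(1,2)] dorfman_mem[OF assms(2,1)]]
    unfolding u w z using mem
    by (simp only: anchor.simps pairing_dorfman sections_iff simp_thms sk)
      (simp add: fun_eq_iff field_simps)
qed

definition \<eta>r :: "nat \<Rightarrow> real" where
  "\<eta>r A = (if A = 0 then 1 else if A \<le> 3 then \<epsilon> A else - \<epsilon> (A - 3))"

lemma \<eta>r_sq: "A \<in> {0..6} \<Longrightarrow> \<eta>r A * \<eta>r A = 1"
proof -
  assume "A \<in> {0..6}"
  then have "A = 0 \<or> A \<in> {1..3} \<or> \<not> A \<le> 3 \<and> A - 3 \<in> {1..3}" by auto
  then show ?thesis using \<epsilon>[of A] \<epsilon>[of "A - 3"] by (auto simp: \<eta>r_def)
qed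

abbreviation "E \<equiv> e_basis g v"

lemma e_simps:
  "E 0 = (0, 0, 1)" "a \<in> {1..3} \<Longrightarrow> E a = (v a, g (v a), 0)" "a \<in> {1..3} \<Longrightarrow> E (a + 3) = (v a, - g (v a), 0)"
  by (auto simp: e_basis_def)

lemma index_cases:
  assumes "A \<in> {0..6::nat}"
  obtains "A = 0" | a where "a \<in> {1..3}" "A = a" | a where "a \<in> {1..3}" "A = a + 3"
proof -
  have "A = 0 \<or> A \<in> {1..3} \<or> A - 3 \<in> {1..3} \<and> A = A - 3 + 3"
    using assms by auto
  then show ?thesis using that by blast
qed

lemma e_mem: "A \<in> {0..6} \<Longrightarrow> E A \<in> S"
  by (erule index_cases) (auto simp: e_simps v_VF)

lemma e_orth: "A \<in> {0..6} \<Longrightarrow> B \<in> {0..6} \<Longrightarrow>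
    pairing (E A) (E B) = (if A = B then const_fun (\<eta>r A) else 0)"
  by (erule index_cases; erule index_cases)
    (auto simp: e_simps g_v \<eta>r_def fun_eq_iff one_form_zero_arg[OF g_form[OF v_VF]])

lemma sum_frame: "(\<Sum>A\<in>{0..6}. f A) = f 0 + (\<Sum>a\<in>{1..3}. f a + f (a + 3))"
  for f :: "nat \<Rightarrow> 'z::ab_group_add"
proof -
  have "{0..6} = {0, 1, 2, 3, 4, 5, 6::nat}" "{1..3} = {1, 2, 3::nat}" by auto
  then show ?thesis by (simp add: algebra_simps)
qed

lemma one_form_expansion:
  assumes "\<xi> \<in> OF1" "X \<in> VF"
  shows "\<xi> X = (\<Sum>a\<in>{1..3}. \<theta> a X * \<xi> (v a))"
proof -
  have "\<xi> X = \<xi> (\<Sum>a\<in>{1..3}. cscale (\<theta> a X) (v a))"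
    using vector_field_expansion[OF assms(2)] by simp
  also have "\<dots> = (\<Sum>a\<in>{1..3}. \<theta> a X * \<xi> (v a))"
  proof -
    have th: "\<theta> a X \<in> C" if "a \<in> {1..3}" for a
      by (rule one_formD(1)[OF \<theta>[OF that] assms(2)])
    have "\<xi> (\<Sum>a\<in>{1..3}. cscale (\<theta> a X) (v a)) = (\<Sum>a\<in>{1..3}. \<xi> (cscale (\<theta> a X) (v a)))"
      by (rule one_form_sum[OF assms(1)]) (rule VF_cscale[OF th v_VF])
    also have "\<dots> = (\<Sum>a\<in>{1..3}. \<theta> a X * \<xi> (v a))"
      by (rule sum.cong[OF refl]) (rule one_formD(3)[OF assms(1) th v_VF])
    finally show ?thesis .
  qed
  finally show ?thesis .
qed

lemma \<theta>_metric: "X \<in> VF \<Longrightarrow> a \<in> {1..3} \<Longrightarrow> \<theta> a X = const_fun (\<epsilon> a) * g (v a) X"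
proof -
  assume X: "X \<in> VF" and a: "a \<in> {1..3}"
  have "g (v a) X = (\<Sum>b\<in>{1..3}. \<theta> b X * g (v a) (v b))"
    by (rule one_form_expansion[OF g_form[OF v_VF[OF a]] X])
  also have "\<dots> = (\<Sum>b\<in>{1..3}. if b = a then \<theta> b X * const_fun (\<epsilon> b) else 0)"
    using a by (intro sum.cong) (auto simp: g_v const_fun_arith)
  finally have "g (v a) X = \<theta> a X * const_fun (\<epsilon> a)"
    using a by simp
  then show ?thesis
    using \<epsilon>[OF a] by (auto simp: fun_eq_iff)
qed

lemma e_expand:
  assumes "u \<in> S"
  shows "u = (\<Sum>A\<in>{0..6}. sscale (const_fun (\<eta>r A) * pairing u (E A)) (E A))"
proof -
  obtain X \<xi> l where u: "u = (X, \<xi>, l)" by (rule prod_cases3)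
  have X: "X \<in> VF" and \<xi>: "\<xi> \<in> OF1" and l: "l \<in> C"
    using assms unfolding u by auto
  define x where "x a = const_fun (\<epsilon> a) * g (v a) X" for a
  define y where "y a = const_fun (\<epsilon> a) * \<xi> (v a)" for a
  have \<eta>: "\<eta>r a = \<epsilon> a" "\<eta>r (a + 3) = - \<epsilon> a" if "a \<in> {1..3}" for a
    using that by (auto simp: \<eta>r_def)
  have c0: "const_fun (\<eta>r 0) * pairing u (E 0) = l"
    using one_form_zero_arg[OF \<xi>] by (simp add: u e_simps \<eta>r_def const_fun_arith)
  have c: "const_fun (\<eta>r a) * pairing u (E a) = const_fun (1/2) * (y a + x a)"
    "const_fun (\<eta>r (a + 3)) * pairing u (E (a + 3)) = const_fun (1/2) * (x a - y a)" if a: "a \<in> {1..3}" for a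
    using a by (simp_all add: u e_simps \<eta> x_def y_def fun_eq_iff field_simps)
  have pair_sum: "sscale (const_fun (\<eta>r a) * pairing u (E a)) (E a) + sscale (const_fun (\<eta>r (a + 3)) * pairing u (E (a + 3))) (E (a + 3))
      = (cscale (x a) (v a), cscale (y a) (g (v a)), 0)" if a: "a \<in> {1..3}" for a
    unfolding c[OF a] unfolding e_simps(2,3)[OF a] by (simp add: cscale_def fun_eq_iff field_simps)
  have "(\<Sum>A\<in>{0..6}. sscale (const_fun (\<eta>r A) * pairing u (E A)) (E A))
      = sscale l (0, 0, 1) + (\<Sum>a\<in>{1..3}. (cscale (x a) (v a), cscale (y a) (g (v a)), 0))"
    unfolding sum_frame c0 unfolding e_simps(1)
    by (intro arg_cong[where f = "\<lambda>t. sscale l (0, 0, 1) + t"] sum.cong refl pair_sum)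
  also have "\<dots> = (\<Sum>a\<in>{1..3}. cscale (x a) (v a), \<Sum>a\<in>{1..3}. cscale (y a) (g (v a)), l)"
    by (intro prod_eqI) (simp_all add: fst_sum snd_sum cscale_distribs)
  also have "(\<Sum>a\<in>{1..3}. cscale (x a) (v a)) = X"
    using vector_field_expansion[OF X] \<theta>_metric[OF X] by (simp add: x_def)
  also have "(\<Sum>a\<in>{1..3}. cscale (y a) (g (v a))) = \<xi>"
  proof (rule one_form_ext[OF _ \<xi>])
    have "y a \<in> C" if "a \<in> {1..3}" for a
      using one_formD(1)[OF \<xi> v_VF[OF that]] by (simp add: y_def)
    then show "(\<Sum>a\<in>{1..3}. cscale (y a) (g (v a))) \<in> OF1"
      using v_VF by (intro OF1_sum OF1_cscale g_form) auto
    show "(\<Sum>a\<in>{1..3}. cscale (y a) (g (v a))) Z = \<xi> Z" if Z: "Z \<in> VF" for Z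
      using one_form_expansion[OF \<xi> Z] \<theta>_metric[OF Z]
      by (simp add: sum_fun_apply cscale_def y_def mult_ac)
  qed
  finally show ?thesis
    unfolding u by (rule sym)
qed

end

section \<open>The left-invariant frame of the Courant algebroid\<close>

text \<open>\<open>str a b\<close>, \<open>Fc a b\<close> and \<open>Hc a b c\<close> are the constant components of the Lie bracket, of \<open>F\<close> and of \<open>H\<close> in
  the basis \<open>v\<close>.\<close>

locale left_inv_courant = bn_courant G v \<theta> g F H \<epsilon>
  for G :: "('g::{t2_space, second_countable_topology}) lie_group" and v \<theta> g F H \<epsilon> +
  fixes str :: "nat \<Rightarrow> nat \<Rightarrow> nat \<Rightarrow> real" and Fc :: "nat \<Rightarrow> nat \<Rightarrow> real"
    and Hc :: "nat \<Rightarrow> nat \<Rightarrow> nat \<Rightarrow> real"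
  assumes bracket_v: "\<And>a b. a \<in> {1..3} \<Longrightarrow> b \<in> {1..3} \<Longrightarrow>
      lie_bracket (v a) (v b) = (\<Sum>k\<in>{1..3}. rscale (str a b k) (v k))"
    and F_v: "\<And>a b. a \<in> {1..3} \<Longrightarrow> b \<in> {1..3} \<Longrightarrow> F (v a) (v b) = const_fun (Fc a b)"
    and H_v: "\<And>a b c. a \<in> {1..3} \<Longrightarrow> b \<in> {1..3} \<Longrightarrow> c \<in> {1..3} \<Longrightarrow> H (v a) (v b) (v c) = const_fun (Hc a b c)"
begin

lemma g_bracket:
  assumes a: "a \<in> {1..3}" and b: "b \<in> {1..3}" and c: "c \<in> {1..3}"
  shows "g (v c) (lie_bracket (v a) (v b)) = const_fun (str a b c * \<epsilon> c)"
proof -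
  note gc = g_form[OF v_VF[OF c]]
  have "g (v c) (lie_bracket (v a) (v b)) = (\<Sum>k\<in>{1..3}. g (v c) (rscale (str a b k) (v k)))"
    unfolding bracket_v[OF a b] by (rule one_form_sum[OF gc]) (rule VF_rscale[OF v_VF])
  also have "\<dots> = (\<Sum>k\<in>{1..3}. const_fun (if k = c then str a b k * \<epsilon> k else 0))"
  proof (rule sum.cong[OF refl])
    fix k assume k: "k \<in> {1..3::nat}"
    show "g (v c) (rscale (str a b k) (v k)) = const_fun (if k = c then str a b k * \<epsilon> k else 0)"
      unfolding rscale_def one_formD(3)[OF gc smooth_const v_VF[OF k]] g_v[OF c k] const_fun_arith by auto
  qed
  finally show ?thesis
    using c by (simp add: const_fun_sum)
qed

text \<open>For \<open>A \<ge> 1\<close> the frame vector \<open>e\<^sub>A\<close> is \<open>v\<^sub>i + s g(v\<^sub>i)\<close> with \<open>i = ix A\<close> and sign \<open>s = sg A\<close>.\<close>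

definition ix :: "nat \<Rightarrow> nat" where "ix A = (if A \<le> 3 then A else A - 3)"
definition sg :: "nat \<Rightarrow> real" where "sg A = (if A \<le> 3 then 1 else - 1)"

lemma ix_mem: "A \<in> {0..6} \<Longrightarrow> A \<noteq> 0 \<Longrightarrow> ix A \<in> {1..3}"
  by (auto simp: ix_def)

lemma e_eq: "A \<noteq> 0 \<Longrightarrow> E A = (v (ix A), rscale (sg A) (g (v (ix A))), 0)"
  by (simp add: e_basis_def ix_def sg_def rscale_simps)

definition frame_coeff :: "nat \<Rightarrow> nat \<Rightarrow> nat \<Rightarrow> real" where
  "frame_coeff a b c =
     (if a = 0 then if b = 0 \<or> c = 0 then 0 else Fc (ix b) (ix c)
      else if b = 0 then if c = 0 then 0 else Fc (ix c) (ix a)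
      else if c = 0 then Fc (ix a) (ix b)
      else (sg a * str (ix b) (ix c) (ix a) * \<epsilon> (ix a) - sg b * str (ix a) (ix c) (ix b) * \<epsilon> (ix b)
        + sg c * str (ix a) (ix b) (ix c) * \<epsilon> (ix c) + Hc (ix b) (ix a) (ix c)) / 2)"

lemma pairing_dorfman_frame:
  assumes "a \<in> {0..6}" "b \<in> {0..6}" "c \<in> {0..6}"
  shows "pairing (dorfman G H F (E a) (E b)) (E c) = const_fun (frame_coeff a b c)"
proof -
  have S: "E a \<in> S" "E b \<in> S" "E c \<in> S" using e_mem assms by auto
  have H0: "H X 0 = 0" "H 0 X = 0" if "X \<in> VF" for X
  proof -
    show "H X 0 = 0"
      using H_skew'[OF that VF_zero] one_form_zero_arg[OF H_form[OF that]]
      by (intro one_form_ext[OF H_form[OF that VF_zero] OF1_zero]) simp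
    then show "H 0 X = 0"
      using H_skew[OF VF_zero that] by simp
  qed
  have F0: "F 0 X = 0" "F X 0 = 0" if "X \<in> VF" for X
    using F_skew[OF VF_zero that] one_form_zero_arg[OF F_form[OF that]] by auto
  have V: "v (ix i) \<in> VF" "rscale s (g (v (ix i))) \<in> OF1" if "i \<in> {0..6}" "i \<noteq> 0" for i s
    using v_VF[OF ix_mem[OF that]] by auto
  note zero = H0 F0 one_form_zero_arg lie_bracket_zero
  consider "a = 0" "b = 0" | "a = 0" "b \<noteq> 0" "c = 0" | "a = 0" "b \<noteq> 0" "c \<noteq> 0"
    | "a \<noteq> 0" "b = 0" "c = 0" | "a \<noteq> 0" "b = 0" "c \<noteq> 0" | "a \<noteq> 0" "b \<noteq> 0" "c = 0" | "a \<noteq> 0" "b \<noteq> 0" "c \<noteq> 0"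
    by blast
  then show ?thesis
  proof cases
    case 1
    show ?thesis
    proof (cases "c = 0")
      case True
      then show ?thesis using S 1 unfolding 1 True e_simps(1)
        by (subst pairing_dorfman) (simp_all add: zero frame_coeff_def fun_eq_iff)
    next
      case False
      note V' = V[OF assms(3) False]
      show ?thesis using S unfolding 1 e_simps(1) e_eq[OF False]
        by (subst pairing_dorfman) (use V' in \<open>simp_all add: zero frame_coeff_def fun_eq_iff\<close>)
    qed
  next
    case 2
    note V' = V[OF assms(2) 2(2)]
    show ?thesis using S unfolding 2 e_simps(1) e_eq[OF 2(2)]
      by (subst pairing_dorfman) (use V' 2 in \<open>simp_all add: zero frame_coeff_def fun_eq_iff\<close>)
  next
    case 3
    note V' = V[OF assms(2) 3(2)] V[OF assms(3) 3(3)]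
    show ?thesis using S unfolding 3 e_simps(1) e_eq[OF 3(2)] e_eq[OF 3(3)]
      by (subst pairing_dorfman) (use V' 3 F_v[OF ix_mem[OF assms(2) 3(2)] ix_mem[OF assms(3) 3(3)]] in
          \<open>simp_all add: zero frame_coeff_def fun_eq_iff\<close>)
  next
    case 4
    note V' = V[OF assms(1) 4(1)]
    show ?thesis using S unfolding 4 e_simps(1) e_eq[OF 4(1)]
      by (subst pairing_dorfman) (use V' 4 in \<open>simp_all add: zero frame_coeff_def fun_eq_iff\<close>)
  next
    case 5
    note V' = V[OF assms(1) 5(1)] V[OF assms(3) 5(3)]
    note zero = H0 F0 one_form_zero_arg[OF V'(2)] one_form_zero_arg[OF V'(4)] lie_bracket_zero
      VF_0[OF V'(1)] VF_0[OF V'(3)]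
    show ?thesis using S unfolding 5 e_simps(1) e_eq[OF 5(1)] e_eq[OF 5(3)]
      by (subst pairing_dorfman) (use V' 5 F_skew[OF V'(1,3)] F_v[OF ix_mem[OF assms(3) 5(3)] ix_mem[OF assms(1) 5(1)]] in
          \<open>simp_all add: zero frame_coeff_def fun_eq_iff\<close>)
  next
    case 6
    note V' = V[OF assms(1) 6(1)] V[OF assms(2) 6(2)]
    note zero = H0 F0 one_form_zero_arg[OF V'(2)] one_form_zero_arg[OF V'(4)] lie_bracket_zero
      VF_0[OF V'(1)] VF_0[OF V'(3)] one_form_zero_arg[OF H_form[OF V'(3,1)]]
    show ?thesis using S unfolding 6 e_simps(1) e_eq[OF 6(1)] e_eq[OF 6(2)]
      by (subst pairing_dorfman) (use V' 6 F_v[OF ix_mem[OF assms(1) 6(1)] ix_mem[OF assms(2) 6(2)]] in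
          \<open>simp_all add: zero frame_coeff_def fun_eq_iff\<close>)
  next
    case 7
    note i = ix_mem[OF assms(1) 7(1)] ix_mem[OF assms(2) 7(2)] ix_mem[OF assms(3) 7(3)]
    note V' = V[OF assms(1) 7(1)] V[OF assms(2) 7(2)] V[OF assms(3) 7(3)]
    have r: "rscale s (g X) Y = const_fun s * g X Y" for s X Y
      by (simp add: rscale_def cscale_def)
    have k: "v (ix j) (const_fun s * (const_fun t)) = 0" if "j \<in> {0..6}" "j \<noteq> 0" for j s t
      unfolding const_fun_arith by (rule VF_const[OF V(1)[OF that]])
    note k' = k[OF assms(1) 7(1)] k[OF assms(2) 7(2)] k[OF assms(3) 7(3)]
    show ?thesis
      using S unfolding e_eq[OF 7(1)] e_eq[OF 7(2)] e_eq[OF 7(3)]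
      by (subst pairing_dorfman)
        (assumption+, simp only: r g_v[OF i(1) i(2)] g_v[OF i(1) i(3)] g_v[OF i(2) i(3)] k'
          g_bracket[OF i(1,3,2)] g_bracket[OF i(2,3,1)] g_bracket[OF i(1,2,3)] H_v[OF i(2,1,3)],
          use 7 V' in \<open>simp add: frame_coeff_def fun_eq_iff\<close>)
  qed
qed

sublocale cf: courant_frame sscale C S pairing anchor "dorfman G H F" "{0..6}" E "\<lambda>A. const_fun (\<eta>r A)"
proof (intro courant_frame.intro module_sscale courant_frame_axioms.intro)
  fix u w z assume u: "u \<in> S" and w: "w \<in> S" and z: "z \<in> S"
  obtain X \<xi> l where u': "u = (X, \<xi>, l)" by (rule prod_cases3)
  obtain Y \<eta> m where w': "w = (Y, \<eta>, m)" by (rule prod_cases3)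
  obtain Z \<zeta> n where z': "z = (Z, \<zeta>, n)" by (rule prod_cases3)
  show "pairing u w \<in> C" by (rule pairing_mem[OF u w])
  show "pairing u w = pairing w u" by (simp add: u' w' fun_eq_iff mult.commute)
  show "pairing (u + w) z = pairing u z + pairing w z"
    using u w z by (simp add: u' w' z' one_formD(2) fun_eq_iff algebra_simps)
  show "dorfman G H F u w \<in> S" by (rule dorfman_mem[OF u w])
  show "anchor u (pairing w z) = pairing (dorfman G H F u w) z + pairing w (dorfman G H F u z)"
    by (rule dorfman_metric[OF u w z])
  show "pairing (dorfman G H F u w + dorfman G H F w u) z = anchor z (pairing u w)"
    by (rule dorfman_symmetric_part[OF u w z])
next
  fix u w f assume u: "u \<in> S" and w: "w \<in> S" and f: "f \<in> C"
  obtain X \<xi> l where u': "u = (X, \<xi>, l)" by (rule prod_cases3)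
  obtain Y \<eta> m where w': "w = (Y, \<eta>, m)" by (rule prod_cases3)
  show "anchor (dorfman G H F u w) f = anchor u (anchor w f) - anchor w (anchor u f)"
    by (simp add: u' w' lie_bracket_def)
  show "anchor (u + w) f = anchor u f + anchor w f"
    by (simp add: u' w')
  have "cscale f \<xi> Y = f * \<xi> Y" by (simp add: cscale_def)
  then show "pairing (sscale f u) w = f * pairing u w"
    using u w f one_formD(3)[of \<eta> f X] by (simp add: u' w' fun_eq_iff algebra_simps)
next
  fix u f h assume u: "u \<in> S" and f: "f \<in> C" and h: "h \<in> C"
  obtain X \<xi> l where u': "u = (X, \<xi>, l)" by (rule prod_cases3)
  have X: "X \<in> VF" using u by (simp add: u')
  show "anchor u f \<in> C" using VF_smooth[OF X f] by (simp add: u')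
  show "anchor u (f + h) = anchor u f + anchor u h" using VF_add[OF X f h] by (simp add: u')
  show "anchor u (f * h) = anchor u f * h + f * anchor u h" using VF_mult[OF X f h] by (simp add: u')
  show "anchor (sscale h u) f = h * anchor u f" by (simp add: u' cscale_def)
next
  fix u A assume "u \<in> S" and "A \<in> {0..6::nat}"
  then show "anchor u (const_fun (\<eta>r A)) = 0"
    by (cases u) (auto simp: VF_const)
next
  fix u a b c assume "u \<in> S" and "a \<in> {0..6::nat}" "b \<in> {0..6::nat}" "c \<in> {0..6::nat}"
  then show "anchor u (pairing (dorfman G H F (E a) (E b)) (E c)) = 0"
    unfolding pairing_dorfman_frame[OF \<open>a \<in> {0..6}\<close> \<open>b \<in> {0..6}\<close> \<open>c \<in> {0..6}\<close>]
    by (cases u) (auto simp: VF_const)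
next
  fix u w assume "u \<in> S" "w \<in> S"
  then show "u + w \<in> S" by (cases u; cases w) auto
next
  fix f u assume "f \<in> C" "u \<in> S"
  then show "sscale f u \<in> S" by (cases u) auto
next
  show "0 \<in> S" by (simp add: zero_prod_def)
next
  fix A assume A: "A \<in> {0..6::nat}"
  show "E A \<in> S" by (rule e_mem[OF A])
  show "const_fun (\<eta>r A) * const_fun (\<eta>r A) = 1"
    using \<eta>r_sq[OF A] by (simp add: const_fun_arith)
next
  fix A B assume "A \<in> {0..6::nat}" "B \<in> {0..6::nat}"
  then show "pairing (E A) (E B) = (if A = B then const_fun (\<eta>r A) else 0)"
    by (rule e_orth)
next
  fix u assume "u \<in> S"
  then show "u = (\<Sum>A\<in>{0..6}. sscale (const_fun (\<eta>r A) * pairing u (E A)) (E A))"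
    by (rule e_expand)
qed auto

lemma B_eq: "a \<in> {0..6} \<Longrightarrow> b \<in> {0..6} \<Longrightarrow> c \<in> {0..6} \<Longrightarrow> cf.B a b c = const_fun (frame_coeff a b c)"
  by (simp add: cf.B_def pairing_dorfman_frame)

lemma frame_coeff_antisym:
  assumes "a \<in> {0..6}" "b \<in> {0..6}" "c \<in> {0..6}"
  shows "frame_coeff b a c = - frame_coeff a b c" "frame_coeff a c b = - frame_coeff a b c"
  using cf.B_antisym[OF assms] assms by (simp_all add: B_eq const_fun_arith)

lemma E_minus_eq: "E_minus G g = cf.part {4..6}"
proof (intro Set.set_eqI iffI)
  fix u assume "u \<in> E_minus G g"
  then obtain X where X: "X \<in> VF" and u: "u = (X, - g X, 0)"
    by (auto simp: E_minus_def)
  show "u \<in> cf.part {4..6}"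
  proof (rule cf.part_intro)
    show "u \<in> S" using X by (simp add: u)
    fix A assume "A \<in> {0..6::nat}" "A \<notin> {4..6::nat}"
    then have "A = 0 \<or> A \<in> {1..3}" by auto
    then show "pairing u (E A) = 0"
    proof
      assume "A = 0"
      then show ?thesis using one_form_zero_arg[OF g_form[OF X]] by (simp add: u e_simps fun_eq_iff)
    next
      assume A: "A \<in> {1..3}"
      show ?thesis using g_sym[OF X v_VF[OF A]] by (simp add: u e_simps(2)[OF A] fun_eq_iff)
    qed
  qed
next
  fix u assume u: "u \<in> cf.part {4..6}"
  obtain X \<xi> l where u': "u = (X, \<xi>, l)" by (rule prod_cases3)
  have X: "X \<in> VF" and \<xi>: "\<xi> \<in> OF1"
    using cf.part_M[OF u] by (auto simp: u')
  have l: "l = 0"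
    using cf.part_zero[OF u, of 0] one_form_zero_arg[OF \<xi>] by (simp add: u' e_simps)
  have on_v: "\<xi> (v a) = (- g X) (v a)" if a: "a \<in> {1..3}" for a
  proof -
    have "pairing u (E a) = 0" by (rule cf.part_zero[OF u]) (use a in auto)
    then show ?thesis
      using g_sym[OF X v_VF[OF a]] by (simp add: u' e_simps(2)[OF a] fun_eq_iff) (simp add: eq_neg_iff_add_eq_0)
  qed
  have "\<xi> = - g X"
  proof (rule one_form_ext[OF \<xi>])
    show gX: "- g X \<in> OF1" using X by simp
    show "\<xi> Y = (- g X) Y" if "Y \<in> VF" for Y
      unfolding one_form_expansion[OF \<xi> that] one_form_expansion[OF gX that]
      by (rule sum.cong[OF refl]) (simp only: on_v)
  qed
  then show "u \<in> E_minus G g"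
    using X by (auto simp: E_minus_def u' l)
qed

lemma E_plus_eq: "E_plus G g = cf.part {0..3}"
proof (intro Set.set_eqI iffI)
  fix u assume u: "u \<in> E_plus G g"
  show "u \<in> cf.part {0..3}"
  proof (rule cf.part_intro)
    show "u \<in> S" using u by (simp add: E_plus_def)
    fix A assume "A \<in> {0..6::nat}" "A \<notin> {0..3::nat}"
    then have "E A \<in> E_minus G g"
      unfolding E_minus_eq by (intro cf.e_part) auto
    then show "pairing u (E A) = 0" using u by (simp add: E_plus_def)
  qed
next
  fix u assume "u \<in> cf.part {0..3}"
  then show "u \<in> E_plus G g"
    unfolding E_plus_def E_minus_eq using cf.part_orthogonal[of u "{0..3}" _ "{4..6}"] by auto
qed

lemma generalized_connection_iff: "generalized_connection G D \<longleftrightarrow> cf.gconn D"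
  unfolding generalized_connection_def cf.gconn_def ..

lemma levi_civita_iff: "levi_civita G g H F D \<longleftrightarrow> cf.LC {4..6} D"
  unfolding levi_civita_def cf.LC_def generalized_connection_iff E_minus_eq torsion_def cf.tors_def ..

lemma curvature_eq: "curvature G H F D = cf.curv D"
  by (simp add: curvature_def cf.curv_def fun_eq_iff)

section \<open>The generalized Einstein condition in the frame\<close>

text \<open>The frame components of the Ricci tensor with trace over \<open>J\<close>, as real numbers.\<close>

definition ricci_coeff :: "(nat \<Rightarrow> real) \<Rightarrow> nat set \<Rightarrow> nat set \<Rightarrow> nat \<Rightarrow> nat \<Rightarrow> real" where
  "ricci_coeff d J K b j = (\<Sum>k\<in>J. \<eta>r k * frame_coeff b j k * d k) - (\<Sum>i\<in>J. \<Sum>c\<in>K. \<eta>r i * \<eta>r c * frame_coeff i b c * frame_coeff c j i)"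

lemma split_connection_of:
  assumes D: "cf.LC {4..6} D"
  shows "split_connection sscale C S pairing anchor (dorfman G H F) {0..6} E (\<lambda>A. const_fun (\<eta>r A)) {0..3} {4..6} D"
    "split_connection sscale C S pairing anchor (dorfman G H F) {0..6} E (\<lambda>A. const_fun (\<eta>r A)) {4..6} {0..3} D"
proof -
  have I: "{0..3} \<union> {4..6} = {0..6::nat}" "{0..3} \<inter> {4..6::nat} = {}" by auto
  have conn: "cf.gconn D" and tf: "\<And>u v w. u \<in> S \<Longrightarrow> v \<in> S \<Longrightarrow> w \<in> S \<Longrightarrow> cf.tors D u v w = 0"
    and pres: "\<And>u v. u \<in> S \<Longrightarrow> v \<in> cf.part {4..6} \<Longrightarrow> D u v \<in> cf.part {4..6}"
    using D unfolding cf.LC_def by blast+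
  note pres' = cf.preserves_complement[OF conn I pres]
  show "split_connection sscale C S pairing anchor (dorfman G H F) {0..6} E (\<lambda>A. const_fun (\<eta>r A)) {0..3} {4..6} D"
    using I conn tf pres pres' by unfold_locales auto
  show "split_connection sscale C S pairing anchor (dorfman G H F) {0..6} E (\<lambda>A. const_fun (\<eta>r A)) {4..6} {0..3} D"
    using I conn tf pres pres' by unfold_locales auto
qed

lemma ricci_vanishes_iff:
  assumes D: "cf.LC {4..6} D" and d: "\<And>k. k \<in> {0..6} \<Longrightarrow> connection_div G D (E k) = const_fun (d k)"
  shows "(\<forall>u\<in>E_minus G g. \<forall>w\<in>E_plus G g. ricci_plus G g H F D u w = 0) \<longleftrightarrow>
      (\<forall>b\<in>{4..6}. \<forall>j\<in>{0..3}. ricci_coeff d {0..3} {4..6} b j = 0)" (is ?plus)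
    "(\<forall>u\<in>E_plus G g. \<forall>w\<in>E_minus G g. ricci_minus G g H F D u w = 0) \<longleftrightarrow>
      (\<forall>b\<in>{0..3}. \<forall>j\<in>{4..6}. ricci_coeff d {4..6} {0..3} b j = 0)" (is ?minus)
proof -
  interpret p: split_connection sscale C S pairing anchor "dorfman G H F" "{0..6}" E "\<lambda>A. const_fun (\<eta>r A)" "{0..3}" "{4..6}" D
    by (rule split_connection_of(1)[OF D])
  interpret m: split_connection sscale C S pairing anchor "dorfman G H F" "{0..6}" E "\<lambda>A. const_fun (\<eta>r A)" "{4..6}" "{0..3}" D
    by (rule split_connection_of(2)[OF D])
  have dvp: "p.frame_div k = const_fun (d k)" and dvm: "m.frame_div k = const_fun (d k)" if "k \<in> {0..6}" for k
    using d[OF that] by (simp_all add: p.frame_div_def m.frame_div_def connection_div_def)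
  have act0: "anchor (E b) (const_fun c) = 0" if "b \<in> {0..6}" for b c
    using e_mem[OF that] by (cases "E b") (auto simp: VF_const)
  have rp: "p.ric (E b) (E j) = const_fun (ricci_coeff d {0..3} {4..6} b j)" if b: "b \<in> {4..6}" and j: "j \<in> {0..3}" for b j
  proof -
    have "p.ric (E b) (E j) = (\<Sum>k\<in>{0..3}. const_fun (\<eta>r k) * cf.B b j k * p.frame_div k)
      - (\<Sum>i\<in>{0..3}. \<Sum>c\<in>{4..6}. const_fun (\<eta>r i) * const_fun (\<eta>r c) * cf.B i b c * cf.B c j i)"
      by (rule p.ric_frame[OF b j]) (use b j act0 in \<open>simp add: dvp\<close>)
    moreover have "const_fun (\<eta>r k) * cf.B b j k * p.frame_div k = const_fun (\<eta>r k * frame_coeff b j k * d k)" if "k \<in> {0..3}" for k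
      using that b j by (simp add: B_eq dvp const_fun_arith)
    moreover have "const_fun (\<eta>r i) * const_fun (\<eta>r c) * cf.B i b c * cf.B c j i
        = const_fun (\<eta>r i * \<eta>r c * frame_coeff i b c * frame_coeff c j i)" if "i \<in> {0..3}" "c \<in> {4..6}" for i c
      using that b j by (simp add: B_eq const_fun_arith)
    ultimately show ?thesis
      unfolding ricci_coeff_def const_fun_arith(6)[symmetric] const_fun_sum[symmetric] by (simp only: cong: sum.cong)
  qed
  have rm: "m.ric (E b) (E j) = const_fun (ricci_coeff d {4..6} {0..3} b j)" if b: "b \<in> {0..3}" and j: "j \<in> {4..6}" for b j
  proof -
    have "m.ric (E b) (E j) = (\<Sum>k\<in>{4..6}. const_fun (\<eta>r k) * cf.B b j k * m.frame_div k)
      - (\<Sum>i\<in>{4..6}. \<Sum>c\<in>{0..3}. const_fun (\<eta>r i) * const_fun (\<eta>r c) * cf.B i b c * cf.B c j i)"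
      by (rule m.ric_frame[OF b j]) (use b j act0 in \<open>simp add: dvm\<close>)
    moreover have "const_fun (\<eta>r k) * cf.B b j k * m.frame_div k = const_fun (\<eta>r k * frame_coeff b j k * d k)" if "k \<in> {4..6}" for k
      using that b j by (simp add: B_eq dvm const_fun_arith)
    moreover have "const_fun (\<eta>r i) * const_fun (\<eta>r c) * cf.B i b c * cf.B c j i
        = const_fun (\<eta>r i * \<eta>r c * frame_coeff i b c * frame_coeff c j i)" if "i \<in> {4..6}" "c \<in> {0..3}" for i c
      using that b j by (simp add: B_eq const_fun_arith)
    ultimately show ?thesis
      unfolding ricci_coeff_def const_fun_arith(6)[symmetric] const_fun_sum[symmetric] by (simp only: cong: sum.cong)
  qed
  have z: "const_fun x = 0 \<longleftrightarrow> x = 0" for x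
    by (simp add: const_fun_arith(1)[symmetric])
  have "ricci_plus G g H F D = p.ric"
    by (simp add: ricci_plus_def p.ric_def E_plus_eq curvature_eq fun_eq_iff)
  then show ?plus
    using p.ric_zero_iff rp by (simp add: E_minus_eq E_plus_eq z)
  have "ricci_minus G g H F D = m.ric"
    by (simp add: ricci_minus_def m.ric_def E_minus_eq curvature_eq fun_eq_iff)
  then show ?minus
    using m.ric_zero_iff rm by (simp add: E_minus_eq E_plus_eq z)
qed

text \<open>The mixed symbols are forced by vanishing torsion. In the two diagonal blocks \<open>frame_coeff / 3\<close> has the required
  cyclic sum, and a term of pure trace type, whose cyclic sum is zero, adjusts the divergence: on a block of
  dimension \<open>n\<close> its trace is \<open>n - 1\<close> times its coefficient, whence the factors \<open>1/3\<close> and \<open>1/2\<close>.\<close>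

definition christoffel :: "(nat \<Rightarrow> real) \<Rightarrow> nat \<Rightarrow> nat \<Rightarrow> nat \<Rightarrow> real" where
  "christoffel d a b c =
     (if (b \<le> 3) \<noteq> (c \<le> 3) then 0
      else if (a \<le> 3) \<noteq> (b \<le> 3) then frame_coeff a b c
      else frame_coeff a b c / 3 + ((if a = c then \<eta>r a * d b else 0) - (if a = b then \<eta>r a * d c else 0)) / (if a \<le> 3 then 3 else 2))"

lemma levi_civita_div_exists:
  assumes \<delta>: "divergence_operator G \<delta>" and d: "\<And>A. A \<in> {0..6} \<Longrightarrow> \<delta> (E A) = const_fun (d A)"
  shows "\<exists>D. levi_civita_div G g H F \<delta> D"
proof -
  let ?\<gamma> = "\<lambda>a b c. const_fun (christoffel d a b c)"
  obtain D where D: "cf.LC {4..6} D"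
    and frame: "\<And>a b c. a \<in> {0..6} \<Longrightarrow> b \<in> {0..6} \<Longrightarrow> c \<in> {0..6} \<Longrightarrow> pairing (D (E a) (E b)) (E c) = ?\<gamma> a b c"
  proof (rule cf.connection_exists[of ?\<gamma> "{4..6}"])
    fix a b c :: nat assume abc: "a \<in> {0..6}" "b \<in> {0..6}" "c \<in> {0..6}"
    show "?\<gamma> a c b = - ?\<gamma> a b c"
      using frame_coeff_antisym(2)[OF abc] by (auto simp: const_fun_arith christoffel_def field_simps)
    have "frame_coeff b c a = frame_coeff a b c" "frame_coeff c a b = frame_coeff a b c"
      using frame_coeff_antisym(1)[of a b c] frame_coeff_antisym(2)[of a b c] frame_coeff_antisym(2)[of b a c] frame_coeff_antisym(1)[of a c b] abc by auto
    then show "?\<gamma> a b c + ?\<gamma> b c a + ?\<gamma> c a b = cf.B a b c"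
      using abc by (auto simp: B_eq const_fun_arith christoffel_def field_simps)
  qed (auto simp: christoffel_def const_fun_arith)
  have tr: "(\<Sum>a\<in>{0..6}. const_fun (\<eta>r a) * pairing (D (E a) (E b)) (E a)) = const_fun (d b)" if b: "b \<in> {0..6}" for b
  proof -
    have B0: "frame_coeff a b a = 0" if "a \<in> {0..6}" for a
      using frame_coeff_antisym(2)[of a a b] frame_coeff_antisym(1)[of a a b] that b by simp
    have "(\<Sum>a\<in>{0..6}. const_fun (\<eta>r a) * pairing (D (E a) (E b)) (E a)) = const_fun (\<Sum>a\<in>{0..6}. \<eta>r a * christoffel d a b a)"
      unfolding const_fun_sum[symmetric]
      by (rule sum.cong[OF refl]) (simp only: frame[OF _ b] const_fun_arith)
    also have "(\<Sum>a\<in>{0..6}. \<eta>r a * christoffel d a b a)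
      = (\<Sum>a\<in>{0..6}. if (a \<le> 3) = (b \<le> 3) \<and> a \<noteq> b then d b / (if a \<le> 3 then 3 else 2) else 0)"
    proof (rule sum.cong[OF refl])
      fix a assume a: "a \<in> {0..6::nat}"
      have "\<eta>r a * (\<eta>r a * x) = x" for x
        using \<eta>r_sq[OF a] by (simp add: mult.assoc[symmetric])
      then show "\<eta>r a * christoffel d a b a = (if (a \<le> 3) = (b \<le> 3) \<and> a \<noteq> b then d b / (if a \<le> 3 then 3 else 2) else 0)"
        using B0[OF a] by (auto simp: christoffel_def)
    qed
    also have "\<dots> = d b"
    proof -
      have 7: "{0..6} = {0, 1, 2, 3, 4, 5, 6::nat}" by auto
      show ?thesis using b unfolding 7 by auto
    qed
    finally show ?thesis .
  qed
  have conn: "cf.gconn D" using D by (simp add: cf.LC_def)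
  have \<delta>_add: "\<delta> (u + w) = \<delta> u + \<delta> w" and \<delta>_scale: "\<delta> (sscale f u) = anchor u f + f * \<delta> u"
    if "u \<in> S" "w \<in> S" "f \<in> C" for u w f
    using \<delta> that unfolding divergence_operator_def by blast+
  have \<delta>0: "\<delta> 0 = 0"
    using \<delta>_add[of 0 0 0] by simp
  have \<delta>_sum: "\<delta> (\<Sum>i\<in>T. f i) = (\<Sum>i\<in>T. \<delta> (f i))" if "\<And>i. i \<in> T \<Longrightarrow> f i \<in> S" for f :: "nat \<Rightarrow> 'g sec" and T
    using that by (induction T rule: infinite_finite_induct) (auto simp: \<delta>0 \<delta>_add[of _ _ 0])
  have "connection_div G D u = \<delta> u" if u: "u \<in> S" for u
  proof -
    have k: "const_fun (\<eta>r A) * pairing u (E A) \<in> C" if "A \<in> {0..6}" for A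
      using u that e_mem[OF that] pairing_mem by simp
    have "\<delta> u = \<delta> (\<Sum>A\<in>{0..6}. sscale (const_fun (\<eta>r A) * pairing u (E A)) (E A))"
      using e_expand[OF u] by simp
    also have "\<dots> = (\<Sum>A\<in>{0..6}. \<delta> (sscale (const_fun (\<eta>r A) * pairing u (E A)) (E A)))"
      by (rule \<delta>_sum) (rule cf.M(3)[OF k e_mem])
    also have "\<dots> = (\<Sum>A\<in>{0..6}. anchor (E A) (const_fun (\<eta>r A) * pairing u (E A)) + const_fun (\<eta>r A) * pairing u (E A) * const_fun (d A))"
      by (rule sum.cong[OF refl]) (simp only: \<delta>_scale[OF e_mem e_mem k] d)
    finally have \<delta>u: "\<delta> u = \<dots>" .
    show ?thesis
      unfolding connection_div_def cf.connection_trace[OF conn u] \<delta>u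
      by (rule sum.cong[OF refl]) (simp only: tr)
  qed
  then show ?thesis
    using D unfolding levi_civita_div_def levi_civita_iff by blast
qed

text \<open>The Ricci tensors are the same for every Levi-Civita connection with divergence \<open>\<delta>\<close>, so it suffices that
  there is at least one.\<close>

theorem generalized_einstein_iff:
  assumes \<delta>: "divergence_operator G \<delta>" and d: "\<And>A. A \<in> {0..6} \<Longrightarrow> \<delta> (E A) = const_fun (d A)"
  shows "generalized_einstein G g H F \<delta> \<longleftrightarrow>
    (\<forall>b\<in>{4..6}. \<forall>j\<in>{0..3}. ricci_coeff d {0..3} {4..6} b j = 0) \<and>
    (\<forall>b\<in>{0..3}. \<forall>j\<in>{4..6}. ricci_coeff d {4..6} {0..3} b j = 0)"
proof -
  let ?plus = "\<lambda>D. \<forall>u\<in>E_minus G g. \<forall>w\<in>E_plus G g. ricci_plus G g H F D u w = 0"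
  let ?minus = "\<lambda>D. \<forall>u\<in>E_plus G g. \<forall>w\<in>E_minus G g. ricci_minus G g H F D u w = 0"
  let ?P = "\<forall>b\<in>{4..6}. \<forall>j\<in>{0..3}. ricci_coeff d {0..3} {4..6} b j = 0"
  let ?M = "\<forall>b\<in>{0..3}. \<forall>j\<in>{4..6}. ricci_coeff d {4..6} {0..3} b j = 0"
  have iff: "?plus D \<and> ?minus D \<longleftrightarrow> ?P \<and> ?M" if D: "levi_civita_div G g H F \<delta> D" for D
  proof -
    note D' = D[unfolded levi_civita_div_def levi_civita_iff]
    have LC: "cf.LC {4..6} D" and tr: "\<And>u. u \<in> S \<Longrightarrow> connection_div G D u = \<delta> u"
      using conjunct1[OF D'] bspec[OF conjunct2[OF D']] by simp_all
    have "connection_div G D (E k) = const_fun (d k)" if "k \<in> {0..6}" for k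
      using tr[OF e_mem[OF that]] d[OF that] by (rule trans)
    then show ?thesis
      using ricci_vanishes_iff[OF LC, of d] by (simp only:)
  qed
  obtain D where D: "levi_civita_div G g H F \<delta> D"
    using levi_civita_div_exists[OF assms] ..
  show ?thesis
    unfolding generalized_einstein_def
  proof
    assume A: "(\<exists>D. levi_civita_div G g H F \<delta> D) \<and> (\<forall>D. levi_civita_div G g H F \<delta> D \<longrightarrow> ?plus D \<and> ?minus D)"
    have "?plus D \<and> ?minus D"
      by (rule mp[OF spec[OF conjunct2[OF A]] D])
    then show "?P \<and> ?M"
      by (simp only: iff[OF D])
  next
    assume "?P \<and> ?M"
    then show "(\<exists>D. levi_civita_div G g H F \<delta> D) \<and> (\<forall>D. levi_civita_div G g H F \<delta> D \<longrightarrow> ?plus D \<and> ?minus D)"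
      using D iff by (intro conjI exI[of _ D] allI impI) (assumption, (drule iff, simp)+)
  qed
qed

end

section \<open>The polynomial system and its solutions\<close>

text \<open>The 24 components of the two Ricci tensors: \<open>R\<close> stands for the tensor obtained from a trace over \<open>E\<^sub>+\<close>, \<open>S\<close> for
  the other one, and the digits are the indices of the two frame vectors. Here \<open>f = F\<^sub>1\<^sub>2 = - F\<^sub>1\<^sub>3\<close> and
  \<open>k = F\<^sub>2\<^sub>3\<close>; the letters \<open>l, m, n, r\<close> stand for \<open>\<lambda>, \<mu>, \<nu>, \<rho>\<close> and \<open>e\<close> for \<open>\<epsilon>\<^sub>1\<close>.\<close>

locale einstein_system =
  fixes e l m n r h f k :: real and d :: "nat \<Rightarrow> real"
  assumes R40: "n * k - e * f * d 2 - e * f * d 3 - h * k = 0"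
    and R41: "h\<^sup>2 / 2 - e * l * d 2 - e * l * d 3 - n\<^sup>2 / 2 = 0"
    and R42: "f * d 0 + e * l * d 1 + e * h * d 3 / 2 + l * n / 2 + l * h / 2 + r * h / 2 - e * n * d 3 / 2 - e * f * k - n * r / 2 = 0"
    and R43: "e * h * d 2 / 2 + e * f * k + n * r / 2 - f * d 0 - e * l * d 1 - e * n * d 2 / 2 - l * n / 2 - l * h / 2 - r * h / 2 = 0"
    and R50: "e * f * d 1 + e * k * d 3 + r * k - h * f = 0"
    and R51: "l * n / 2 - f * d 0 - e * m * d 2 - e * m * d 3 - e * n * d 3 / 2 - e * h * d 3 / 2 - e * f * k - n * r / 2 - r * h / 2 - l * h / 2 = 0"
    and R52: "e * m * d 1 + e * k\<^sup>2 + n\<^sup>2 / 2 + h\<^sup>2 / 2 - e * r * d 3 - e * f\<^sup>2 - l\<^sup>2 - m * n - r\<^sup>2 = 0"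
    and R53: "k * d 0 + e * f\<^sup>2 + l\<^sup>2 + m * n + r\<^sup>2 - e * m * d 1 - e * n * d 1 / 2 - e * h * d 1 / 2 - e * r * d 2 = 0"
    and R60: "e * k * d 2 + h * f - e * f * d 1 - r * k = 0"
    and R61: "f * d 0 + e * m * d 2 + e * m * d 3 + e * f * k + l * h / 2 + n * r / 2 + r * h / 2 - e * n * d 2 / 2 - e * h * d 2 / 2 - l * n / 2 = 0"
    and R62: "e * n * d 1 / 2 + e * h * d 1 / 2 + e * r * d 3 + e * f\<^sup>2 + l\<^sup>2 + m * n + r\<^sup>2 - k * d 0 - e * m * d 1 = 0"
    and R63: "e * m * d 1 + e * r * d 2 - e * f\<^sup>2 - e * k\<^sup>2 - l\<^sup>2 - m * n - n\<^sup>2 / 2 - h\<^sup>2 / 2 - r\<^sup>2 = 0"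
    and S04: "n * k - e * f * d 5 - e * f * d 6 - h * k = 0"
    and S05: "e * f * d 4 + e * k * d 6 + r * k - h * f = 0"
    and S06: "e * k * d 5 + h * f - e * f * d 4 - r * k = 0"
    and S14: "h\<^sup>2 / 2 - e * l * d 5 - e * l * d 6 - n\<^sup>2 / 2 = 0"
    and S15: "e * l * d 4 + l * n / 2 - e * n * d 6 / 2 - e * h * d 6 / 2 - l * h / 2 - e * f * k - n * r / 2 - r * h / 2 = 0"
    and S16: "l * h / 2 + e * f * k + n * r / 2 + r * h / 2 - e * l * d 4 - e * n * d 5 / 2 - e * h * d 5 / 2 - l * n / 2 = 0"
    and S24: "e * h * d 6 / 2 + r * h / 2 + l * n / 2 + l * h / 2 - e * m * d 5 - e * m * d 6 - e * n * d 6 / 2 - n * r / 2 - e * f * k = 0"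
    and S25: "e * m * d 4 + n\<^sup>2 / 2 + h\<^sup>2 / 2 + e * k\<^sup>2 - e * r * d 6 - e * f\<^sup>2 - l\<^sup>2 - m * n - r\<^sup>2 = 0"
    and S26: "e * h * d 4 / 2 + e * f\<^sup>2 + l\<^sup>2 + m * n + r\<^sup>2 - e * m * d 4 - e * n * d 4 / 2 - e * r * d 5 = 0"
    and S34: "e * m * d 5 + e * h * d 5 / 2 + e * m * d 6 + e * f * k + n * r / 2 - e * n * d 5 / 2 - l * n / 2 - l * h / 2 - r * h / 2 = 0"
    and S35: "e * n * d 4 / 2 + e * r * d 6 + e * f\<^sup>2 + l\<^sup>2 + m * n + r\<^sup>2 - e * m * d 4 - e * h * d 4 / 2 = 0"
    and S36: "e * m * d 4 + e * r * d 5 - e * f\<^sup>2 - l\<^sup>2 - m * n - n\<^sup>2 / 2 - h\<^sup>2 / 2 - e * k\<^sup>2 - r\<^sup>2 = 0"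

text \<open>The sum \<open>\<delta>\<^sub>2 + \<delta>\<^sub>3\<close> is multiplied by \<open>h - n\<close>, \<open>h + n\<close>, \<open>k\<close> and, once these vanish, by \<open>f\<close> in suitable
  equations; since \<open>F \<noteq> 0\<close> it must be zero, and likewise \<open>\<delta>\<^sub>5 + \<delta>\<^sub>6\<close>. What remains are \<open>h\<^sup>2 = n\<^sup>2\<close> and
  \<open>e k\<^sup>2 + n\<^sup>2 = 0\<close>. If \<open>n = 0\<close> this leaves only \<open>f\<close>, which is the first family; otherwise \<open>e = -1\<close>,
  \<open>h = n\<close> and \<open>k = \<plusminus>n\<close>, which is the second one.\<close>

lemma (in einstein_system) families:
  assumes e: "e = 1 \<or> e = -1" and fk: "f \<noteq> 0 \<or> k \<noteq> 0"
  shows "(n = 0 \<and> k = 0 \<and> h = 0 \<and> f\<^sup>2 = - e * (l\<^sup>2 + r\<^sup>2) + r * d 2 \<and> f \<noteq> 0 \<and> r * (d 2 - d 5) = 0 \<and>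
      d 3 = - d 2 \<and> d 6 = - d 5 \<and> d 0 = 0 \<and> d 1 = 0 \<and> d 4 = 0)
    \<or> (\<exists>\<kappa>\<in>{1, -1}. n \<noteq> 0 \<and> k = \<kappa> * n \<and> f = - \<kappa> * l \<and> e = -1 \<and> h = n \<and> d 0 = - \<kappa> * d 1 \<and>
      (l * r - m * n) * (d 1 + n) = 0 \<and> (l * r - m * n) * (d 1 - d 4) = 0 \<and>
      d 3 = - d 2 \<and> d 3 = l + r + l / n * d 1 \<and> d 6 = - d 5 \<and> d 6 = l + r + l / n * d 4)"
proof -
  have ee: "e * e = 1" and e0: "e \<noteq> 0" using e by auto
  have s: "d 2 + d 3 = 0"
  proof (rule ccontr)
    assume s: "d 2 + d 3 \<noteq> 0"
    have "e * (h - n) * (d 2 + d 3) = 0" using R42 R43 by algebra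
    then have hn: "h = n" using s e0 by simp
    have "e * (h + n) * (d 2 + d 3) = 0" using R51 R61 by algebra
    then have "h + n = 0" using s e0 by simp
    with hn have n: "n = 0" "h = 0" by auto
    have "e * k * (d 2 + d 3) = 0" using R50 R60 by algebra
    then have k: "k = 0" using s e0 by simp
    have "e * f * (d 2 + d 3) = 0" using R40 n k by algebra
    then have "f = 0" using s e0 by simp
    with k fk show False by simp
  qed
  have t: "d 5 + d 6 = 0"
  proof (rule ccontr)
    assume t: "d 5 + d 6 \<noteq> 0"
    have "e * (h - n) * (d 5 + d 6) = 0" using S24 S34 by algebra
    then have hn: "h = n" using t e0 by simp
    have "e * (h + n) * (d 5 + d 6) = 0" using S15 S16 by algebra
    then have "h + n = 0" using t e0 by simp
    with hn have n: "n = 0" "h = 0" by auto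
    have "e * k * (d 5 + d 6) = 0" using S05 S06 by algebra
    then have k: "k = 0" using t e0 by simp
    have "e * f * (d 5 + d 6) = 0" using S04 n k by algebra
    then have "f = 0" using t e0 by simp
    with k fk show False by simp
  qed
  from s t have d3: "d 3 = - d 2" and d6: "d 6 = - d 5" by simp_all
  have hn: "h\<^sup>2 = n\<^sup>2" using R41 d3 by algebra
  have kn: "e * k\<^sup>2 + n\<^sup>2 = 0" proof -
    have "2 * (e * k\<^sup>2 + n\<^sup>2) = (e * m * d 1 + e * k\<^sup>2 + n\<^sup>2 / 2 + h\<^sup>2 / 2 - e * r * d 3 - e * f\<^sup>2 - l\<^sup>2 - m * n - r\<^sup>2)
        - (e * m * d 1 + e * r * d 2 - e * f\<^sup>2 - e * k\<^sup>2 - l\<^sup>2 - m * n - n\<^sup>2 / 2 - h\<^sup>2 / 2 - r\<^sup>2)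
        + e * r * (d 2 + d 3) - (h\<^sup>2 - n\<^sup>2)"
      by (simp add: field_simps)
    then show ?thesis
      by (simp only: R52 R63 s) (simp add: hn)
  qed
  show ?thesis
  proof (cases "n = 0")
    case True
    then have h: "h = 0" and k: "k = 0" using hn kn e0 by auto
    with fk have f: "f \<noteq> 0" by simp
    have "e * f * d 1 = 0" using R50 h k by algebra
    then have d1: "d 1 = 0" using e0 f by simp
    have "f * d 0 = 0" using R42 d1 h k True by algebra
    then have d0: "d 0 = 0" using f by simp
    have "e * f * d 4 = 0" using S05 h k by algebra
    then have d4: "d 4 = 0" using e0 f by simp
    have ff: "f\<^sup>2 = - e * (l\<^sup>2 + r\<^sup>2) + r * d 2" using R52 d1 d3 h k True ee by algebra
    have "r * (d 2 - d 5) = 0" using S25 d4 d6 h k True ee ff by algebra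
    then show ?thesis using True h k f d0 d1 d4 d3 d6 ff by simp
  next
    case False
    then have k0: "k \<noteq> 0" using kn by auto
    have e1: "e = -1"
    proof (rule ccontr)
      assume "e \<noteq> -1"
      with e have "k\<^sup>2 + n\<^sup>2 = 0" using kn by simp
      then show False using False by simp
    qed
    have "k\<^sup>2 = n\<^sup>2" using kn e1 by simp
    then have "k = n \<or> k = - n" by (simp add: power2_eq_iff)
    then obtain \<kappa> :: real where \<kappa>: "\<kappa> \<in> {1, -1}" "k = \<kappa> * n" by force
    have \<kappa>\<kappa>: "\<kappa> * \<kappa> = 1" using \<kappa>(1) by auto
    then have \<kappa>0: "\<kappa> \<noteq> 0" by auto
    have "k * (n - h) = 0" using R40 d3 by algebra
    then have h: "h = n" using k0 by simp
    have "n * (d 0 * \<kappa> + d 1) = 0" using R53 R62 \<kappa>(2) h e1 d3 by algebra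
    then have "d 0 * \<kappa> = - d 1" using False by (simp add: eq_neg_iff_add_eq_0)
    then have d0: "d 0 = - \<kappa> * d 1" using \<kappa>\<kappa> by algebra
    have d3n: "n * (d 3 - r) = - \<kappa> * f * (d 1 + n)" using R50 \<kappa>(2) h e1 \<kappa>\<kappa> by algebra
    have d6n: "n * (d 6 - r) = - \<kappa> * f * (d 4 + n)" using S05 \<kappa>(2) h e1 \<kappa>\<kappa> by algebra
    \<comment> \<open>\<open>R42\<close> would only give \<open>(\<kappa>f + l)(n - d 1) = 0\<close>; it is the other Ricci tensor that determines \<open>f\<close>.\<close>
    have "n * (\<kappa> * f + l) = 0" using S24 \<kappa>(2) h e1 d6 by algebra
    then have "\<kappa> * f = - l" using False by (simp add: eq_neg_iff_add_eq_0)
    then have f: "f = - \<kappa> * l" using \<kappa>\<kappa> by algebra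
    have "n * (d 3 - r) = l * (d 1 + n)" using d3n f \<kappa>\<kappa> by algebra
    then have d3': "d 3 = l + r + l / n * d 1" using False by (simp add: field_simps)
    have d6_mult: "n * (d 6 - r) = l * (d 4 + n)" using d6n f \<kappa>\<kappa> by algebra
    then have d6': "d 6 = l + r + l / n * d 4" using False by (simp add: field_simps)
    have "(l * r - m * n) * (d 1 + n) = 0"
      using R52 e1 h \<kappa>(2) \<kappa>\<kappa> f \<open>n * (d 3 - r) = l * (d 1 + n)\<close> by algebra
    moreover have "(l * r - m * n) * (d 4 + n) = 0"
      using S25 e1 h \<kappa>(2) \<kappa>\<kappa> f d6_mult by algebra
    ultimately have "(l * r - m * n) * (d 1 + n) = 0" "(l * r - m * n) * (d 1 - d 4) = 0"
      by algebra+
    then show ?thesis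
      using False \<kappa> f e1 h d0 d3 d6 d3' d6' by blast
  qed
qed

lemma einstein_system_family1:
  fixes d :: "nat \<Rightarrow> real"
  assumes e: "e = 1 \<or> e = -1"
    and "n = 0" "k = 0" "h = 0" "f\<^sup>2 = - e * (l\<^sup>2 + r\<^sup>2) + r * d 2" "r * (d 2 - d 5) = 0"
      "d 3 = - d 2" "d 6 = - d 5" "d 0 = 0" "d 1 = 0" "d 4 = 0"
  shows "einstein_system e l m n r h f k d"
proof -
  have "e * e = 1" using e by auto
  moreover have "r * d 5 = r * d 2" using assms(6) by algebra
  ultimately show ?thesis
    using assms(2-) by unfold_locales algebra+
qed

lemma einstein_system_family2:
  fixes d :: "nat \<Rightarrow> real"
  assumes n: "n \<noteq> 0" and \<kappa>: "\<kappa> \<in> {1, -1}"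
    and eqs: "k = \<kappa> * n" "f = - \<kappa> * l" "e = -1" "h = n" "d 0 = - \<kappa> * d 1"
      "(l * r - m * n) * (d 1 + n) = 0" "(l * r - m * n) * (d 1 - d 4) = 0"
      "d 3 = - d 2" "d 3 = l + r + l / n * d 1" "d 6 = - d 5" "d 6 = l + r + l / n * d 4"
  shows "einstein_system e l m n r h f k d"
proof -
  have \<kappa>\<kappa>: "\<kappa> * \<kappa> = 1" using \<kappa> by auto
  have d3: "n * d 3 = n * (l + r) + l * d 1" and d6: "n * d 6 = n * (l + r) + l * d 4"
    using n unfolding eqs(9,11) by (simp_all add: field_simps)
  \<comment> \<open>The polynomial identities hold after multiplication by \<open>n\<close>, which clears the denominators of
    the formulas for \<open>d 3\<close> and \<open>d 6\<close>.\<close>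
  have cancel: "x = 0" if "n * x = 0" for x using that n by simp
  show ?thesis
    by (unfold_locales; rule cancel; insert eqs(1-8,10) d3 d6 \<kappa>\<kappa>; algebra)
qed

section \<open>The Ricci tensors of the given Lie algebras\<close>

definition structure_const :: "real \<Rightarrow> real \<Rightarrow> real \<Rightarrow> real \<Rightarrow> real \<Rightarrow> nat \<Rightarrow> nat \<Rightarrow> nat \<Rightarrow> real" where
  "structure_const e l m n r a b c =
     (if (a, b) = (1, 2) \<or> (a, b) = (3, 1) then e * (if c = 1 then l else m)
      else if (a, b) = (2, 1) \<or> (a, b) = (1, 3) then - e * (if c = 1 then l else m)
      else if (a, b) = (2, 3) then - e * (if c = 1 then n else r)
      else if (a, b) = (3, 2) then e * (if c = 1 then n else r)
      else 0)"

text \<open>The components of \<open>v\<^sub>1\<^sup>* \<and> v\<^sub>2\<^sup>* \<and> v\<^sub>3\<^sup>*\<close>, written out as in the definition of the triple wedge product.\<close>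

definition volume_form :: "nat \<Rightarrow> nat \<Rightarrow> nat \<Rightarrow> real" where
  "volume_form a b c = (let \<delta> = \<lambda>i j. if i = j then 1 else 0 in
     \<delta> 1 a * (\<delta> 2 b * \<delta> 3 c - \<delta> 2 c * \<delta> 3 b) - \<delta> 1 b * (\<delta> 2 a * \<delta> 3 c - \<delta> 2 c * \<delta> 3 a)
     + \<delta> 1 c * (\<delta> 2 a * \<delta> 3 b - \<delta> 2 b * \<delta> 3 a))"

lemma (in left_inv_courant) ricci_equations:
  assumes str: "\<And>a b c. str a b c = structure_const e l m n r a b c"
    and Hc: "\<And>a b c. Hc a b c = h * volume_form a b c"
    and eps: "\<epsilon> 1 = e" "\<epsilon> 2 = e" "\<epsilon> 3 = - e" and e: "e = 1 \<or> e = -1"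
    and Fc: "Fc 1 1 = 0" "Fc 2 2 = 0" "Fc 3 3 = 0" "Fc 2 1 = - f" "Fc 1 2 = f" "Fc 1 3 = - f" "Fc 3 1 = f"
      "Fc 2 3 = k" "Fc 3 2 = - k"
  shows "(\<forall>b\<in>{4..6}. \<forall>j\<in>{0..3}. ricci_coeff d {0..3} {4..6} b j = 0) \<and>
     (\<forall>b\<in>{0..3}. \<forall>j\<in>{4..6}. ricci_coeff d {4..6} {0..3} b j = 0) \<longleftrightarrow> einstein_system e l m n r h f k d"
proof -
  have sets: "{0..3} = {0, 1, 2, 3::nat}" "{4..6} = {4, 5, 6::nat}" by auto
  note defs = ricci_coeff_def \<eta>r_def frame_coeff_def sg_def ix_def str structure_const_def Hc volume_form_def eps
    eps[unfolded One_nat_def] Fc Fc[unfolded One_nat_def]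
  have components: "(\<forall>b\<in>{4..6}. \<forall>j\<in>{0..3}. P b j) \<longleftrightarrow> P 4 0 \<and> P 4 1 \<and> P 4 2 \<and> P 4 3 \<and> P 5 0 \<and> P 5 1 \<and> P 5 2 \<and> P 5 3
      \<and> P 6 0 \<and> P 6 1 \<and> P 6 2 \<and> P 6 3"
    "(\<forall>b\<in>{0..3}. \<forall>j\<in>{4..6}. P b j) \<longleftrightarrow> P 0 4 \<and> P 0 5 \<and> P 0 6 \<and> P 1 4 \<and> P 1 5 \<and> P 1 6 \<and> P 2 4 \<and> P 2 5
      \<and> P 2 6 \<and> P 3 4 \<and> P 3 5 \<and> P 3 6" for P :: "nat \<Rightarrow> nat \<Rightarrow> bool"
    unfolding sets by auto
  show ?thesis
    unfolding components einstein_system_def conj_assoc unfolding sets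
    by (intro arg_cong2[where f = "(\<and>)"] arg_cong[where f = "\<lambda>x. x = 0"]; rule disjE[OF e])
      (simp_all add: defs field_simps power2_eq_square)
qed

section \<open>Classification of the generalized Einstein metrics\<close>

theorem theorem33:
  fixes G :: "('g::{t2_space, second_countable_topology}) lie_group"
    and g F :: "'g tensor2" and H :: "'g tensor3"
    and \<delta> :: "'g sec \<Rightarrow> 'g cfun"
    and v :: "nat \<Rightarrow> 'g vfield" and \<theta> :: "nat \<Rightarrow> 'g form1"
    and \<epsilon> \<delta>c :: "nat \<Rightarrow> real" and Fc :: "nat \<Rightarrow> nat \<Rightarrow> real"
    and lam \<mu> \<nu> \<rho> h :: real
  assumes G: "lie_group3 G"
    and non_unimodular: "unimodular_kernel G \<noteq> lie_algebra G"
    and metric: "pseudo_riemannian G g" "left_inv2 G g"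
    and degenerate: "\<exists>x\<in>unimodular_kernel G. x \<noteq> 0 \<and> (\<forall>y\<in>unimodular_kernel G. g x y = 0)"
    and basis: "is_basis (UNIV :: real set) rscale (lie_algebra G) {1..3} v"
    and orthonormal:
      "\<And>a. a \<in> {1..3} \<Longrightarrow> \<epsilon> a = 1 \<or> \<epsilon> a = -1"
      "\<And>a b. a \<in> {1..3} \<Longrightarrow> b \<in> {1..3} \<Longrightarrow> g (v a) (v b) = const_fun (if a = b then \<epsilon> a else 0)"
    and signs: "\<epsilon> 1 = \<epsilon> 2" "\<epsilon> 2 = - \<epsilon> 3"
    and brackets:
      "lie_bracket (v 1) (v 2) = rscale (\<epsilon> 1) (rscale lam (v 1) + rscale \<mu> (v 2) + rscale \<mu> (v 3))"
      "lie_bracket (v 2) (v 3) = rscale (- \<epsilon> 1) (rscale \<nu> (v 1) + rscale \<rho> (v 2) + rscale \<rho> (v 3))"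
      "lie_bracket (v 3) (v 1) = rscale (\<epsilon> 1) (rscale lam (v 1) + rscale \<mu> (v 2) + rscale \<mu> (v 3))"
    and lam_rho: "lam + \<rho> \<noteq> 0"
    and dual_basis:
      "\<And>a. a \<in> {1..3} \<Longrightarrow> \<theta> a \<in> one_forms G"
      "\<And>a b. a \<in> {1..3} \<Longrightarrow> b \<in> {1..3} \<Longrightarrow> \<theta> a (v b) = const_fun (if a = b then 1 else 0)"
    and H: "H \<in> three_forms G" "left_inv3 G H"
      "H = (\<lambda>X Y Z. const_fun h * wedge3 (\<theta> 1) (\<theta> 2) (\<theta> 3) X Y Z)"
    and F: "F \<in> two_forms G" "left_inv2 G F" "closed2 G F" "F \<noteq> 0"
      "\<And>a b. a \<in> {1..3} \<Longrightarrow> b \<in> {1..3} \<Longrightarrow> F (v a) (v b) = const_fun (Fc a b)"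
      "F = (\<lambda>X Y. \<Sum>a\<in>{1..3}. \<Sum>b\<in>{1..3}. const_fun (1/2 * Fc a b) * wedge2 (\<theta> a) (\<theta> b) X Y)"
    and div: "left_inv_divergence G \<delta>"
      "\<And>A. A \<in> {0..6} \<Longrightarrow> \<delta> (e_basis g v A) = const_fun (\<delta>c A)"
  shows "generalized_einstein G g H F \<delta> \<longleftrightarrow>
    (lam + \<rho> \<noteq> 0 \<and> \<nu> = 0 \<and> Fc 2 3 = 0 \<and> h = 0 \<and> Fc 1 3 = - Fc 1 2 \<and>
     (Fc 1 2)\<^sup>2 = - \<epsilon> 1 * (lam\<^sup>2 + \<rho>\<^sup>2) + \<rho> * \<delta>c 2 \<and> - \<epsilon> 1 * (lam\<^sup>2 + \<rho>\<^sup>2) + \<rho> * \<delta>c 2 > 0 \<and>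
     \<rho> * (\<delta>c 2 - \<delta>c 5) = 0 \<and> \<delta>c 3 = - \<delta>c 2 \<and> \<delta>c 6 = - \<delta>c 5 \<and>
     \<delta>c 0 = 0 \<and> \<delta>c 1 = 0 \<and> \<delta>c 4 = 0)
    \<or>
    (\<exists>\<epsilon>'\<in>{1, -1::real}.
     \<nu> * (lam + \<rho>) \<noteq> 0 \<and> Fc 2 3 = \<epsilon>' * \<nu> \<and> Fc 1 2 = - Fc 1 3 \<and> - Fc 1 3 = - \<epsilon>' * lam \<and>
     \<epsilon> 1 = -1 \<and> h = \<nu> \<and> \<delta>c 0 = - \<epsilon>' * \<delta>c 1 \<and>
     (lam * \<rho> - \<mu> * \<nu>) * (\<delta>c 1 + \<nu>) = 0 \<and> (lam * \<rho> - \<mu> * \<nu>) * (\<delta>c 1 - \<delta>c 4) = 0 \<and>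
     \<delta>c 3 = - \<delta>c 2 \<and> - \<delta>c 2 = lam + \<rho> + lam / \<nu> * \<delta>c 1 \<and>
     \<delta>c 6 = - \<delta>c 5 \<and> - \<delta>c 5 = lam + \<rho> + lam / \<nu> * \<delta>c 4)"
  (is "_ \<longleftrightarrow> ?family1 \<or> ?family2")
proof -
  note F_hyps = F and H_hyps = H and metric_hyps = metric
  have three: "{1..3} = {1, 2, 3::nat}" by auto
  define str where "str = structure_const (\<epsilon> 1) lam \<mu> \<nu> \<rho>"
  interpret lie3 G by (rule lie3.intro[OF G])
  interpret framed G v \<theta>
    by unfold_locales (use basis dual_basis in auto)
  have bracket_v: "lie_bracket (v a) (v b) = (\<Sum>k\<in>{1..3}. rscale (str a b k) (v k))"
    if "a \<in> {1..3}" "b \<in> {1..3}" for a b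
  proof -
    have "a = 1 \<or> a = 2 \<or> a = 3" "b = 1 \<or> b = 2 \<or> b = 3" using that by auto
    moreover have "lie_bracket (v 2) (v 1) = - lie_bracket (v 1) (v 2)"
      "lie_bracket (v 3) (v 2) = - lie_bracket (v 2) (v 3)" "lie_bracket (v 1) (v 3) = - lie_bracket (v 3) (v 1)"
      by (rule lie_bracket_skew)+
    ultimately show ?thesis
      unfolding three
      by (elim disjE)
        (simp_all add: brackets brackets[unfolded One_nat_def] lie_bracket_self str_def structure_const_def
          rscale_def cscale_def fun_eq_iff algebra_simps)
  qed
  have H_v: "H (v a) (v b) (v c) = const_fun (h * volume_form a b c)"
    if "a \<in> {1..3}" "b \<in> {1..3}" "c \<in> {1..3}" for a b c
  proof -
    have \<theta>_v: "\<theta> i (v j) = const_fun (if i = j then 1 else 0)" if "i \<in> {1, 2, 3}" "j \<in> {1..3}" for i j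
      using dual_basis(2) that unfolding three by blast
    show ?thesis
      unfolding H_hyps(3) wedge3_def wedge2_def volume_form_def Let_def
      by (simp only: \<theta>_v that insert_iff simp_thms const_fun_arith)
  qed
  interpret left_inv_courant G v \<theta> g F H \<epsilon> str Fc "\<lambda>a b c. h * volume_form a b c"
  proof unfold_locales
    fix a b c :: nat assume a: "a \<in> {1..3}"
    show "\<epsilon> a = 1 \<or> \<epsilon> a = - 1" by (rule orthonormal(1)[OF a])
    assume b: "b \<in> {1..3}"
    show "g (v a) (v b) = const_fun (if a = b then \<epsilon> a else 0)" by (rule orthonormal(2)[OF a b])
    show "lie_bracket (v a) (v b) = (\<Sum>k\<in>{1..3}. rscale (str a b k) (v k))" by (rule bracket_v[OF a b])
    show "F (v a) (v b) = const_fun (Fc a b)" by (rule F_hyps(5)[OF a b])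
    assume c: "c \<in> {1..3}"
    show "H (v a) (v b) (v c) = const_fun (h * volume_form a b c)" by (rule H_v[OF a b c])
  qed (fact metric_hyps(1) F_hyps(1) H_hyps(1))+
  have mem: "1 \<in> {1..3::nat}" "2 \<in> {1..3::nat}" "3 \<in> {1..3::nat}" by auto
  have Fc_skew: "Fc b a = - Fc a b" if "a \<in> {1..3}" "b \<in> {1..3}" for a b
    using F_skew[OF v_VF[OF that(2)] v_VF[OF that(1)]] F_hyps(5)[OF that(2,1)] F_hyps(5)[OF that] by (simp add: const_fun_arith)
  have Fc_diag: "Fc a a = 0" if "a \<in> {1..3}" for a
    using Fc_skew[OF that that] by simp
  have F_lin: "F (lie_bracket (v a) (v b)) (v c) = const_fun (\<Sum>k\<in>{1..3}. str a b k * Fc k c)"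
    if a: "a \<in> {1..3}" and b: "b \<in> {1..3}" and c: "c \<in> {1..3}" for a b c
  proof -
    note Fc_form = F_form[OF v_VF[OF c]]
    have "F (v c) (lie_bracket (v a) (v b)) = (\<Sum>k\<in>{1..3}. F (v c) (rscale (str a b k) (v k)))"
      unfolding bracket_v[OF a b] by (rule one_form_sum[OF Fc_form]) (rule VF_rscale[OF v_VF])
    also have "\<dots> = (\<Sum>k\<in>{1..3}. const_fun (str a b k * Fc c k))"
      by (rule sum.cong[OF refl])
        (simp only: rscale_def one_formD(3)[OF Fc_form smooth_const v_VF] F_hyps(5)[OF c] const_fun_arith)
    also have "\<dots> = const_fun (- (\<Sum>k\<in>{1..3}. str a b k * Fc k c))"
      unfolding const_fun_sum sum_negf[symmetric]
      by (rule arg_cong[where f = const_fun], rule sum.cong[OF refl]) (simp add: Fc_skew[OF c])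
    finally show ?thesis
      using F_skew[OF VF_bracket[OF v_VF[OF a] v_VF[OF b]] v_VF[OF c]] by (simp add: const_fun_arith)
  qed
  \<comment> \<open>\<open>dF(v\<^sub>1, v\<^sub>2, v\<^sub>3)\<close> is a nonzero multiple of \<open>(\<lambda> + \<rho>)(F\<^sub>1\<^sub>2 + F\<^sub>1\<^sub>3)\<close>.\<close>
  have closed: "Fc 1 3 = - Fc 1 2"
  proof -
    have "v 1 (F (v 2) (v 3)) - v 2 (F (v 1) (v 3)) + v 3 (F (v 1) (v 2))
        - F (lie_bracket (v 1) (v 2)) (v 3) + F (lie_bracket (v 1) (v 3)) (v 2) - F (lie_bracket (v 2) (v 3)) (v 1) = 0"
      using F_hyps(3) v_VF[OF mem(1)] v_VF[OF mem(2)] v_VF[OF mem(3)] unfolding closed2_def by blast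
    then have "- (\<Sum>k\<in>{1..3}. str 1 2 k * Fc k 3) + (\<Sum>k\<in>{1..3}. str 1 3 k * Fc k 2) - (\<Sum>k\<in>{1..3}. str 2 3 k * Fc k 1) = 0"
      unfolding F_lin[OF mem(1,2,3)] F_lin[OF mem(1,3,2)] F_lin[OF mem(2,3,1)]
        F_hyps(5)[OF mem(2,3)] F_hyps(5)[OF mem(1,3)] F_hyps(5)[OF mem(1,2)]
        VF_const[OF v_VF[OF mem(1)]] VF_const[OF v_VF[OF mem(2)]] VF_const[OF v_VF[OF mem(3)]]
      by (simp add: fun_eq_iff)
    then have "\<epsilon> 1 * (lam + \<rho>) * (Fc 1 2 + Fc 1 3) = 0"
      unfolding three str_def structure_const_def
      using Fc_skew[OF mem(1,2)] Fc_skew[OF mem(1,3)] Fc_skew[OF mem(2,3)] Fc_diag[OF mem(1)] Fc_diag[OF mem(2)] Fc_diag[OF mem(3)]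
      by (simp add: algebra_simps)
    then show ?thesis
      using orthonormal(1)[OF mem(1)] lam_rho by (auto simp: add.commute eq_neg_iff_add_eq_0)
  qed
  have F0: "Fc 1 2 \<noteq> 0 \<or> Fc 2 3 \<noteq> 0"
  proof (rule ccontr)
    assume "\<not> (Fc 1 2 \<noteq> 0 \<or> Fc 2 3 \<noteq> 0)"
    then have "Fc a b = 0" if "a \<in> {1, 2, 3}" "b \<in> {1, 2, 3}" for a b
      using that closed Fc_skew[OF mem(1,2)] Fc_skew[OF mem(1,3)] Fc_skew[OF mem(2,3)]
        Fc_diag[OF mem(1)] Fc_diag[OF mem(2)] Fc_diag[OF mem(3)] by auto
    then have "F = (\<lambda>X Y. \<Sum>a\<in>{1..3}. \<Sum>b\<in>{1..3}. 0)"
      unfolding F_hyps(6) three by (intro ext sum.cong refl) (simp add: fun_eq_iff)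
    then have "F = 0" by (simp add: fun_eq_iff)
    then show False using F_hyps(4) by simp
  qed
  have e: "\<epsilon> 1 = 1 \<or> \<epsilon> 1 = -1" by (rule orthonormal(1)[OF mem(1)])
  have "generalized_einstein G g H F \<delta> \<longleftrightarrow>
      (\<forall>b\<in>{4..6}. \<forall>j\<in>{0..3}. ricci_coeff \<delta>c {0..3} {4..6} b j = 0) \<and>
      (\<forall>b\<in>{0..3}. \<forall>j\<in>{4..6}. ricci_coeff \<delta>c {4..6} {0..3} b j = 0)"
  proof (rule generalized_einstein_iff)
    show "divergence_operator G \<delta>"
      using div(1) by (simp add: left_inv_divergence_def)
    show "\<delta> (E A) = const_fun (\<delta>c A)" if "A \<in> {0..6}" for A
      by (rule div(2)[OF that])
  qed
  also have "\<dots> \<longleftrightarrow> einstein_system (\<epsilon> 1) lam \<mu> \<nu> \<rho> h (Fc 1 2) (Fc 2 3) \<delta>c"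
    by (rule ricci_equations)
      (use e signs closed Fc_skew[OF mem(1,2)] Fc_skew[OF mem(1,3)] Fc_skew[OF mem(2,3)]
        Fc_diag[OF mem(1)] Fc_diag[OF mem(2)] Fc_diag[OF mem(3)] in \<open>simp_all add: str_def\<close>)
  also have "\<dots> \<longleftrightarrow> ?family1 \<or> ?family2"
  proof
    assume "einstein_system (\<epsilon> 1) lam \<mu> \<nu> \<rho> h (Fc 1 2) (Fc 2 3) \<delta>c"
    from einstein_system.families[OF this e F0] show "?family1 \<or> ?family2"
    proof
      assume *: "\<nu> = 0 \<and> Fc 2 3 = 0 \<and> h = 0 \<and> (Fc 1 2)\<^sup>2 = - \<epsilon> 1 * (lam\<^sup>2 + \<rho>\<^sup>2) + \<rho> * \<delta>c 2 \<and> Fc 1 2 \<noteq> 0 \<and>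
        \<rho> * (\<delta>c 2 - \<delta>c 5) = 0 \<and> \<delta>c 3 = - \<delta>c 2 \<and> \<delta>c 6 = - \<delta>c 5 \<and> \<delta>c 0 = 0 \<and> \<delta>c 1 = 0 \<and> \<delta>c 4 = 0"
      then have "Fc 1 2 \<noteq> 0" by blast
      then have "(Fc 1 2)\<^sup>2 > 0" by simp
      then have "- \<epsilon> 1 * (lam\<^sup>2 + \<rho>\<^sup>2) + \<rho> * \<delta>c 2 > 0" using * by metis
      then show ?thesis using * lam_rho closed by blast
    next
      assume "\<exists>\<kappa>\<in>{1, -1}. \<nu> \<noteq> 0 \<and> Fc 2 3 = \<kappa> * \<nu> \<and> Fc 1 2 = - \<kappa> * lam \<and> \<epsilon> 1 = -1 \<and> h = \<nu> \<and> \<delta>c 0 = - \<kappa> * \<delta>c 1 \<and>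
        (lam * \<rho> - \<mu> * \<nu>) * (\<delta>c 1 + \<nu>) = 0 \<and> (lam * \<rho> - \<mu> * \<nu>) * (\<delta>c 1 - \<delta>c 4) = 0 \<and>
        \<delta>c 3 = - \<delta>c 2 \<and> \<delta>c 3 = lam + \<rho> + lam / \<nu> * \<delta>c 1 \<and> \<delta>c 6 = - \<delta>c 5 \<and> \<delta>c 6 = lam + \<rho> + lam / \<nu> * \<delta>c 4"
      then obtain \<kappa> where \<kappa>: "\<kappa> \<in> {1, -1}" and *: "\<nu> \<noteq> 0 \<and> Fc 2 3 = \<kappa> * \<nu> \<and> Fc 1 2 = - \<kappa> * lam \<and> \<epsilon> 1 = -1 \<and> h = \<nu> \<and>
        \<delta>c 0 = - \<kappa> * \<delta>c 1 \<and>
        (lam * \<rho> - \<mu> * \<nu>) * (\<delta>c 1 + \<nu>) = 0 \<and> (lam * \<rho> - \<mu> * \<nu>) * (\<delta>c 1 - \<delta>c 4) = 0 \<and>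
        \<delta>c 3 = - \<delta>c 2 \<and> \<delta>c 3 = lam + \<rho> + lam / \<nu> * \<delta>c 1 \<and> \<delta>c 6 = - \<delta>c 5 \<and> \<delta>c 6 = lam + \<rho> + lam / \<nu> * \<delta>c 4" ..
      from * closed have "\<nu> * (lam + \<rho>) \<noteq> 0" "Fc 1 2 = - Fc 1 3" "- Fc 1 3 = - \<kappa> * lam"
        "- \<delta>c 2 = lam + \<rho> + lam / \<nu> * \<delta>c 1" "- \<delta>c 5 = lam + \<rho> + lam / \<nu> * \<delta>c 4"
        using lam_rho by auto
      with * have ?family2 by (intro bexI[OF _ \<kappa>]) (simp only: simp_thms)
      then show ?thesis ..
    qed
  next
    assume "?family1 \<or> ?family2"
    then show "einstein_system (\<epsilon> 1) lam \<mu> \<nu> \<rho> h (Fc 1 2) (Fc 2 3) \<delta>c"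
    proof
      assume ?family1
      then show ?thesis by (intro einstein_system_family1 e) simp_all
    next
      assume ?family2
      then obtain \<kappa> where \<kappa>: "\<kappa> \<in> {1, -1::real}" and *: "\<nu> * (lam + \<rho>) \<noteq> 0 \<and> Fc 2 3 = \<kappa> * \<nu> \<and> Fc 1 2 = - Fc 1 3 \<and>
        - Fc 1 3 = - \<kappa> * lam \<and> \<epsilon> 1 = -1 \<and> h = \<nu> \<and> \<delta>c 0 = - \<kappa> * \<delta>c 1 \<and>
        (lam * \<rho> - \<mu> * \<nu>) * (\<delta>c 1 + \<nu>) = 0 \<and> (lam * \<rho> - \<mu> * \<nu>) * (\<delta>c 1 - \<delta>c 4) = 0 \<and>
        \<delta>c 3 = - \<delta>c 2 \<and> - \<delta>c 2 = lam + \<rho> + lam / \<nu> * \<delta>c 1 \<and>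
        \<delta>c 6 = - \<delta>c 5 \<and> - \<delta>c 5 = lam + \<rho> + lam / \<nu> * \<delta>c 4" ..
      show ?thesis
        by (rule einstein_system_family2[OF _ \<kappa>]) (use * in simp_all)
    qed
  qed
  finally show ?thesis .
qed

end
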